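(* Let $d\ge 1$ and let $\xi\subset\mathbb{R}^d\setminus\{0\}$ be a locally finite set of points (deterministic, or random and independent of the fading variables below) such that there is a nondecreasing function $D:[0,\infty)\to[0,\infty)$ satisfying (almost surely if $\xi$ is random) $$\lim_{r\to\infty}\frac{|\xi|(r)}{D(r)}=1\quad\text{and}\quad \lim_{r\to 0}D(r)=0 .$$ Let $g:\mathbb{R}^d\to[0,\infty)$ be such that $g$ is positive on $\mathbb{R}^d\setminus\{0\}$ and $g(x)=h(|x|)$, where $h$ is a left continuous and nondecreasing function with inverse $h^{-1}(y):=\inf\{x:h(x)>y\}$. Let $(S(\sigma))_{\sigma\ge 0}$ be a family of positive random variables indexed by a non-negative parameter $\sigma$, and let $N^{(\sigma)}$ be the propagation process generated by $S(\sigma)$, $g$ and $\xi$. If, as $\sigma\to\infty$, (i) $S(\sigma)\to 0$ in probability, and (ii) $\mathbb{E}\,D\big(h^{-1}(S(\sigma)t)\big)\to L(t)$ for all $t\in C(L)$, where $C(L):=\{t\in(0,\infty):\lim_{s\to t}L(s)=L(t)\}$, then, as $\sigma\to\infty$, $N^{(\sigma)}$ converges weakly to a Poisson process on $(0,\infty)$ with mean measure $L$.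
   Context: $|x|$ is the Euclidean norm and $|\xi|(r)$ is the number of points of $\xi$ within distance $r$ of the origin. The propagation process generated by a positive random variable $S$, a function $g$ and a point configuration $\xi=\{x_i\}$ is the point process $\sum_i\delta_{g(x_i)/S_i}$ on $(0,\infty)$, where the $S_i$ are i.i.d. copies of $S$ (independent of $\xi$ if $\xi$ is random). Point processes on $(0,\infty)$ are random elements of the space of locally finite point measures on $(0,\infty)$ with the vague topology, and weak convergence is convergence in distribution with respect to this topology. $L$ denotes a Radon measure on $(0,\infty)$ and $L(t):=L((0,t])$ for $t>0$. Conventions: $\inf\emptyset=\infty$ and $D(\infty):=\lim_{r\to\infty}D(r)$.
   Formalization: The formal statement additionally assumes L(t) = L((0,t]) is finite for every t > 0; for Radon measures with infinite mass near 0, condition (ii) only says the expectation tends to infinity and the claimed convergence can fail. *)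

theory Defs
  imports "HOL-Probability.Probability"
begin

section \<open>Point configurations in Euclidean space\<close>

definition locally_finite_config :: "(real ^ 'n) set \<Rightarrow> bool" where
  "locally_finite_config \<xi> \<longleftrightarrow> \<xi> \<subseteq> - {0} \<and> (\<forall>r. finite {x \<in> \<xi>. norm x \<le> r})"

definition num_points :: "(real ^ 'n) set \<Rightarrow> real \<Rightarrow> nat" where
  "num_points \<xi> r = card {x \<in> \<xi>. norm x \<le> r}"

text \<open>A random configuration is written as a (finite or infinite) sequence of distinct random
  points \<open>X 0, X 1, \<dots>\<close>, of random length \<open>\<kappa>\<close>; the values \<open>X i \<omega>\<close> with \<open>i \<ge> \<kappa> \<omega>\<close> are irrelevant.
  A deterministic configuration is the case where \<open>\<kappa>\<close> and all \<open>X i\<close> are constant.\<close>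

definition random_enumeration ::
  "'w measure \<Rightarrow> ('w \<Rightarrow> (real ^ 'n) set) \<Rightarrow> ('w \<Rightarrow> enat) \<Rightarrow> (nat \<Rightarrow> 'w \<Rightarrow> real ^ 'n) \<Rightarrow> bool" where
  "random_enumeration M \<xi> \<kappa> X \<longleftrightarrow>
     \<kappa> \<in> measurable M (count_space UNIV) \<and> (\<forall>i. X i \<in> borel_measurable M) \<and>
     (AE \<omega> in M. bij_betw (\<lambda>i. X i \<omega>) {i. enat i < \<kappa> \<omega>} (\<xi> \<omega>))"

section \<open>Point measures on the positive half line\<close>

definition pos_borel :: "real measure" where
  "pos_borel = restrict_space borel {0<..}"

text \<open>The sum of the Dirac measures at \<open>y i\<close> for \<open>i \<in> I\<close>, as the image of counting measure.\<close>

definition dirac_sum :: "'i set \<Rightarrow> ('i \<Rightarrow> real) \<Rightarrow> real measure" where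
  "dirac_sum I y = distr (count_space I) pos_borel y"

definition radon_pos :: "real measure \<Rightarrow> bool" where
  "radon_pos \<mu> \<longleftrightarrow> sets \<mu> = sets pos_borel \<and> (\<forall>K. compact K \<and> K \<subseteq> {0<..} \<longrightarrow> emeasure \<mu> K < \<infinity>)"

text \<open>Index sets in \<^typ>\<open>nat\<close> suffice, since a locally finite family of points is countable.\<close>

definition point_measures :: "real measure set" where
  "point_measures = {dirac_sum I y | (I :: nat set) y.
     (\<forall>i\<in>I. 0 < y i) \<and> radon_pos (dirac_sum I y)}"

definition test_function :: "(real \<Rightarrow> real) \<Rightarrow> bool" where
  "test_function f \<longleftrightarrow> continuous_on {0<..} f \<and>
     (\<exists>K. compact K \<and> K \<subseteq> {0<..} \<and> (\<forall>x\<in>{0<..} - K. f x = 0))"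

definition vague_topology :: "real measure topology" where
  "vague_topology = topology_generated_by
     {{\<nu> \<in> point_measures. (\<integral>x. f x \<partial>\<nu>) \<in> U} | f U. test_function f \<and> open U}"

definition borel_of :: "'a topology \<Rightarrow> 'a measure" where
  "borel_of T = sigma (topspace T) {U. openin T U}"

definition point_process :: "'w measure \<Rightarrow> ('w \<Rightarrow> real measure) \<Rightarrow> bool" where
  "point_process M N \<longleftrightarrow> N \<in> measurable M (borel_of vague_topology)"

definition weak_convergence ::
  "'a topology \<Rightarrow> ('i \<Rightarrow> 'a measure) \<Rightarrow> 'a measure \<Rightarrow> 'i filter \<Rightarrow> bool" where
  "weak_convergence T P Q F \<longleftrightarrow>
     (\<forall>\<phi>. continuous_map T euclideanreal \<phi> \<and> bounded (\<phi> ` topspace T) \<longrightarrow>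
        ((\<lambda>i. \<integral>\<nu>. \<phi> \<nu> \<partial>P i) \<longlongrightarrow> (\<integral>\<nu>. \<phi> \<nu> \<partial>Q)) F)"

text \<open>\<open>Q\<close> is the law of a Poisson process with mean measure \<open>L\<close>.\<close>

definition poisson_process_law :: "real measure \<Rightarrow> real measure measure \<Rightarrow> bool" where
  "poisson_process_law L Q \<longleftrightarrow>
     prob_space Q \<and> space Q = point_measures \<and> sets Q = sets (borel_of vague_topology) \<and>
     (\<forall>A\<in>sets pos_borel. \<forall>k::nat.
        measure Q {\<nu> \<in> space Q. emeasure \<nu> A = of_nat k} =
          (if emeasure L A < \<infinity> then exp (- measure L A) * measure L A ^ k / fact k else 0)) \<and>
     (\<forall>(n::nat) A. (\<forall>i<n. A i \<in> sets pos_borel) \<and> disjoint_family_on A {..<n} \<longrightarrow>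
        prob_space.indep_vars Q (\<lambda>_. borel) (\<lambda>i \<nu>. emeasure \<nu> (A i)) {..<n})"

section \<open>Propagation processes\<close>

text \<open>\<open>prob_space.indep_var\<close> needs both variables to have the same type.\<close>

definition indep_pair ::
  "'w measure \<Rightarrow> 'a measure \<Rightarrow> ('w \<Rightarrow> 'a) \<Rightarrow> 'b measure \<Rightarrow> ('w \<Rightarrow> 'b) \<Rightarrow> bool" where
  "indep_pair M A Y B Z \<longleftrightarrow> Y \<in> measurable M A \<and> Z \<in> measurable M B \<and>
     prob_space.indep_set M {Y -` U \<inter> space M | U. U \<in> sets A} {Z -` V \<inter> space M | V. V \<in> sets B}"

text \<open>\<open>N\<close> is required to be a point process, so its values are locally finite; it agrees with the
  sum of Dirac measures outside a null set.\<close>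

definition propagation_process ::
  "'w measure \<Rightarrow> ('w \<Rightarrow> real) \<Rightarrow> (real ^ 'n \<Rightarrow> real) \<Rightarrow> ('w \<Rightarrow> (real ^ 'n) set)
     \<Rightarrow> ('w \<Rightarrow> real measure) \<Rightarrow> bool" where
  "propagation_process M S g \<xi> N \<longleftrightarrow> point_process M N \<and>
     (\<exists>\<kappa> X S'. random_enumeration M \<xi> \<kappa> X \<and>
        prob_space.indep_vars M (\<lambda>_. borel) S' (UNIV :: nat set) \<and>
        (\<forall>i. distr M borel (S' i) = distr M borel S) \<and>
        indep_pair M
          (count_space UNIV \<Otimes>\<^sub>M PiM UNIV (\<lambda>_. borel)) (\<lambda>\<omega>. (\<kappa> \<omega>, \<lambda>i. X i \<omega>))
          (PiM UNIV (\<lambda>_. borel)) (\<lambda>\<omega> i. S' i \<omega>) \<and>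
        (AE \<omega> in M. N \<omega> = dirac_sum {i. enat i < \<kappa> \<omega>} (\<lambda>i. g (X i \<omega>) / S' i \<omega>)))"

section \<open>Generalised inverse and values at infinity\<close>

definition gen_inverse :: "(real \<Rightarrow> real) \<Rightarrow> real \<Rightarrow> ennreal" where
  "gen_inverse h y = Inf {ennreal x | x. 0 \<le> x \<and> y < h x}"

definition extend_infty :: "(real \<Rightarrow> real) \<Rightarrow> ennreal \<Rightarrow> ennreal" where
  "extend_infty D r =
     (if r = \<infinity> then Lim at_top (\<lambda>x. ennreal (D x)) else ennreal (D (enn2real r)))"

definition continuity_points :: "real measure \<Rightarrow> real set" where
  "continuity_points L = {t. 0 < t \<and> ((\<lambda>s. emeasure L {0<..s}) \<longlongrightarrow> emeasure L {0<..t}) (at t)}"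

definition tends_to_0_in_probability :: "'w measure \<Rightarrow> (real \<Rightarrow> 'w \<Rightarrow> real) \<Rightarrow> bool" where
  "tends_to_0_in_probability M S \<longleftrightarrow>
     (\<forall>\<epsilon>>0. ((\<lambda>\<sigma>. measure M {\<omega> \<in> space M. \<bar>S \<sigma> \<omega>\<bar> > \<epsilon>}) \<longlongrightarrow> 0) at_top)"

end

theory Submission
  imports Defs
begin

text \<open>
  Write \<open>y\<^sub>i = g(x\<^sub>i) / S\<^sub>i\<close> for the points of the process. Given the configuration they are
  independent, and each single one of them is unlikely to fall below any fixed bound, because
  \<open>S(\<sigma>)\<close> is small. The process is therefore a null array of independent points, and the law of rare
  events says that it is asymptotically Poisson as soon as its mean measure converges. The proof
  consists of making each part of this sentence precise.

  \<^item> Mean measure. As \<open>h\<close> is nondecreasing and left continuous, \<open>g(x) \<le> S t\<close> holds iff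
    \<open>|x| \<le> h\<^sup>-\<^sup>1(S t)\<close>. The expected number of points in \<open>(0, t]\<close> is thus the mean of \<open>|\<xi>|(h\<^sup>-\<^sup>1(S t))\<close>,
    and it has the same limit as the mean of \<open>D(h\<^sup>-\<^sup>1(S t))\<close>: the ratio of the two functions is close
    to \<open>1\<close> at large radii, and at small radii both contribute little because \<open>S\<close> tends to \<open>0\<close>
    (\<open>ball_count_intensity_tendsto\<close>, \<open>interval_intensity_tendsto\<close>).

  \<^item> Rare events. For disjoint intervals \<open>I\<^sub>j\<close> with end points in \<open>C(L)\<close> and weights \<open>0 < s\<^sub>j < 1\<close>, the
    conditional probability generating function of the counts in the \<open>I\<^sub>j\<close> is a product of factors
    \<open>1 - q(x)\<close> over the points \<open>x\<close> of the configuration, where the \<open>q(x)\<close> are uniformly small and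
    have a convergent sum. It tends to the generating function of independent Poisson variables,
    for almost every configuration, hence also after averaging over a random configuration
    (\<open>thinning_product_bounds\<close>, \<open>propagation_pgf_tendsto\<close>). Pointwise convergence of generating
    functions gives convergence of the probabilities of all count vectors (\<open>pgf_convergence\<close>).

  \<^item> Topology. A vaguely open set that contains \<open>\<nu>\<close> contains every point measure with the same counts
    as \<open>\<nu>\<close> in the cells of a sufficiently fine grid of half-open intervals
    (\<open>vague_open_cell_counts\<close>). So a bounded continuous function is a pointwise limit of functions
    of finitely many counts from below, and likewise from above, and weak convergence reduces to
    the convergence of the probabilities of count vectors (\<open>weak_convergence_cell_counts\<close>). All but
    countably many \<open>t > 0\<close> lie in \<open>C(L)\<close>, so the grid can have its nodes there.

  The limit law is constructed by placing, independently in each interval \<open>(n, n + 1]\<close>, a Poisson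
  number of independent points distributed as the normalised restriction of \<open>L\<close>. The same
  generating function argument, applied to a constant sequence, identifies its finite-dimensional
  distributions (\<open>poisson_law_counts\<close>).
\<close>

section \<open>Generating functions of counts\<close>

definition count_values :: "ennreal set" where
  "count_values = insert \<infinity> (range of_nat)"

text \<open>The power \<open>s ^ x\<close> with \<open>s ^ \<infinity> = 0\<close>, which is its
  limit for \<open>0 \<le> s < 1\<close>. With this convention the expectation of
  \<open>count_power s X\<close> is the generating function of a possibly infinite count
  \<open>X\<close>.\<close>

definition count_power :: "real \<Rightarrow> ennreal \<Rightarrow> real" where
  "count_power s x = (if x = \<infinity> then 0 else s ^ nat \<lfloor>enn2real x\<rfloor>)"

text \<open>A Poisson count of infinite mean is infinite almost surely, so it takes each finite
  value with probability \<open>0\<close> and its generating function vanishes on \<open>[0,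
  1)\<close>.\<close>

definition poisson_prob :: "ennreal \<Rightarrow> nat \<Rightarrow> real" where
  "poisson_prob l k = (if l < \<infinity> then exp (- enn2real l) * enn2real l ^ k / fact k else 0)"

definition poisson_pgf :: "ennreal \<Rightarrow> real \<Rightarrow> real" where
  "poisson_pgf l s = (if l < \<infinity> then exp (- ((1 - s) * enn2real l)) else 0)"

lemma count_power_of_nat [simp]: "count_power s (of_nat k) = s ^ k"
  by (simp add: count_power_def)

lemma count_power_infinity [simp]: "count_power s \<infinity> = 0" "count_power s top = 0"
  by (simp_all add: count_power_def)

lemma count_power_measurable [measurable]: "count_power s \<in> borel_measurable borel"
  unfolding count_power_def by measurable

lemma count_power_bounds:
  assumes "0 \<le> s" "s \<le> 1"
  shows "0 \<le> count_power s x" "count_power s x \<le> 1"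
  using assms by (auto simp: count_power_def power_le_one)

lemma count_power_sums:
  assumes "x \<in> count_values"
  shows "(\<lambda>k. indicator {of_nat k} x * s ^ k) sums count_power s x"
proof (cases "x = \<infinity>")
  case True
  then show ?thesis by (simp add: indicator_def sums_0)
next
  case False
  then obtain n where n: "x = of_nat n"
    using assms by (auto simp: count_values_def)
  have "(\<lambda>k. if k = n then s ^ k else 0) sums s ^ n"
    by (rule sums_single)
  moreover have "(\<lambda>k. indicator {of_nat k} x * s ^ k) = (\<lambda>k. if k = n then s ^ k else 0)"
    unfolding n by (auto simp: indicator_def)
  ultimately show ?thesis
    by (simp add: n)
qed

lemma poisson_pgf_sums: "(\<lambda>k. poisson_prob l k * s ^ k) sums poisson_pgf l s"
proof (cases "l < \<infinity>")
  case True
  define r where "r = enn2real l"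
  have "(\<lambda>k. exp (- r) * ((r * s) ^ k /\<^sub>R fact k)) sums (exp (- r) * exp (r * s))"
    by (intro sums_mult exp_converges)
  moreover have "exp (- r) * exp (r * s) = poisson_pgf l s"
    using True by (simp add: poisson_pgf_def r_def algebra_simps flip: exp_add)
  moreover have "(\<lambda>k. exp (- r) * ((r * s) ^ k /\<^sub>R fact k)) = (\<lambda>k. poisson_prob l k * s ^ k)"
    using True by (auto simp: poisson_prob_def r_def fun_eq_iff power_mult_distrib divide_inverse)
  ultimately show ?thesis by simp
qed (simp add: poisson_prob_def poisson_pgf_def)

lemma poisson_prob_nonneg: "0 \<le> poisson_prob l k"
  by (simp add: poisson_prob_def)

lemma poisson_prob_le_1: "poisson_prob l k \<le> 1"
proof (cases "l < \<infinity>")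
  case True
  have sums: "(\<lambda>k. poisson_prob l k) sums 1"
    using poisson_pgf_sums[of l 1] True by (simp add: poisson_pgf_def)
  have "sum (poisson_prob l) {k} \<le> 1"
    using sum_le_suminf[OF sums_summable[OF sums], of "{k}"] sums_unique[OF sums]
    by (auto simp: poisson_prob_nonneg)
  then show ?thesis by simp
qed (simp add: poisson_prob_def)

lemma bounded_power_series_summable:
  fixes a :: "nat \<Rightarrow> real"
  assumes "\<And>k. \<bar>a k\<bar> \<le> B" "0 < s" "s < 1"
  shows "summable (\<lambda>k. a k * s ^ k)"
proof (rule summable_comparison_test')
  show "summable (\<lambda>k. B * s ^ k)"
    using assms by (intro summable_mult summable_geometric) auto
  show "norm (a n * s ^ n) \<le> B * s ^ n" if "n \<ge> 0" for n
    using assms by (auto simp: abs_mult intro!: mult_right_mono)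
qed

text \<open>For small \<open>s\<close> a power series with bounded coefficients is close to its
  constant term, and the bound depends on the coefficients only through \<open>B\<close>. This
  uniformity drives the next lemma.\<close>

lemma power_series_minus_constant:
  fixes a :: "nat \<Rightarrow> real"
  assumes "\<And>k. \<bar>a k\<bar> \<le> B" "0 < s" "s < 1"
  shows "(\<Sum>k. a k * s ^ k) - a 0 = s * (\<Sum>k. a (Suc k) * s ^ k)"
    and "\<bar>(\<Sum>k. a k * s ^ k) - a 0\<bar> \<le> s * (B / (1 - s))"
proof -
  have sm: "summable (\<lambda>k. a (Suc k) * s ^ k)"
    using assms by (intro bounded_power_series_summable[where B = B]) auto
  have "(\<Sum>k. a k * s ^ k) - a 0 = (\<Sum>k. a (Suc k) * s ^ Suc k)"
    using suminf_split_head[OF bounded_power_series_summable[of a B s]] assms by simp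
  also have "\<dots> = s * (\<Sum>k. a (Suc k) * s ^ k)"
    using suminf_mult[OF sm, of s] by (simp add: mult_ac)
  finally show eq: "(\<Sum>k. a k * s ^ k) - a 0 = s * (\<Sum>k. a (Suc k) * s ^ k)" .
  have B: "(\<lambda>k. B * s ^ k) sums (B * (1 / (1 - s)))"
    using assms by (intro sums_mult geometric_sums) auto
  have bd: "norm (a (Suc k) * s ^ k) \<le> B * s ^ k" for k
    using assms by (auto simp: abs_mult intro!: mult_right_mono)
  have "norm (\<Sum>k. a (Suc k) * s ^ k) \<le> (\<Sum>k. B * s ^ k)"
    by (rule norm_suminf_le[OF bd sums_summable[OF B]])
  also have "\<dots> = B / (1 - s)"
    using sums_unique[OF B] by simp
  finally show "\<bar>(\<Sum>k. a k * s ^ k) - a 0\<bar> \<le> s * (B / (1 - s))"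
    unfolding eq using mult_left_mono[of _ "B / (1 - s)" s] assms by (simp add: abs_mult)
qed

text \<open>Convergence of the sums on \<open>(0, 1)\<close> determines the limit of the constant
  terms by letting \<open>s \<rightarrow> 0\<close> uniformly in \<open>n\<close>. Subtracting the
  constant terms and dividing by \<open>s\<close> shifts the coefficients, and induction reaches
  every coefficient.\<close>

lemma power_series_coeff_tendsto:
  fixes a :: "'n \<Rightarrow> nat \<Rightarrow> real" and b :: "nat \<Rightarrow> real"
  assumes "\<And>n k. \<bar>a n k\<bar> \<le> B" "\<And>k. \<bar>b k\<bar> \<le> B"
    and "\<And>s. 0 < s \<Longrightarrow> s < 1 \<Longrightarrow> ((\<lambda>n. \<Sum>k. a n k * s ^ k) \<longlongrightarrow> (\<Sum>k. b k * s ^ k)) F"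
  shows "((\<lambda>n. a n k) \<longlongrightarrow> b k) F"
proof -
  have const: "((\<lambda>n. a n 0) \<longlongrightarrow> b 0) F"
    if a: "\<And>n k. \<bar>a n k\<bar> \<le> B" and b: "\<And>k. \<bar>b k\<bar> \<le> B"
      and lim: "\<And>s. 0 < s \<Longrightarrow> s < 1 \<Longrightarrow>
        ((\<lambda>n. \<Sum>k. a n k * s ^ k) \<longlongrightarrow> (\<Sum>k. b k * s ^ k)) F"
    for a :: "'n \<Rightarrow> nat \<Rightarrow> real" and b :: "nat \<Rightarrow> real"
  proof (rule tendstoI)
    fix e :: real assume e: "e > 0"
    have "((\<lambda>s. s * (B / (1 - s))) \<longlongrightarrow> 0 * (B / (1 - 0))) (at_right 0)"
      by (intro tendsto_intros) auto
    then have "\<forall>\<^sub>F s in at_right 0. s * (B / (1 - s)) < e / 4"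
      using e by (intro order_tendstoD) auto
    moreover have "\<forall>\<^sub>F s in at_right (0::real). s < 1"
      by (auto simp: eventually_at_right_field intro!: exI[of _ 1])
    moreover have "\<forall>\<^sub>F s in at_right (0::real). 0 < s"
      by (simp add: eventually_at_right_less)
    ultimately have "\<forall>\<^sub>F s in at_right (0::real). 0 < s \<and> s < 1 \<and> s * (B / (1 - s)) < e / 4"
      by eventually_elim auto
    then have "\<exists>s. 0 < s \<and> s < 1 \<and> s * (B / (1 - s)) < e / 4"
      by (rule eventually_happens'[rotated]) simp
    then obtain s where s: "0 < s" "s < 1" "s * (B / (1 - s)) < e / 4"
      by blast
    have "\<forall>\<^sub>F n in F. dist (\<Sum>k. a n k * s ^ k) (\<Sum>k. b k * s ^ k) < e / 4"
      using lim[OF s(1,2)] e by (intro tendstoD) auto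
    then show "\<forall>\<^sub>F n in F. dist (a n 0) (b 0) < e"
    proof eventually_elim
      case (elim n)
      have "\<bar>(\<Sum>k. a n k * s ^ k) - a n 0\<bar> \<le> s * (B / (1 - s))"
        by (rule power_series_minus_constant(2)[OF a s(1,2)])
      moreover have "\<bar>(\<Sum>k. b k * s ^ k) - b 0\<bar> \<le> s * (B / (1 - s))"
        by (rule power_series_minus_constant(2)[OF b s(1,2)])
      ultimately show ?case
        using elim s(3) unfolding dist_real_def by linarith
    qed
  qed
  show ?thesis using assms
  proof (induction k arbitrary: a b)
    case 0
    show ?case by (rule const[OF 0])
  next
    case (Suc k)
    note 0 = const[OF Suc.prems]
    have "((\<lambda>n. \<Sum>k. a n (Suc k) * s ^ k) \<longlongrightarrow> (\<Sum>k. b (Suc k) * s ^ k)) F"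
      if s: "0 < s" "s < 1" for s
    proof -
      have "((\<lambda>n. ((\<Sum>k. a n k * s ^ k) - a n 0) / s) \<longlongrightarrow> ((\<Sum>k. b k * s ^ k) - b 0) / s) F"
        using s by (intro tendsto_divide tendsto_diff tendsto_const Suc.prems(3) 0) simp_all
      moreover have "((\<Sum>k. a n k * s ^ k) - a n 0) / s = (\<Sum>k. a n (Suc k) * s ^ k)" for n
        using power_series_minus_constant(1)[where a = "a n", OF Suc.prems(1) s] s by simp
      moreover have "((\<Sum>k. b k * s ^ k) - b 0) / s = (\<Sum>k. b (Suc k) * s ^ k)"
        using power_series_minus_constant(1)[where a = b, OF Suc.prems(2) s] s by simp
      ultimately show ?thesis by simp
    qed
    then show ?case
      by (intro Suc.IH[of "\<lambda>n k. a n (Suc k)" "\<lambda>k. b (Suc k)"] Suc.prems(1,2))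
  qed
qed

context prob_space
begin

lemma integrable_unit_interval:
  assumes "Y \<in> borel_measurable M" "\<And>\<omega>. 0 \<le> Y \<omega>" "\<And>\<omega>. Y \<omega> \<le> (1::real)"
  shows "integrable M Y"
  using assms by (intro integrable_const_bound[where B = 1]) auto

lemma expectation_unit_interval:
  assumes "Y \<in> borel_measurable M" "\<And>\<omega>. 0 \<le> Y \<omega>" "\<And>\<omega>. Y \<omega> \<le> (1::real)"
  shows "0 \<le> expectation Y" "expectation Y \<le> 1"
proof -
  show "0 \<le> expectation Y" using assms by simp
  show "expectation Y \<le> 1"
    using integrable_unit_interval[OF assms] assms(3) by (intro integral_le_const) auto
qed

text \<open>The weight \<open>Y\<close> lets the remaining coordinates of a count vector be
  carried along while one coordinate is treated.\<close>

lemma expectation_count_power: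
  assumes [measurable]: "X \<in> borel_measurable M" "Y \<in> borel_measurable M"
    and X: "AE \<omega> in M. X \<omega> \<in> count_values"
    and Y: "\<And>\<omega>. 0 \<le> Y \<omega>" "\<And>\<omega>. Y \<omega> \<le> 1" and s: "0 < s" "s < 1"
  shows "expectation (\<lambda>\<omega>. count_power s (X \<omega>) * Y \<omega>) =
    (\<Sum>k. expectation (\<lambda>\<omega>. indicator {of_nat k} (X \<omega>) * Y \<omega>) * s ^ k)"
proof -
  define f where "f k \<omega> = indicator {of_nat k} (X \<omega>) * Y \<omega> * s ^ k" for k \<omega>
  have f[measurable]: "f k \<in> borel_measurable M" for k
    unfolding f_def by measurable
  have f_bounds: "0 \<le> f k \<omega>" "f k \<omega> \<le> s ^ k" for k \<omega>
    using Y[of \<omega>] s by (auto simp: f_def indicator_def)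
  have f_int: "integrable M (f k)" for k
    using f_bounds s by (intro integrable_const_bound[where B = "s ^ k"]) auto
  have sm: "summable (\<lambda>k. s ^ k)"
    using s by (intro summable_geometric) auto
  have 1: "AE \<omega> in M. summable (\<lambda>k. norm (f k \<omega>))"
    using f_bounds by (intro AE_I2 summable_comparison_test'[OF sm]) auto
  have 2: "summable (\<lambda>k. \<integral>\<omega>. norm (f k \<omega>) \<partial>M)"
  proof (rule summable_comparison_test'[OF sm])
    fix k :: nat
    show "norm (\<integral>\<omega>. norm (f k \<omega>) \<partial>M) \<le> s ^ k"
      using f_bounds f_int by (auto intro!: integral_le_const)
  qed
  have "(\<integral>\<omega>. (\<Sum>k. f k \<omega>) \<partial>M) = (\<Sum>k. integral\<^sup>L M (f k))"
    by (rule integral_suminf[OF f_int 1 2])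
  moreover have "(\<integral>\<omega>. (\<Sum>k. f k \<omega>) \<partial>M) = expectation (\<lambda>\<omega>. count_power s (X \<omega>) * Y \<omega>)"
  proof (intro integral_cong_AE)
    show "AE \<omega> in M. (\<Sum>k. f k \<omega>) = count_power s (X \<omega>) * Y \<omega>"
      using X
    proof eventually_elim
      case (elim \<omega>)
      have "(\<lambda>k. f k \<omega>) sums (count_power s (X \<omega>) * Y \<omega>)"
        using sums_mult2[OF count_power_sums[OF elim, of s], of "Y \<omega>"]
        by (simp add: f_def mult_ac)
      then show ?case by (simp add: sums_iff)
    qed
  qed auto
  moreover have "integral\<^sup>L M (f k) = expectation (\<lambda>\<omega>. indicator {of_nat k} (X \<omega>) * Y \<omega>) * s ^ k" for k
    unfolding f_def by simp
  ultimately show ?thesis by simp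
qed

lemma pgf_convergence_single:
  fixes X :: "nat \<Rightarrow> 'a \<Rightarrow> ennreal"
  assumes [measurable]: "\<And>n. X n \<in> borel_measurable M" "\<And>n. Y n \<in> borel_measurable M"
    and X: "\<And>n. AE \<omega> in M. X n \<omega> \<in> count_values"
    and Y: "\<And>n \<omega>. 0 \<le> Y n \<omega>" "\<And>n \<omega>. Y n \<omega> \<le> 1"
    and lim: "\<And>s. 0 < s \<Longrightarrow> s < 1 \<Longrightarrow>
      (\<lambda>n. expectation (\<lambda>\<omega>. count_power s (X n \<omega>) * Y n \<omega>)) \<longlonglongrightarrow> C * poisson_pgf l s"
  shows "(\<lambda>n. expectation (\<lambda>\<omega>. indicator {of_nat k} (X n \<omega>) * Y n \<omega>)) \<longlonglongrightarrow> C * poisson_prob l k"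
proof (rule power_series_coeff_tendsto[where B = "max 1 \<bar>C\<bar>"])
  fix n k
  have "0 \<le> expectation (\<lambda>\<omega>. indicator {of_nat k} (X n \<omega>) * Y n \<omega>)"
    "expectation (\<lambda>\<omega>. indicator {of_nat k} (X n \<omega>) * Y n \<omega>) \<le> 1"
    using Y by (intro expectation_unit_interval; auto simp: indicator_def)+
  then show "\<bar>expectation (\<lambda>\<omega>. indicator {of_nat k} (X n \<omega>) * Y n \<omega>)\<bar> \<le> max 1 \<bar>C\<bar>"
    by auto
next
  fix k
  have "\<bar>C\<bar> * poisson_prob l k \<le> \<bar>C\<bar> * 1"
    by (intro mult_left_mono poisson_prob_le_1) auto
  then show "\<bar>C * poisson_prob l k\<bar> \<le> max 1 \<bar>C\<bar>"
    by (simp add: abs_mult poisson_prob_nonneg)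
next
  fix s :: real assume s: "0 < s" "s < 1"
  have "(\<lambda>k. C * (poisson_prob l k * s ^ k)) sums (C * poisson_pgf l s)"
    by (rule sums_mult[OF poisson_pgf_sums])
  then have "(\<Sum>k. C * poisson_prob l k * s ^ k) = C * poisson_pgf l s"
    unfolding mult.assoc by (rule sums_unique[symmetric])
  moreover have "(\<Sum>k. expectation (\<lambda>\<omega>. indicator {of_nat k} (X n \<omega>) * Y n \<omega>) * s ^ k) =
      expectation (\<lambda>\<omega>. count_power s (X n \<omega>) * Y n \<omega>)" for n
    by (rule expectation_count_power[OF assms(1,2) X Y s, symmetric])
  ultimately show "(\<lambda>n. \<Sum>k. expectation (\<lambda>\<omega>. indicator {of_nat k} (X n \<omega>) * Y n \<omega>) * s ^ k)
      \<longlonglongrightarrow> (\<Sum>k. C * poisson_prob l k * s ^ k)"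
    using lim[OF s] by presburger
qed

text \<open>The coordinates are converted from generating functions to point probabilities one
  after the other. In the induction step the weight \<open>Y\<close> absorbs \<open>t ^
  X\<^sub>a\<close> for the new index \<open>a\<close>, the induction hypothesis treats the other
  coordinates, and then \<open>t\<close> is varied with the indicators of the other coordinates as
  weight.\<close>

lemma pgf_convergence_weighted:
  fixes X :: "nat \<Rightarrow> 'j \<Rightarrow> 'a \<Rightarrow> ennreal" and l :: "'j \<Rightarrow> ennreal"
  assumes "finite J"
    and "\<And>n j. j \<in> J \<Longrightarrow> X n j \<in> borel_measurable M" "\<And>n. Y n \<in> borel_measurable M"
    and "\<And>n j. j \<in> J \<Longrightarrow> AE \<omega> in M. X n j \<omega> \<in> count_values"
    and "\<And>n \<omega>. 0 \<le> Y n \<omega>" "\<And>n \<omega>. Y n \<omega> \<le> 1"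
    and "\<And>s. (\<And>j. 0 < s j \<and> s j < 1) \<Longrightarrow>
      (\<lambda>n. expectation (\<lambda>\<omega>. (\<Prod>j\<in>J. count_power (s j) (X n j \<omega>)) * Y n \<omega>))
        \<longlonglongrightarrow> C * (\<Prod>j\<in>J. poisson_pgf (l j) (s j))"
  shows "(\<lambda>n. expectation (\<lambda>\<omega>. (\<Prod>j\<in>J. indicator {of_nat (k j)} (X n j \<omega>)) * Y n \<omega>))
        \<longlonglongrightarrow> C * (\<Prod>j\<in>J. poisson_prob (l j) (k j))"
  using assms
proof (induction J arbitrary: Y C rule: finite_induct)
  case empty
  have "(\<lambda>n. expectation (\<lambda>\<omega>. (\<Prod>j\<in>{}. count_power (1 / 2) (X n j \<omega>)) * Y n \<omega>))
      \<longlonglongrightarrow> C * (\<Prod>j\<in>{}. poisson_pgf (l j) (1 / 2))"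
    by (rule empty.prems(6)) simp
  then show ?case by simp
next
  case (insert a J)
  note [measurable] = insert.prems(2)
  have X_meas[measurable]: "X n j \<in> borel_measurable M" if "j \<in> insert a J" for n j
    by (rule insert.prems(1)[OF that])
  have Xa[measurable]: "X n a \<in> borel_measurable M" for n
    by (rule X_meas) simp
  define Z where "Z n \<omega> = (\<Prod>j\<in>J. indicator {of_nat (k j)} (X n j \<omega>)) * Y n \<omega>" for n \<omega>
  have Z[measurable]: "Z n \<in> borel_measurable M" for n
    unfolding Z_def using X_meas by measurable
  have ind: "(\<Prod>j\<in>J. indicator {of_nat (k j)} (X n j \<omega>)) \<le> (1::real)"
       "(\<Prod>j\<in>J. indicator {of_nat (k j)} (X n j \<omega>)) \<ge> (0::real)" for n \<omega>
    by (auto intro!: prod_le_1 prod_nonneg)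
  have Z01: "0 \<le> Z n \<omega>" "Z n \<omega> \<le> 1" for n \<omega>
    unfolding Z_def using ind[of n \<omega>] insert.prems(4)[of n \<omega>] insert.prems(5)[of n \<omega>]
    by (auto intro: mult_nonneg_nonneg mult_le_one)
  have "(\<lambda>n. expectation (\<lambda>\<omega>. indicator {of_nat (k a)} (X n a \<omega>) * Z n \<omega>))
      \<longlonglongrightarrow> (C * (\<Prod>j\<in>J. poisson_prob (l j) (k j))) * poisson_prob (l a) (k a)"
  proof (rule pgf_convergence_single)
    fix t :: real assume t: "0 < t" "t < 1"
    have "(\<lambda>n. expectation (\<lambda>\<omega>. (\<Prod>j\<in>J. indicator {of_nat (k j)} (X n j \<omega>)) *
              (count_power t (X n a \<omega>) * Y n \<omega>)))
        \<longlonglongrightarrow> (C * poisson_pgf (l a) t) * (\<Prod>j\<in>J. poisson_prob (l j) (k j))"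
    proof (rule insert.IH)
      fix s :: "'j \<Rightarrow> real" assume s: "\<And>j. 0 < s j \<and> s j < 1"
      have "(\<lambda>n. expectation (\<lambda>\<omega>. (\<Prod>j\<in>insert a J. count_power ((s(a := t)) j) (X n j \<omega>)) * Y n \<omega>))
        \<longlonglongrightarrow> C * (\<Prod>j\<in>insert a J. poisson_pgf (l j) ((s(a := t)) j))"
        using s t by (intro insert.prems(6)) auto
      moreover have "(\<Prod>j\<in>insert a J. poisson_pgf (l j) ((s(a := t)) j)) =
          poisson_pgf (l a) t * (\<Prod>j\<in>J. poisson_pgf (l j) (s j))"
      proof -
        have "(\<Prod>j\<in>J. poisson_pgf (l j) ((s(a := t)) j)) = (\<Prod>j\<in>J. poisson_pgf (l j) (s j))"
          using insert.hyps(2) by (intro prod.cong) auto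
        then show ?thesis
          using insert.hyps by simp
      qed
      moreover have "(\<Prod>j\<in>insert a J. count_power ((s(a := t)) j) (X n j \<omega>)) =
          count_power t (X n a \<omega>) * (\<Prod>j\<in>J. count_power (s j) (X n j \<omega>))" for n \<omega>
      proof -
        have "(\<Prod>j\<in>J. count_power ((s(a := t)) j) (X n j \<omega>)) = (\<Prod>j\<in>J. count_power (s j) (X n j \<omega>))"
          using insert.hyps(2) by (intro prod.cong) auto
        then show ?thesis
          using insert.hyps by simp
      qed
      ultimately show "(\<lambda>n. expectation (\<lambda>\<omega>. (\<Prod>j\<in>J. count_power (s j) (X n j \<omega>)) * (count_power t (X n a \<omega>) * Y n \<omega>)))
         \<longlonglongrightarrow> (C * poisson_pgf (l a) t) * (\<Prod>j\<in>J. poisson_pgf (l j) (s j))"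
        by (simp only: mult_ac)
    next
      fix n \<omega>
      show "0 \<le> count_power t (X n a \<omega>) * Y n \<omega>" "count_power t (X n a \<omega>) * Y n \<omega> \<le> 1"
        using t insert.prems(4)[of n \<omega>] insert.prems(5)[of n \<omega>]
        by (auto intro!: mult_nonneg_nonneg mult_le_one count_power_bounds)
    next
      show "AE \<omega> in M. X n j \<omega> \<in> count_values" if "j \<in> J" for n j
        using insert.prems(3)[of j n] that by simp
    next
      show "random_variable borel (X n j)" if "j \<in> J" for n j
        using that by (intro X_meas) simp
      show "random_variable borel (\<lambda>\<omega>. count_power t (X n a \<omega>) * Y n \<omega>)" for n
        by measurable
    qed
    then show "(\<lambda>n. expectation (\<lambda>\<omega>. count_power t (X n a \<omega>) * Z n \<omega>))
        \<longlonglongrightarrow> (C * (\<Prod>j\<in>J. poisson_prob (l j) (k j))) * poisson_pgf (l a) t"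
      by (simp add: Z_def mult_ac)
  next
    show "AE \<omega> in M. X n a \<omega> \<in> count_values" for n
      by (rule insert.prems(3)) simp
    show "0 \<le> Z n \<omega>" "Z n \<omega> \<le> 1" for n \<omega>
      by (rule Z01)+
  qed (rule Xa Z)+
  then show ?case
    unfolding Z_def prod.insert[OF insert.hyps] by (simp only: mult_ac)
qed

text \<open>Continuity theorem for multivariate generating functions with independent Poisson
  limits. Applied to a constant sequence it says that the generating function determines the law
  of the counts.\<close>

lemma pgf_convergence:
  fixes X :: "nat \<Rightarrow> 'j \<Rightarrow> 'a \<Rightarrow> ennreal" and l :: "'j \<Rightarrow> ennreal"
  assumes J: "finite J"
    and X: "\<And>n j. j \<in> J \<Longrightarrow> X n j \<in> borel_measurable M"
    and "\<And>n j. j \<in> J \<Longrightarrow> AE \<omega> in M. X n j \<omega> \<in> count_values"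
    and "\<And>s. (\<And>j. 0 < s j \<and> s j < 1) \<Longrightarrow>
      (\<lambda>n. expectation (\<lambda>\<omega>. \<Prod>j\<in>J. count_power (s j) (X n j \<omega>)))
        \<longlonglongrightarrow> (\<Prod>j\<in>J. poisson_pgf (l j) (s j))"
  shows "(\<lambda>n. prob {\<omega> \<in> space M. \<forall>j\<in>J. X n j \<omega> = of_nat (k j)})
        \<longlonglongrightarrow> (\<Prod>j\<in>J. poisson_prob (l j) (k j))"
proof -
  have "(\<lambda>n. expectation (\<lambda>\<omega>. (\<Prod>j\<in>J. indicator {of_nat (k j)} (X n j \<omega>)) * 1))
        \<longlonglongrightarrow> 1 * (\<Prod>j\<in>J. poisson_prob (l j) (k j))"
  proof (rule pgf_convergence_weighted[OF J X _ assms(3)])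
    fix s :: "'j \<Rightarrow> real" assume "\<And>j. 0 < s j \<and> s j < 1"
    then show "(\<lambda>n. expectation (\<lambda>\<omega>. (\<Prod>j\<in>J. count_power (s j) (X n j \<omega>)) * 1))
        \<longlonglongrightarrow> 1 * (\<Prod>j\<in>J. poisson_pgf (l j) (s j))"
      unfolding mult_1_left mult_1_right by (rule assms(4))
  qed simp_all
  moreover have "expectation (\<lambda>\<omega>. (\<Prod>j\<in>J. indicator {of_nat (k j)} (X n j \<omega>)) * 1) =
     prob {\<omega> \<in> space M. \<forall>j\<in>J. X n j \<omega> = of_nat (k j)}" for n
  proof -
    have "expectation (\<lambda>\<omega>. (\<Prod>j\<in>J. indicator {of_nat (k j)} (X n j \<omega>)) * 1) =
      (expectation (indicator {\<omega> \<in> space M. \<forall>j\<in>J. X n j \<omega> = of_nat (k j)}) :: real)"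
    proof (rule Bochner_Integration.integral_cong[OF refl])
      fix \<omega> assume "\<omega> \<in> space M"
      show "(\<Prod>j\<in>J. indicator {of_nat (k j)} (X n j \<omega>)) * 1 =
          (indicator {\<omega> \<in> space M. \<forall>j\<in>J. X n j \<omega> = of_nat (k j)} \<omega> :: real)"
      proof (cases "\<forall>j\<in>J. X n j \<omega> = of_nat (k j)")
        case True
        with \<open>\<omega> \<in> space M\<close> show ?thesis by simp
      next
        case False
        then have "(\<Prod>j\<in>J. indicator {of_nat (k j)} (X n j \<omega>)) = (0::real)"
          using J by (intro prod_zero) (auto simp: indicator_def)
        with False show ?thesis by simp
      qed
    qed
    also have "\<dots> = prob ({\<omega> \<in> space M. \<forall>j\<in>J. X n j \<omega> = of_nat (k j)} \<inter> space M)"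
      by (rule Bochner_Integration.integral_indicator)
    also have "{\<omega> \<in> space M. \<forall>j\<in>J. X n j \<omega> = of_nat (k j)} \<inter> space M =
        {\<omega> \<in> space M. \<forall>j\<in>J. X n j \<omega> = of_nat (k j)}"
      by blast
    finally show ?thesis .
  qed
  ultimately show ?thesis by simp
qed

end

section \<open>Point measures and their evaluations\<close>

lemma space_pos_borel [simp]: "space pos_borel = {0<..}"
  by (simp add: pos_borel_def space_restrict_space)

lemma sets_pos_borel_iff: "A \<in> sets pos_borel \<longleftrightarrow> A \<in> sets borel \<and> A \<subseteq> {0<..}"
  by (simp add: pos_borel_def sets_restrict_space_iff conj_commute)

lemma Int_pos_borel: "A \<in> sets borel \<Longrightarrow> B \<in> sets pos_borel \<Longrightarrow> A \<inter> B \<in> sets pos_borel"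
  by (auto simp: sets_pos_borel_iff)

lemma interval_pos_borel [simp, intro]:
  "0 \<le> a \<Longrightarrow> {a<..b} \<in> sets pos_borel" "0 \<le> a \<Longrightarrow> {a<..<b} \<in> sets pos_borel"
  "0 < a \<Longrightarrow> {a..b} \<in> sets pos_borel"
  by (auto simp: sets_pos_borel_iff)

lemma emeasure_dirac_sum:
  assumes "\<And>i. i \<in> I \<Longrightarrow> 0 < y i" "A \<in> sets pos_borel"
  shows "emeasure (dirac_sum I y) A = emeasure (count_space I) {i \<in> I. y i \<in> A}"
proof -
  have "y \<in> measurable (count_space I) pos_borel"
    using assms(1) by auto
  then show ?thesis
    using assms(2) unfolding dirac_sum_def
    by (subst emeasure_distr) (auto intro: arg_cong2[where f = emeasure])
qed

lemma emeasure_count_space_count_values: "A \<subseteq> I \<Longrightarrow> emeasure (count_space I) A \<in> count_values"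
  by (cases "finite A") (auto simp: count_values_def)

lemma sets_dirac_sum [simp]: "sets (dirac_sum I y) = sets pos_borel"
  by (simp add: dirac_sum_def)

lemma point_measures_sets: "\<nu> \<in> point_measures \<Longrightarrow> sets \<nu> = sets pos_borel"
  by (auto simp: point_measures_def)

lemma point_measures_space: "\<nu> \<in> point_measures \<Longrightarrow> space \<nu> = {0<..}"
  using sets_eq_imp_space_eq[OF point_measures_sets] by simp

lemma point_measures_counts:
  assumes "\<nu> \<in> point_measures" "A \<in> sets pos_borel"
  shows "emeasure \<nu> A \<in> count_values"
proof -
  obtain I :: "nat set" and y where "\<nu> = dirac_sum I y" "\<forall>i\<in>I. 0 < y i"
    using assms(1) by (auto simp: point_measures_def)
  then show ?thesis
    using assms(2) by (simp add: emeasure_dirac_sum emeasure_count_space_count_values)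
qed

lemma radon_pos_finite:
  assumes "radon_pos \<mu>" "0 < a" "A \<in> sets pos_borel" "A \<subseteq> {a..b}"
  shows "emeasure \<mu> A < \<infinity>"
proof -
  have "emeasure \<mu> A \<le> emeasure \<mu> {a..b}"
    using assms by (intro emeasure_mono) (auto simp: radon_pos_def)
  also have "\<dots> < \<infinity>"
  proof -
    have "compact {a..b}" "{a..b} \<subseteq> {0<..}" using assms by auto
    then show ?thesis using assms(1) by (auto simp: radon_pos_def)
  qed
  finally show ?thesis .
qed

lemma point_measures_radon: "\<nu> \<in> point_measures \<Longrightarrow> radon_pos \<nu>"
  by (auto simp: point_measures_def)

lemmas point_measures_finite = radon_pos_finite[OF point_measures_radon]

lemma compact_pos_bounds:
  assumes "compact K" "K \<subseteq> {0<..}"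
  obtains a b :: real where "0 < a" "a < b" "K \<subseteq> {a..b}"
proof (cases "K = {}")
  case True
  then show ?thesis using that[of 1 2] by auto
next
  case False
  obtain a where a: "a \<in> K" "\<And>x. x \<in> K \<Longrightarrow> a \<le> x"
    using compact_attains_inf[OF assms(1) False] by blast
  obtain b where b: "b \<in> K" "\<And>x. x \<in> K \<Longrightarrow> x \<le> b"
    using compact_attains_sup[OF assms(1) False] by blast
  show ?thesis
    using a b assms(2) by (intro that[of a "b + 1"]) (force, force, force)
qed

lemma test_function_bounds:
  assumes "test_function f"
  obtains a b where "0 < a" "a < b" "\<And>x. 0 < x \<Longrightarrow> x \<notin> {a..b} \<Longrightarrow> f x = 0"
proof -
  obtain K where K: "compact K" "K \<subseteq> {0<..}" "\<forall>x\<in>{0<..} - K. f x = 0"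
    using assms by (auto simp: test_function_def)
  obtain a b where ab: "0 < a" "a < b" "K \<subseteq> {a..b}"
    using compact_pos_bounds[OF K(1,2)] by blast
  show ?thesis
    using K(3) ab by (intro that[of a b]) auto
qed

lemma test_function_measurable:
  assumes "test_function f" "\<nu> \<in> point_measures"
  shows "f \<in> borel_measurable \<nu>"
proof -
  have "f \<in> borel_measurable pos_borel"
    using assms(1) unfolding pos_borel_def test_function_def
    by (intro borel_measurable_continuous_on_restrict) auto
  then show ?thesis
    using measurable_cong_sets[OF point_measures_sets[OF assms(2)] refl] by blast
qed

lemma integrable_indicator_point_measure:
  assumes "\<nu> \<in> point_measures" "0 < a" "A \<in> sets pos_borel" "A \<subseteq> {a..b}"
  shows "integrable \<nu> (indicator A :: real \<Rightarrow> real)"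
  using point_measures_finite[OF assms] assms(1,3)
  by (intro integrable_real_indicator) (auto simp: point_measures_sets)

lemma test_function_integrable:
  assumes f: "test_function f" and \<nu>: "\<nu> \<in> point_measures"
  shows "integrable \<nu> f"
proof -
  obtain a b where ab: "0 < a" "a < b" "\<And>x. 0 < x \<Longrightarrow> x \<notin> {a..b} \<Longrightarrow> f x = 0"
    using test_function_bounds[OF f] by blast
  have "compact (f ` {a..b})"
    using f ab by (intro compact_continuous_image)
      (auto simp: test_function_def intro: continuous_on_subset)
  then obtain B where B: "\<And>x. x \<in> {a..b} \<Longrightarrow> \<bar>f x\<bar> \<le> B"
    using compact_imp_bounded by (metis bounded_iff imageI real_norm_def)
  have "integrable \<nu> (\<lambda>x. B * indicator {a..b} x)"
    using ab by (intro integrable_mult_right integrable_indicator_point_measure[OF \<nu>]) auto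
  then show ?thesis
  proof (rule Bochner_Integration.integrable_bound)
    show "f \<in> borel_measurable \<nu>"
      by (rule test_function_measurable[OF f \<nu>])
    show "AE x in \<nu>. norm (f x) \<le> norm (B * indicator {a..b} x)"
    proof (rule AE_I2)
      fix x assume "x \<in> space \<nu>"
      then have "0 < x" by (simp add: point_measures_space[OF \<nu>])
      then show "norm (f x) \<le> norm (B * indicator {a..b} x)"
        using ab(3)[of x] B[of x] by (cases "x \<in> {a..b}") auto
    qed
  qed
qed

lemma topspace_vague [simp]: "topspace vague_topology = point_measures"
proof -
  have "test_function (\<lambda>_. 0)"
    by (auto simp: test_function_def intro: exI[of _ "{}"])
  then show ?thesis
    unfolding vague_topology_def topology_generated_by_topspace by auto
qed

lemma openin_vague_integral:
  assumes "test_function f" "open U"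
  shows "openin vague_topology {\<nu> \<in> point_measures. (\<integral>x. f x \<partial>\<nu>) \<in> U}"
  unfolding vague_topology_def openin_topology_generated_by_iff
  using assms by (intro generate_topology_on.Basis) auto

lemma space_borel_of [simp]: "space (borel_of T) = topspace T"
  by (simp add: borel_of_def space_measure_of_conv)

lemma sets_borel_of: "sets (borel_of T) = sigma_sets (topspace T) {U. openin T U}"
  unfolding borel_of_def by (rule sets_measure_of) (auto dest: openin_subset)

lemma openin_sets_borel_of: "openin T U \<Longrightarrow> U \<in> sets (borel_of T)"
  by (auto simp: sets_borel_of)

lemma continuous_map_borel_measurable:
  assumes "continuous_map T euclideanreal \<phi>"
  shows "\<phi> \<in> borel_measurable (borel_of T)"
proof (rule borel_measurableI)
  fix S :: "real set" assume "open S"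
  then have "openin T {x \<in> topspace T. \<phi> x \<in> S}"
    using assms by (intro openin_continuous_map_preimage) auto
  moreover have "\<phi> -` S \<inter> space (borel_of T) = {x \<in> topspace T. \<phi> x \<in> S}"
    by auto
  ultimately show "\<phi> -` S \<inter> space (borel_of T) \<in> sets (borel_of T)"
    by (simp add: openin_sets_borel_of)
qed

lemma test_integral_measurable:
  assumes "test_function f"
  shows "(\<lambda>\<nu>. \<integral>x. f x \<partial>\<nu>) \<in> borel_measurable (borel_of vague_topology)"
proof (rule borel_measurableI)
  fix S :: "real set" assume "open S"
  then have "openin vague_topology {\<nu> \<in> point_measures. (\<integral>x. f x \<partial>\<nu>) \<in> S}"
    by (intro openin_vague_integral assms)
  moreover have "(\<lambda>\<nu>. \<integral>x. f x \<partial>\<nu>) -` S \<inter> space (borel_of vague_topology) =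
      {\<nu> \<in> point_measures. (\<integral>x. f x \<partial>\<nu>) \<in> S}"
    by auto
  ultimately show "(\<lambda>\<nu>. \<integral>x. f x \<partial>\<nu>) -` S \<inter> space (borel_of vague_topology) \<in> sets (borel_of vague_topology)"
    by (simp add: openin_sets_borel_of)
qed

text \<open>The indicator of an open interval is the limit of trapezoidal test functions, whose
  integrals are measurable because they are continuous for the vague topology.\<close>

lemma evaluation_measurable_interval:
  assumes a: "0 < a"
  shows "(\<lambda>\<nu>. emeasure \<nu> {a<..<b}) \<in> borel_measurable (borel_of vague_topology)"
proof -
  define f where "f n x = min 1 (real n * max 0 (min (x - a) (b - x)))" for n x
  have f: "test_function (f n)" for n
    unfolding test_function_def
  proof (intro conjI exI[of _ "{a..b}"])
    show "continuous_on {0<..} (f n)"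
      unfolding f_def by (intro continuous_intros)
  qed (use a in \<open>auto simp: f_def\<close>)
  have f_bounds: "0 \<le> f n x" "f n x \<le> indicator {a..b} x" for n x
    by (auto simp: f_def indicator_def min_def max_def)
  have f_lim: "(\<lambda>n. f n x) \<longlonglongrightarrow> indicator {a<..<b} x" for x
  proof (cases "x \<in> {a<..<b}")
    case True
    define c where "c = min (x - a) (b - x)"
    have c: "c > 0" using True by (auto simp: c_def)
    obtain n0 :: nat where n0: "1 / c < real n0"
      using reals_Archimedean2 by blast
    have "\<forall>\<^sub>F n in sequentially. f n x = 1"
      using eventually_ge_at_top[of n0]
    proof eventually_elim
      case (elim n)
      have "1 \<le> real n0 * c" using n0 c by (simp add: field_simps)
      also have "\<dots> \<le> real n * c" using elim c by (intro mult_right_mono) auto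
      finally show ?case using c by (simp add: f_def c_def[symmetric])
    qed
    then show ?thesis using True by (simp add: tendsto_eventually)
  next
    case False
    then have "max 0 (min (x - a) (b - x)) = 0" by auto
    then have "f n x = 0" for n by (simp add: f_def)
    then show ?thesis using False by simp
  qed
  have lim: "(\<lambda>n. \<integral>x. f n x \<partial>\<nu>) \<longlonglongrightarrow> measure \<nu> {a<..<b}" if \<nu>: "\<nu> \<in> point_measures" for \<nu>
  proof -
    have "(\<lambda>n. \<integral>x. f n x \<partial>\<nu>) \<longlonglongrightarrow> (\<integral>x. indicator {a<..<b} x \<partial>\<nu>)"
    proof (rule integral_dominated_convergence[where w = "indicator {a..b}"])
      show "integrable \<nu> (indicator {a..b} :: real \<Rightarrow> real)"
        using a by (intro integrable_indicator_point_measure[OF \<nu>]) auto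
      show "(\<lambda>x. indicator {a<..<b} x :: real) \<in> borel_measurable \<nu>"
        using a \<nu> by (intro borel_measurable_indicator) (auto simp: point_measures_sets)
    qed (use f_bounds f_lim test_function_measurable[OF f \<nu>] in \<open>auto simp: abs_of_nonneg\<close>)
    moreover have "{a<..<b} \<inter> space \<nu> = {a<..<b}"
      using a by (auto simp: point_measures_space[OF \<nu>])
    ultimately show ?thesis
      by simp
  qed
  have "(\<lambda>\<nu>. measure \<nu> {a<..<b}) \<in> borel_measurable (borel_of vague_topology)"
    by (rule borel_measurable_LIMSEQ_real[OF lim test_integral_measurable[OF f]]) simp
  then have "(\<lambda>\<nu>. ennreal (measure \<nu> {a<..<b})) \<in> borel_measurable (borel_of vague_topology)"
    by measurable
  then show ?thesis
  proof (rule measurable_cong[THEN iffD1, rotated])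
    fix \<nu> :: "real measure" assume "\<nu> \<in> space (borel_of vague_topology)"
    then have "emeasure \<nu> {a<..<b} < \<infinity>"
      using a by (intro point_measures_finite[where a = a and b = b]) auto
    then show "ennreal (measure \<nu> {a<..<b}) = emeasure \<nu> {a<..<b}"
      by (intro emeasure_eq_ennreal_measure[symmetric]) auto
  qed
qed

text \<open>A monotone class argument extends measurability from open intervals to Borel sets. It
  is carried out inside the windows \<open>W n\<close>, on which point measures are finite, so
  that complements can be formed by subtraction.\<close>

lemma evaluation_measurable [measurable]:
  assumes A: "A \<in> sets pos_borel"
  shows "(\<lambda>\<nu>. emeasure \<nu> A) \<in> borel_measurable (borel_of vague_topology)"
proof -
  define W where "W n = {1 / real (Suc n) <..< real (Suc n)}" for n
  have W_sets: "W n \<in> sets pos_borel" for n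
    unfolding W_def by auto
  have W_mono: "incseq W"
  proof (rule incseq_SucI)
    fix n
    have "1 / real (Suc (Suc n)) \<le> 1 / real (Suc n)"
      by (intro frac_le) auto
    then show "W n \<le> W (Suc n)"
      unfolding W_def by auto
  qed
  have W_Un: "(\<Union>n. W n) = {0<..}"
  proof -
    have "\<exists>n. x \<in> W n" if x: "x > 0" for x
    proof -
      obtain n :: nat where "max x (1 / x) < real n"
        using reals_Archimedean2 by blast
      then have "x < real (Suc n)" "1 / x < real (Suc n)" by auto
      then have "x \<in> W n" using x unfolding W_def by (auto simp: field_simps)
      then show ?thesis by blast
    qed
    moreover have "W n \<subseteq> {0<..}" for n using W_sets[of n] by (simp add: sets_pos_borel_iff)
    ultimately show ?thesis by blast
  qed
  have loc: "(\<lambda>\<nu>. emeasure \<nu> (B \<inter> W n)) \<in> borel_measurable (borel_of vague_topology)"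
    if "B \<in> sets borel" for B n
  proof -
    have gen: "sets (borel :: real measure) = sigma_sets UNIV (range (\<lambda>(a, b). {a<..<b}))"
      by (subst borel_eq_box) (simp add: sets_measure_of box_real case_prod_beta')
    have int: "Int_stable (range (\<lambda>(a, b). {a<..<b::real}))"
    proof (safe intro!: Int_stableI)
      fix a b c d :: real
      have "{a<..<b} \<inter> {c<..<d} = {max a c<..<min b d}" by auto
      then show "{a<..<b} \<inter> {c<..<d} \<in> range (\<lambda>(a, b). {a<..<b})" by auto
    qed
    have Pow: "range (\<lambda>(a, b). {a<..<b::real}) \<subseteq> Pow UNIV" by simp
    from that[unfolded gen] show ?thesis
    proof (induction rule: sigma_sets_induct_disjoint[OF int Pow, consumes 1, case_names basic empty compl union])
      case (basic A)
      then obtain a b where ab: "A = {a<..<b}" by auto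
      have eq: "A \<inter> W n = {max a (1 / real (Suc n)) <..< min b (real (Suc n))}"
        unfolding ab W_def by auto
      show ?case unfolding eq
        by (rule evaluation_measurable_interval) (simp add: less_max_iff_disj)
    next
      case empty
      then show ?case by simp
    next
      case (compl A)
      have A: "A \<in> sets borel" using compl(1) by (simp add: gen)
      have "(\<lambda>\<nu>. emeasure \<nu> (W n) - emeasure \<nu> (A \<inter> W n)) \<in> borel_measurable (borel_of vague_topology)"
        using compl(2) unfolding W_def
        by (intro borel_measurable_minus_ennreal evaluation_measurable_interval) auto
      then show ?case
      proof (rule measurable_cong[THEN iffD1, rotated])
        fix \<nu> :: "real measure" assume "\<nu> \<in> space (borel_of vague_topology)"
        then have \<nu>: "\<nu> \<in> point_measures" by simp
        have "emeasure \<nu> (W n - A \<inter> W n) = emeasure \<nu> (W n) - emeasure \<nu> (A \<inter> W n)"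
        proof (rule emeasure_Diff)
          have AW: "A \<inter> W n \<in> sets pos_borel"
            using A W_sets by (rule Int_pos_borel)
          then show "A \<inter> W n \<in> sets \<nu>" "W n \<in> sets \<nu>"
            using W_sets by (simp_all add: point_measures_sets[OF \<nu>])
          have "emeasure \<nu> (A \<inter> W n) < \<infinity>"
            by (rule point_measures_finite[OF \<nu> _ AW, where a = "1 / real (Suc n)" and b = "real (Suc n)"])
              (auto simp: W_def)
          then show "emeasure \<nu> (A \<inter> W n) \<noteq> \<infinity>" by auto
        qed auto
        moreover have "W n - A \<inter> W n = (UNIV - A) \<inter> W n" by blast
        ultimately show "emeasure \<nu> (W n) - emeasure \<nu> (A \<inter> W n) = emeasure \<nu> ((UNIV - A) \<inter> W n)"
          by simp
      qed
    next
      case (union F)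
      have "(\<lambda>\<nu>. \<Sum>i. emeasure \<nu> (F i \<inter> W n)) \<in> borel_measurable (borel_of vague_topology)"
        using union(3) by (intro borel_measurable_suminf_order) auto
      then show ?case
      proof (rule measurable_cong[THEN iffD1, rotated])
        fix \<nu> :: "real measure" assume "\<nu> \<in> space (borel_of vague_topology)"
        then have \<nu>: "\<nu> \<in> point_measures" by simp
        have "(\<Sum>i. emeasure \<nu> (F i \<inter> W n)) = emeasure \<nu> (\<Union>i. F i \<inter> W n)"
        proof (rule suminf_emeasure)
          show "range (\<lambda>i. F i \<inter> W n) \<subseteq> sets \<nu>"
            using union(2) W_sets by (auto simp: point_measures_sets[OF \<nu>] gen intro!: Int_pos_borel)
          show "disjoint_family (\<lambda>i. F i \<inter> W n)"
            using union(1) by (auto simp: disjoint_family_on_def)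
        qed
        then show "(\<Sum>i. emeasure \<nu> (F i \<inter> W n)) = emeasure \<nu> (\<Union> (range F) \<inter> W n)"
          by (simp add: Int_UN_distrib2)
      qed
    qed
  qed
  have "(\<lambda>\<nu>. SUP n. emeasure \<nu> (A \<inter> W n)) \<in> borel_measurable (borel_of vague_topology)"
    using A by (intro borel_measurable_SUP loc) (auto simp: sets_pos_borel_iff)
  then show ?thesis
  proof (rule measurable_cong[THEN iffD1, rotated])
    fix \<nu> :: "real measure" assume "\<nu> \<in> space (borel_of vague_topology)"
    then have \<nu>: "\<nu> \<in> point_measures" by simp
    have "(SUP n. emeasure \<nu> (A \<inter> W n)) = emeasure \<nu> (\<Union>n. A \<inter> W n)"
    proof (rule SUP_emeasure_incseq)
      show "range (\<lambda>n. A \<inter> W n) \<subseteq> sets \<nu>"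
        using A W_sets by (auto simp: point_measures_sets[OF \<nu>])
      show "incseq (\<lambda>n. A \<inter> W n)"
        using W_mono by (fastforce simp: mono_def)
    qed
    moreover have "(\<Union>n. A \<inter> W n) = A"
      using W_Un A by (auto simp: sets_pos_borel_iff)
    ultimately show "(SUP n. emeasure \<nu> (A \<inter> W n)) = emeasure \<nu> A" by simp
  qed
qed

section \<open>The vague topology and counts on fine grids\<close>

text \<open>At level \<open>m\<close> the nodes \<open>T m i\<close> have mesh less than \<open>2
  / (m + 1)\<close>, and the cells between the first \<open>(m + 1)\<^sup>2 + 1\<close> of them
  cover \<open>[1 / (m + 1), m + 1]\<close>. Only the rough position of a node is prescribed, so
  that nodes can be chosen outside a countable set.\<close>

definition fine_grid :: "(nat \<Rightarrow> nat \<Rightarrow> real) \<Rightarrow> bool" where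
  "fine_grid T \<longleftrightarrow> (\<forall>m i. real i / real (Suc m) < T m i \<and> T m i < real (Suc i) / real (Suc m))"

definition grid_size :: "nat \<Rightarrow> nat" where
  "grid_size m = Suc m * Suc m"

definition cell :: "(nat \<Rightarrow> nat \<Rightarrow> real) \<Rightarrow> nat \<Rightarrow> nat \<Rightarrow> real set" where
  "cell T m i = {T m i<..T m (Suc i)}"

text \<open>Count vectors are lists of natural numbers because these form a countable type:
  functions of \<open>cell_counts T m\<close> are then simple to integrate.\<close>

definition cell_counts :: "(nat \<Rightarrow> nat \<Rightarrow> real) \<Rightarrow> nat \<Rightarrow> real measure \<Rightarrow> nat list" where
  "cell_counts T m \<nu> = map (\<lambda>i. nat \<lfloor>enn2real (emeasure \<nu> (cell T m i))\<rfloor>) [0..<grid_size m]"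

context
  fixes T :: "nat \<Rightarrow> nat \<Rightarrow> real"
  assumes T: "fine_grid T"
begin

lemma grid_bounds:
  "real i / real (Suc m) < T m i" "T m i < real (Suc i) / real (Suc m)" "0 < T m i"
proof -
  show 1: "real i / real (Suc m) < T m i" "T m i < real (Suc i) / real (Suc m)"
    using T by (auto simp: fine_grid_def)
  have "0 \<le> real i / real (Suc m)" by simp
  with 1 show "0 < T m i" by linarith
qed

lemma grid_strict_mono: "i < j \<Longrightarrow> T m i < T m j"
  by (rule lift_Suc_mono_less[of "T m"]) (use grid_bounds in \<open>blast intro: less_trans\<close>)

lemma grid_mono: "i \<le> j \<Longrightarrow> T m i \<le> T m j"
  using grid_strict_mono[of i j m] by (cases "i = j") auto

lemma grid_step: "T m (Suc i) < T m i + 2 / real (Suc m)"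
proof -
  have "T m (Suc i) < real (Suc (Suc i)) / real (Suc m)" "real i / real (Suc m) < T m i"
    by (rule grid_bounds)+
  moreover have "real (Suc (Suc i)) / real (Suc m) = real i / real (Suc m) + 2 / real (Suc m)"
    by (simp add: add_divide_distrib)
  ultimately show ?thesis by linarith
qed

lemma cell_pos_borel [simp]: "cell T m i \<in> sets pos_borel"
  using grid_bounds(3)[of m i] by (simp add: cell_def)

lemma cell_finite:
  assumes "radon_pos \<mu>"
  shows "emeasure \<mu> (cell T m i) < \<infinity>"
  by (rule radon_pos_finite[OF assms grid_bounds(3)[of m i] cell_pos_borel, of _ _ "T m (Suc i)"])
    (auto simp: cell_def)

lemma cell_disjoint: "i \<noteq> j \<Longrightarrow> cell T m i \<inter> cell T m j = {}"
proof (induction i j rule: linorder_wlog)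
  case (le i j)
  then have "T m (Suc i) \<le> T m j" by (intro grid_mono) auto
  then show ?case by (auto simp: cell_def)
qed blast

lemma cell_covers:
  assumes x: "0 < x" "1 / real (Suc m) \<le> x" "x \<le> real (Suc m)"
  obtains i where "i < grid_size m" "x \<in> cell T m i"
proof -
  define j where "j = (LEAST j. x \<le> T m j)"
  have "real (grid_size m) / real (Suc m) < T m (grid_size m)"
    by (rule grid_bounds)
  moreover have "real (grid_size m) / real (Suc m) = real (Suc m)"
    unfolding grid_size_def of_nat_mult by simp
  ultimately have ex: "x \<le> T m (grid_size m)"
    using x(3) by linarith
  have j: "x \<le> T m j" "j \<le> grid_size m"
    unfolding j_def by (rule LeastI[of "\<lambda>j. x \<le> T m j", OF ex]) (rule Least_le[of "\<lambda>j. x \<le> T m j", OF ex])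
  have "T m 0 < x"
    using grid_bounds(2)[of m 0] x(2) by simp
  then obtain i where i: "j = Suc i"
    using j(1) by (cases j) auto
  then have "\<not> x \<le> T m i"
    unfolding j_def by (intro not_less_Least) simp
  then show ?thesis
    using j i by (intro that[of i]) (auto simp: cell_def)
qed

lemma point_measure_cell_count:
  assumes "\<nu> \<in> point_measures"
  shows "emeasure \<nu> (cell T m i) = of_nat (nat \<lfloor>enn2real (emeasure \<nu> (cell T m i))\<rfloor>)"
proof -
  have "emeasure \<nu> (cell T m i) \<in> count_values"
    using assms by (intro point_measures_counts) auto
  moreover have "emeasure \<nu> (cell T m i) < \<infinity>"
    by (rule cell_finite[OF point_measures_radon[OF assms]])
  ultimately show ?thesis
    by (auto simp: count_values_def)
qed

lemma cell_counts_eq_iff: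
  assumes "\<nu> \<in> point_measures"
  shows "cell_counts T m \<nu> = ks \<longleftrightarrow>
    length ks = grid_size m \<and> (\<forall>i<grid_size m. emeasure \<nu> (cell T m i) = of_nat (ks ! i))"
proof -
  have "nat \<lfloor>enn2real (emeasure \<nu> (cell T m i))\<rfloor> = k \<longleftrightarrow> emeasure \<nu> (cell T m i) = of_nat k" for i k
    by (subst (2) point_measure_cell_count[OF assms]) (metis of_nat_eq_iff)
  then show ?thesis
    by (auto simp: cell_counts_def list_eq_iff_nth_eq)
qed

lemma measurable_cell_counts:
  assumes N: "\<And>\<omega>. \<omega> \<in> space \<Omega> \<Longrightarrow> N \<omega> \<in> point_measures"
    and meas: "\<And>i. (\<lambda>\<omega>. emeasure (N \<omega>) (cell T m i)) \<in> borel_measurable \<Omega>"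
  shows "(\<lambda>\<omega>. cell_counts T m (N \<omega>)) \<in> measurable \<Omega> (count_space UNIV)"
proof (subst measurable_count_space_eq2_countable)
  note [measurable] = meas
  have "(\<lambda>\<omega>. cell_counts T m (N \<omega>)) -` {ks} \<inter> space \<Omega> \<in> sets \<Omega>" for ks
  proof -
    have "(\<lambda>\<omega>. cell_counts T m (N \<omega>)) -` {ks} \<inter> space \<Omega> =
      {\<omega> \<in> space \<Omega>. length ks = grid_size m \<and> (\<forall>i<grid_size m. emeasure (N \<omega>) (cell T m i) = of_nat (ks ! i))}"
      using cell_counts_eq_iff[OF N] by auto
    also have "\<dots> \<in> sets \<Omega>" by measurable
    finally show ?thesis .
  qed
  then show "(\<lambda>\<omega>. cell_counts T m (N \<omega>)) \<in> space \<Omega> \<rightarrow> UNIV \<and>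
      (\<forall>ks\<in>UNIV. (\<lambda>\<omega>. cell_counts T m (N \<omega>)) -` {ks} \<inter> space \<Omega> \<in> sets \<Omega>)"
    by simp
qed

lemma cell_counts_measurable [measurable]:
  "cell_counts T m \<in> measurable (borel_of vague_topology) (count_space UNIV)"
  by (rule measurable_cell_counts[where N = "\<lambda>\<nu>. \<nu>"]) (auto intro!: evaluation_measurable)

text \<open>Only the cells in \<open>C\<close>, which lie in a compact neighbourhood
  \<open>K\<close> of the support of \<open>f\<close>, matter. On such a cell \<open>f\<close>
  differs by less than \<open>\<eta>\<close> from its value at the right end point, so both
  integrals are within \<open>\<eta> * \<nu> K\<close> of the same Riemann sum; for
  \<open>\<nu>'\<close> the total mass of these cells is bounded by \<open>\<nu> K\<close> as
  well, since it has the same counts. The half-open cells are disjoint, so an atom at a node is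
  counted once.\<close>

lemma test_integral_cell_approx:
  assumes f: "test_function f" and \<nu>: "\<nu> \<in> point_measures" and e: "0 < e"
  shows "\<exists>m0. \<forall>m\<ge>m0. \<forall>\<nu>'\<in>point_measures. cell_counts T m \<nu>' = cell_counts T m \<nu> \<longrightarrow>
    \<bar>(\<integral>x. f x \<partial>\<nu>') - (\<integral>x. f x \<partial>\<nu>)\<bar> < e"
proof -
  obtain a b where ab: "0 < a" "a < b" and f0: "\<And>x. 0 < x \<Longrightarrow> x \<notin> {a..b} \<Longrightarrow> f x = 0"
    using test_function_bounds[OF f] by blast
  define K where "K = {a / 2..b + 1}"
  have K: "K \<in> sets pos_borel" "compact K" "K \<subseteq> {0<..}"
    using ab by (auto simp: K_def)
  define V where "V = measure \<nu> K"
  define \<eta> where "\<eta> = e / (2 * V + 1)"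
  have V: "V \<ge> 0" by (simp add: V_def)
  have \<eta>: "\<eta> > 0" "2 * (\<eta> * V) < e"
    using e V by (auto simp: \<eta>_def field_simps)
  have "uniformly_continuous_on K f"
    using f K by (intro compact_uniformly_continuous)
      (auto simp: test_function_def intro: continuous_on_subset)
  then obtain d where d: "d > 0" "\<And>x x'. x \<in> K \<Longrightarrow> x' \<in> K \<Longrightarrow> dist x' x < d \<Longrightarrow> dist (f x') (f x) < \<eta>"
    unfolding uniformly_continuous_on_def using \<eta>(1) by metis
  \<comment> \<open>With mesh below \<open>\<epsilon>\<close>, cells that meet \<open>[a,
    b]\<close> stay inside \<open>K = [a / 2, b + 1]\<close>, and \<open>f\<close> varies by less
    than \<open>\<eta>\<close> on them.\<close>
  define \<epsilon> where "\<epsilon> = Min {d, a / 2, 1}"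
  have \<epsilon>: "\<epsilon> > 0" "\<epsilon> \<le> d" "\<epsilon> \<le> a / 2" "\<epsilon> \<le> 1"
    using d(1) ab by (auto simp: \<epsilon>_def)
  obtain m0 :: nat where m0: "max (2 / \<epsilon>) b < real m0"
    using reals_Archimedean2 by blast
  show ?thesis
  proof (intro exI[of _ m0] allI impI ballI)
    fix m \<nu>' assume m: "m0 \<le> m" and \<nu>': "\<nu>' \<in> point_measures"
      and eq: "cell_counts T m \<nu>' = cell_counts T m \<nu>"
    have m': "b < real (Suc m)" "2 / \<epsilon> < real (Suc m)" using m0 m by auto
    then have mesh: "2 / real (Suc m) < \<epsilon>" using \<epsilon>(1) by (simp add: field_simps)
    define C where "C = {i. i < grid_size m \<and> a / 2 \<le> T m i \<and> T m (Suc i) \<le> b + 1}"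
    have C: "finite C" by (simp add: C_def)
    have cell_K: "cell T m i \<subseteq> K" "T m (Suc i) \<in> K" if "i \<in> C" for i
      using that grid_strict_mono[of i "Suc i" m] by (auto simp: C_def K_def cell_def)
    have cover: "(\<Sum>i\<in>C. indicator (cell T m i) x * f x) = f x" if x: "0 < x" for x
    proof (cases "x \<in> {a..b}")
      case False
      then show ?thesis using f0[OF x] by simp
    next
      case True
      have "1 / real (Suc m) \<le> 2 / real (Suc m)" by (simp add: divide_right_mono)
      also have "\<dots> \<le> x" using mesh \<epsilon> True ab(1) by auto
      finally obtain i where i: "i < grid_size m" "x \<in> cell T m i"
        using cell_covers[of x m] x True m' by auto
      have "i \<in> C"
        using i grid_step[of m i] mesh \<epsilon> True by (auto simp: C_def cell_def)
      have "(\<Sum>j\<in>C. indicator (cell T m j) x * f x) = (\<Sum>j\<in>C. if j = i then f x else 0)"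
        using i(2) cell_disjoint[of _ i m] by (intro sum.cong) (auto simp: indicator_def)
      then show ?thesis using C \<open>i \<in> C\<close> by simp
    qed
    define A where "A = (\<Sum>i\<in>C. f (T m (Suc i)) * measure \<nu> (cell T m i))"
    define W where "W = (\<Sum>i\<in>C. measure \<nu> (cell T m i))"
    have same: "measure \<nu>' (cell T m i) = measure \<nu> (cell T m i)" if "i \<in> C" for i
    proof -
      have i: "i < grid_size m" using that by (simp add: C_def)
      have "emeasure \<nu>' (cell T m i) = of_nat (cell_counts T m \<nu>' ! i)"
        using cell_counts_eq_iff[OF \<nu>', THEN iffD1, OF refl] i by blast
      moreover have "emeasure \<nu> (cell T m i) = of_nat (cell_counts T m \<nu> ! i)"
        using cell_counts_eq_iff[OF \<nu>, THEN iffD1, OF refl] i by blast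
      ultimately show ?thesis using eq by (simp add: measure_def)
    qed
    have approx: "\<bar>(\<integral>x. f x \<partial>\<mu>) - A\<bar> \<le> \<eta> * W"
      if \<mu>: "\<mu> \<in> point_measures" and \<mu>_same: "\<And>i. i \<in> C \<Longrightarrow> measure \<mu> (cell T m i) = measure \<nu> (cell T m i)"
      for \<mu>
    proof -
      have ind: "integrable \<mu> (indicator (cell T m i) :: real \<Rightarrow> real)" for i
        by (rule integrable_indicator_point_measure[OF \<mu> grid_bounds(3)[of m i] cell_pos_borel, of _ _ "T m (Suc i)"])
          (auto simp: cell_def)
      have ind_f: "integrable \<mu> (\<lambda>x. indicator (cell T m i) x * f x)" for i
      proof -
        have "integrable \<mu> (\<lambda>x. f x * indicator (cell T m i) x)"
          by (rule integrable_real_mult_indicator)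
            (simp_all add: point_measures_sets[OF \<mu>] test_function_integrable[OF f \<mu>])
        then show ?thesis by (simp only: mult.commute)
      qed
      have int_ind: "(\<integral>x. indicator (cell T m i) x \<partial>\<mu>) = measure \<mu> (cell T m i)" for i
      proof -
        have "cell T m i \<inter> space \<mu> = cell T m i"
          using cell_pos_borel[of m i] by (auto simp: point_measures_space[OF \<mu>] sets_pos_borel_iff)
        then show ?thesis by simp
      qed
      have piece: "\<bar>(\<integral>x. indicator (cell T m i) x * f x \<partial>\<mu>) - f (T m (Suc i)) * measure \<mu> (cell T m i)\<bar>
          \<le> \<eta> * measure \<mu> (cell T m i)" if i: "i \<in> C" for i
      proof -
        have diff: "(\<integral>x. indicator (cell T m i) x * f x \<partial>\<mu>) - f (T m (Suc i)) * measure \<mu> (cell T m i) =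
          (\<integral>x. indicator (cell T m i) x * f x - f (T m (Suc i)) * indicator (cell T m i) x \<partial>\<mu>)"
          using ind ind_f int_ind by simp
        have "\<bar>\<integral>x. indicator (cell T m i) x * f x - f (T m (Suc i)) * indicator (cell T m i) x \<partial>\<mu>\<bar>
            \<le> (\<integral>x. \<bar>indicator (cell T m i) x * f x - f (T m (Suc i)) * indicator (cell T m i) x\<bar> \<partial>\<mu>)"
          by (rule integral_abs_bound)
        also have "\<dots> \<le> (\<integral>x. \<eta> * indicator (cell T m i) x \<partial>\<mu>)"
        proof (rule integral_mono)
          fix x
          have "dist (f x) (f (T m (Suc i))) < \<eta>" if x: "x \<in> cell T m i"
          proof (rule d(2))
            show "T m (Suc i) \<in> K" by (rule cell_K(2)[OF i])
            show "x \<in> K" using cell_K(1)[OF i] x by blast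
            have "T m i < x" "x \<le> T m (Suc i)" using x by (simp_all add: cell_def)
            then show "dist x (T m (Suc i)) < d"
              using grid_step[of m i] mesh \<epsilon>(2) unfolding dist_real_def by linarith
          qed
          then show "\<bar>indicator (cell T m i) x * f x - f (T m (Suc i)) * indicator (cell T m i) x\<bar>
              \<le> \<eta> * indicator (cell T m i) x"
            by (cases "x \<in> cell T m i") (simp_all add: dist_real_def)
        next
          show "integrable \<mu> (\<lambda>x. \<bar>indicator (cell T m i) x * f x - f (T m (Suc i)) * indicator (cell T m i) x\<bar>)"
            by (intro integrable_abs Bochner_Integration.integrable_diff integrable_mult_right ind ind_f)
          show "integrable \<mu> (\<lambda>x. \<eta> * indicator (cell T m i) x)"
            by (intro integrable_mult_right ind)
        qed
        also have "\<dots> = \<eta> * measure \<mu> (cell T m i)"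
          using int_ind by simp
        finally show ?thesis unfolding diff .
      qed
      have "(\<integral>x. f x \<partial>\<mu>) = (\<integral>x. (\<Sum>i\<in>C. indicator (cell T m i) x * f x) \<partial>\<mu>)"
        using cover by (intro Bochner_Integration.integral_cong) (auto simp: point_measures_space[OF \<mu>])
      also have "\<dots> = (\<Sum>i\<in>C. \<integral>x. indicator (cell T m i) x * f x \<partial>\<mu>)"
        using ind_f by (intro Bochner_Integration.integral_sum) auto
      finally have "\<bar>(\<integral>x. f x \<partial>\<mu>) - A\<bar> =
          \<bar>\<Sum>i\<in>C. (\<integral>x. indicator (cell T m i) x * f x \<partial>\<mu>) - f (T m (Suc i)) * measure \<mu> (cell T m i)\<bar>"
        unfolding A_def using \<mu>_same by (simp add: sum_subtractf)
      also have "\<dots> \<le> (\<Sum>i\<in>C. \<eta> * measure \<mu> (cell T m i))"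
        using piece by (intro order.trans[OF sum_abs] sum_mono)
      also have "\<dots> = \<eta> * W"
        using \<mu>_same by (simp add: W_def sum_distrib_left)
      finally show ?thesis .
    qed
    have "W \<le> V"
    proof -
      have "W = measure \<nu> (\<Union>i\<in>C. cell T m i)"
        unfolding W_def
      proof (rule measure_finite_Union[symmetric])
        show "emeasure \<nu> (cell T m i) \<noteq> \<infinity>" if "i \<in> C" for i
          using cell_finite[OF point_measures_radon[OF \<nu>], of m i] by auto
      qed (use C cell_disjoint in \<open>auto simp: point_measures_sets[OF \<nu>] disjoint_family_on_def\<close>)
      also have "\<dots> \<le> V"
        unfolding V_def
      proof (rule measure_mono_fmeasurable)
        have "emeasure \<nu> K < \<infinity>"
          using ab by (intro point_measures_finite[OF \<nu> _ K(1), of "a/2" "b+1"]) (auto simp: K_def)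
        then show "K \<in> fmeasurable \<nu>"
          using K by (simp add: fmeasurable_def point_measures_sets[OF \<nu>])
      qed (use C cell_K in \<open>auto simp: point_measures_sets[OF \<nu>]\<close>)
      finally show ?thesis .
    qed
    then have "\<eta> * W \<le> \<eta> * V" using \<eta>(1) by (intro mult_left_mono) auto
    then show "\<bar>(\<integral>x. f x \<partial>\<nu>') - (\<integral>x. f x \<partial>\<nu>)\<bar> < e"
      using approx[OF \<nu>' same] approx[OF \<nu> refl] \<eta>(2) by linarith
  qed
qed

text \<open>The sets of point measures with prescribed cell counts are in general not open, but
  they form a countable network of the vague topology: every open set is a union of them. For a
  subbasic set this is the approximation of a test integral, and the property passes to finite
  intersections and to unions.\<close>

lemma vague_open_cell_counts:
  assumes "openin vague_topology G" "\<nu> \<in> G"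
  shows "\<exists>m0. \<forall>m\<ge>m0. \<forall>\<nu>'\<in>point_measures. cell_counts T m \<nu>' = cell_counts T m \<nu> \<longrightarrow> \<nu>' \<in> G"
proof -
  have "generate_topology_on {{\<nu> \<in> point_measures. (\<integral>x. f x \<partial>\<nu>) \<in> U} | f U. test_function f \<and> open U} G"
    using assms(1) unfolding vague_topology_def openin_topology_generated_by_iff .
  then show ?thesis using assms(2)
  proof (induction arbitrary: \<nu> rule: generate_topology_on.induct)
    case Empty
    then show ?case by simp
  next
    case (Int A B)
    obtain m1 where m1: "\<forall>m\<ge>m1. \<forall>\<nu>'\<in>point_measures. cell_counts T m \<nu>' = cell_counts T m \<nu> \<longrightarrow> \<nu>' \<in> A"
      using Int.IH(1)[of \<nu>] Int.prems by blast
    obtain m2 where m2: "\<forall>m\<ge>m2. \<forall>\<nu>'\<in>point_measures. cell_counts T m \<nu>' = cell_counts T m \<nu> \<longrightarrow> \<nu>' \<in> B"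
      using Int.IH(2)[of \<nu>] Int.prems by blast
    show ?case
      using m1 m2 by (intro exI[of _ "max m1 m2"]) auto
  next
    case (UN K)
    then obtain A where A: "A \<in> K" "\<nu> \<in> A" by blast
    then show ?case using UN.IH[OF A] by blast
  next
    case (Basis A)
    then obtain f U where fU: "A = {\<nu> \<in> point_measures. (\<integral>x. f x \<partial>\<nu>) \<in> U}" "test_function f" "open U"
      by blast
    then have \<nu>: "\<nu> \<in> point_measures" "(\<integral>x. f x \<partial>\<nu>) \<in> U" using Basis.prems by auto
    obtain e where e: "e > 0" "\<And>y. dist y (\<integral>x. f x \<partial>\<nu>) < e \<Longrightarrow> y \<in> U"
      using fU(3) \<nu>(2) unfolding open_dist by blast
    show ?case
      using test_integral_cell_approx[OF fU(2) \<nu>(1) e(1)] e(2) unfolding fU(1) dist_real_def by blast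
  qed
qed

text \<open>By the network property an open set is a countable union of events about cell counts,
  so the vague Borel sets are generated by cell counts.\<close>

lemma measurable_point_process:
  assumes N: "\<And>\<omega>. \<omega> \<in> space \<Omega> \<Longrightarrow> N \<omega> \<in> point_measures"
    and meas: "\<And>m i. (\<lambda>\<omega>. emeasure (N \<omega>) (cell T m i)) \<in> borel_measurable \<Omega>"
  shows "N \<in> measurable \<Omega> (borel_of vague_topology)"
  unfolding borel_of_def
proof (rule measurable_measure_of)
  fix G assume "G \<in> {U. openin vague_topology U}"
  then have G: "openin vague_topology G" by simp
  define R where "R m = {ks. \<forall>\<nu>\<in>point_measures. cell_counts T m \<nu> = ks \<longrightarrow> \<nu> \<in> G}" for m
  have [measurable]: "(\<lambda>\<omega>. cell_counts T m (N \<omega>)) \<in> measurable \<Omega> (count_space UNIV)" for m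
    using N meas by (rule measurable_cell_counts)
  have "N -` G \<inter> space \<Omega> = {\<omega> \<in> space \<Omega>. \<exists>m. cell_counts T m (N \<omega>) \<in> R m}"
  proof (intro equalityI subsetI)
    fix \<omega> assume \<omega>: "\<omega> \<in> N -` G \<inter> space \<Omega>"
    then obtain m0 where "\<forall>m\<ge>m0. \<forall>\<nu>'\<in>point_measures. cell_counts T m \<nu>' = cell_counts T m (N \<omega>) \<longrightarrow> \<nu>' \<in> G"
      using vague_open_cell_counts[OF G, of "N \<omega>"] by blast
    then have "cell_counts T m0 (N \<omega>) \<in> R m0" by (auto simp: R_def)
    then show "\<omega> \<in> {\<omega> \<in> space \<Omega>. \<exists>m. cell_counts T m (N \<omega>) \<in> R m}" using \<omega> by blast
  qed (use N in \<open>auto simp: R_def\<close>)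
  also have "\<dots> \<in> sets \<Omega>" by measurable
  finally show "N -` G \<inter> space \<Omega> \<in> sets \<Omega>" .
next
  show "{U. openin vague_topology U} \<subseteq> Pow (topspace vague_topology)"
    using openin_subset by blast
qed (use N in auto)

text \<open>Let \<open>\<psi> m\<close> be the largest function of the cell counts at level
  \<open>m\<close> below \<open>\<phi>\<close>. By the network property it converges to
  \<open>\<phi>\<close> pointwise, so that \<open>\<psi> m\<close> has almost the same mean as
  \<open>\<phi>\<close> under \<open>Q\<close> for large \<open>m\<close>. Cutting \<open>\<psi>
  m\<close> off outside finitely many count vectors changes the mean little and leaves a finite
  combination of probabilities which converge by assumption. As the result is below
  \<open>\<phi>\<close>, its mean under \<open>P n\<close> bounds that of
  \<open>\<phi>\<close>.\<close>

lemma weak_convergence_lower_bound: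
  assumes P: "\<And>n. prob_space (P n)" "\<And>n. sets (P n) = sets (borel_of vague_topology)"
    and Q: "prob_space Q" "sets Q = sets (borel_of vague_topology)"
    and lim: "\<And>m ks. (\<lambda>n. measure (P n) {\<nu> \<in> point_measures. cell_counts T m \<nu> = ks})
        \<longlonglongrightarrow> measure Q {\<nu> \<in> point_measures. cell_counts T m \<nu> = ks}"
    and \<phi>: "continuous_map vague_topology euclideanreal \<phi>"
    and \<phi>_bounds: "\<And>\<nu>. \<nu> \<in> point_measures \<Longrightarrow> 0 \<le> \<phi> \<nu>" "\<And>\<nu>. \<nu> \<in> point_measures \<Longrightarrow> \<phi> \<nu> \<le> B"
    and e: "0 < e"
  shows "\<forall>\<^sub>F n in sequentially. (\<integral>\<nu>. \<phi> \<nu> \<partial>Q) - e < (\<integral>\<nu>. \<phi> \<nu> \<partial>P n)"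
proof -
  define \<psi> where "\<psi> m ks = Inf (\<phi> ` {\<nu> \<in> point_measures. cell_counts T m \<nu> = ks})" for m ks
  \<comment> \<open>The truncation of \<open>\<psi> m\<close> to the first \<open>k\<close> count
    vectors of an enumeration of all lists.\<close>
  define \<psi>k where "\<psi>k m k \<nu> = (if to_nat (cell_counts T m \<nu>) < k then \<psi> m (cell_counts T m \<nu>) else 0)"
    for m and k :: nat and \<nu>
  have bdd: "bdd_below (\<phi> ` {\<nu> \<in> point_measures. R \<nu>})" for R
    using \<phi>_bounds(1) by (intro bdd_belowI[of _ 0]) auto
  have \<psi>_le: "\<psi> m (cell_counts T m \<nu>) \<le> \<phi> \<nu>" if "\<nu> \<in> point_measures" for m \<nu>
    unfolding \<psi>_def using that bdd by (intro cInf_lower) auto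
  have \<psi>_ge: "c \<le> \<psi> m (cell_counts T m \<nu>)"
    if "\<nu> \<in> point_measures" "\<And>\<nu>'. \<nu>' \<in> point_measures \<Longrightarrow> cell_counts T m \<nu>' = cell_counts T m \<nu> \<Longrightarrow> c \<le> \<phi> \<nu>'"
    for m \<nu> c
    unfolding \<psi>_def using that by (intro cInf_greatest) auto
  have \<psi>_nonneg: "0 \<le> \<psi> m (cell_counts T m \<nu>)" if "\<nu> \<in> point_measures" for m \<nu>
    using that \<phi>_bounds(1) by (intro \<psi>_ge)
  have \<psi>_lim: "(\<lambda>m. \<psi> m (cell_counts T m \<nu>)) \<longlonglongrightarrow> \<phi> \<nu>" if \<nu>: "\<nu> \<in> point_measures" for \<nu>
  proof (rule tendstoI)
    fix \<delta> :: real assume \<delta>: "\<delta> > 0"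
    have "openin vague_topology {\<nu>' \<in> topspace vague_topology. \<phi> \<nu>' \<in> {\<phi> \<nu> - \<delta> / 2<..}}"
      using \<phi> by (intro openin_continuous_map_preimage) auto
    then obtain m0 where m0: "\<And>m \<nu>'. m \<ge> m0 \<Longrightarrow> \<nu>' \<in> point_measures \<Longrightarrow>
        cell_counts T m \<nu>' = cell_counts T m \<nu> \<Longrightarrow> \<phi> \<nu>' > \<phi> \<nu> - \<delta> / 2"
      using vague_open_cell_counts[of "{\<nu>' \<in> topspace vague_topology. \<phi> \<nu>' \<in> {\<phi> \<nu> - \<delta> / 2<..}}" \<nu>] \<nu> \<delta> by auto
    have "dist (\<psi> m (cell_counts T m \<nu>)) (\<phi> \<nu>) < \<delta>" if "m \<ge> m0" for m
    proof -
      have "\<phi> \<nu> - \<delta> / 2 \<le> \<psi> m (cell_counts T m \<nu>)"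
        using m0[OF that] by (intro \<psi>_ge[OF \<nu>]) (auto intro: less_imp_le)
      then show ?thesis
        using \<psi>_le[OF \<nu>, of m] \<delta> by (auto simp: dist_real_def)
    qed
    then show "\<forall>\<^sub>F m in sequentially. dist (\<psi> m (cell_counts T m \<nu>)) (\<phi> \<nu>) < \<delta>"
      using eventually_sequentially by blast
  qed
  have space_of: "space R = point_measures" if "sets R = sets (borel_of vague_topology)" for R :: "real measure measure"
    using sets_eq_imp_space_eq[OF that] by simp
  have meas: "f \<in> borel_measurable R"
    if "f \<in> borel_measurable (borel_of vague_topology)" "sets R = sets (borel_of vague_topology)"
    for R and f :: "real measure \<Rightarrow> real"
    using that measurable_cong_sets by blast
  have \<phi>_meas: "\<phi> \<in> borel_measurable (borel_of vague_topology)"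
    by (rule continuous_map_borel_measurable[OF \<phi>])
  have \<psi>_meas: "(\<lambda>\<nu>. \<psi> m (cell_counts T m \<nu>)) \<in> borel_measurable (borel_of vague_topology)"
    "\<psi>k m k \<in> borel_measurable (borel_of vague_topology)" for m k
    unfolding \<psi>k_def by measurable
  have \<psi>k_bounds: "0 \<le> \<psi>k m k \<nu>" "\<psi>k m k \<nu> \<le> \<psi> m (cell_counts T m \<nu>)" "\<psi>k m k \<nu> \<le> \<phi> \<nu>" "\<psi>k m k \<nu> \<le> B"
    if "\<nu> \<in> point_measures" for m k \<nu>
    using \<psi>_nonneg[OF that, of m] \<psi>_le[OF that, of m] \<phi>_bounds[OF that] by (auto simp: \<psi>k_def)
  interpret Q: prob_space Q by (rule Q(1))
  have "(\<lambda>m. \<integral>\<nu>. \<psi> m (cell_counts T m \<nu>) \<partial>Q) \<longlonglongrightarrow> (\<integral>\<nu>. \<phi> \<nu> \<partial>Q)"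
  proof (rule integral_dominated_convergence[where w = "\<lambda>_. B"])
    show "AE \<nu> in Q. (\<lambda>m. \<psi> m (cell_counts T m \<nu>)) \<longlonglongrightarrow> \<phi> \<nu>"
      using \<psi>_lim by (intro AE_I2) (simp add: space_of[OF Q(2)])
    show "AE \<nu> in Q. norm (\<psi> m (cell_counts T m \<nu>)) \<le> B" for m
    proof (rule AE_I2)
      fix \<nu> assume "\<nu> \<in> space Q"
      then have "\<nu> \<in> point_measures" by (simp add: space_of[OF Q(2)])
      then show "norm (\<psi> m (cell_counts T m \<nu>)) \<le> B"
        using \<psi>_nonneg[of \<nu> m] \<psi>_le[of \<nu> m] \<phi>_bounds[of \<nu>] by auto
    qed
  qed (auto intro!: meas[OF _ Q(2)] \<phi>_meas \<psi>_meas)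
  then have "\<forall>\<^sub>F m in sequentially. (\<integral>\<nu>. \<phi> \<nu> \<partial>Q) - e / 3 < (\<integral>\<nu>. \<psi> m (cell_counts T m \<nu>) \<partial>Q)"
    using e by (intro order_tendstoD) auto
  then obtain m where m: "(\<integral>\<nu>. \<phi> \<nu> \<partial>Q) - e / 3 < (\<integral>\<nu>. \<psi> m (cell_counts T m \<nu>) \<partial>Q)"
    using eventually_happens'[OF sequentially_bot] by blast
  have "(\<lambda>k. \<integral>\<nu>. \<psi>k m k \<nu> \<partial>Q) \<longlonglongrightarrow> (\<integral>\<nu>. \<psi> m (cell_counts T m \<nu>) \<partial>Q)"
  proof (rule integral_dominated_convergence[where w = "\<lambda>_. B"])
    show "AE \<nu> in Q. (\<lambda>k. \<psi>k m k \<nu>) \<longlonglongrightarrow> \<psi> m (cell_counts T m \<nu>)"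
    proof (rule AE_I2, rule tendsto_eventually)
      fix \<nu>
      show "\<forall>\<^sub>F k in sequentially. \<psi>k m k \<nu> = \<psi> m (cell_counts T m \<nu>)"
        using eventually_gt_at_top[of "to_nat (cell_counts T m \<nu>)"]
        by eventually_elim (simp add: \<psi>k_def)
    qed
    show "AE \<nu> in Q. norm (\<psi>k m k \<nu>) \<le> B" for k
    proof (rule AE_I2)
      fix \<nu> assume "\<nu> \<in> space Q"
      then have "\<nu> \<in> point_measures" by (simp add: space_of[OF Q(2)])
      then show "norm (\<psi>k m k \<nu>) \<le> B"
        using \<psi>k_bounds[of \<nu> m k] by auto
    qed
  qed (auto intro!: meas[OF _ Q(2)] \<psi>_meas)
  then have "\<forall>\<^sub>F k in sequentially. (\<integral>\<nu>. \<psi> m (cell_counts T m \<nu>) \<partial>Q) - e / 3 < (\<integral>\<nu>. \<psi>k m k \<nu> \<partial>Q)"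
    using e by (intro order_tendstoD) auto
  then obtain k where k: "(\<integral>\<nu>. \<psi> m (cell_counts T m \<nu>) \<partial>Q) - e / 3 < (\<integral>\<nu>. \<psi>k m k \<nu> \<partial>Q)"
    using eventually_happens'[OF sequentially_bot] by blast
  define F where "F = {ks :: nat list. to_nat ks < k}"
  have F: "finite F"
  proof -
    have "F \<subseteq> from_nat ` {..<k}"
      by (auto simp: F_def intro!: image_eqI[where x = "to_nat _"])
    then show ?thesis by (rule finite_subset) simp
  qed
  have expand: "(\<integral>\<nu>. \<psi>k m k \<nu> \<partial>R) =
      (\<Sum>ks\<in>F. \<psi> m ks * measure R {\<nu> \<in> point_measures. cell_counts T m \<nu> = ks})"
    if R: "prob_space R" "sets R = sets (borel_of vague_topology)" for R
  proof -
    interpret R: prob_space R by (rule R(1))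
    have E: "{\<nu> \<in> point_measures. cell_counts T m \<nu> = ks} \<in> sets R" for ks
    proof -
      have "{\<nu> \<in> space (borel_of vague_topology). cell_counts T m \<nu> = ks} \<in> sets (borel_of vague_topology)"
        by measurable
      then show ?thesis by (simp add: R(2))
    qed
    have "(\<integral>\<nu>. \<psi>k m k \<nu> \<partial>R) =
      (\<integral>\<nu>. (\<Sum>ks\<in>F. \<psi> m ks * indicator {\<nu> \<in> point_measures. cell_counts T m \<nu> = ks} \<nu>) \<partial>R)"
    proof (rule Bochner_Integration.integral_cong[OF refl])
      fix \<nu> assume "\<nu> \<in> space R"
      then have \<nu>: "\<nu> \<in> point_measures" by (simp add: space_of[OF R(2)])
      have "(\<Sum>ks\<in>F. \<psi> m ks * indicator {\<nu> \<in> point_measures. cell_counts T m \<nu> = ks} \<nu>) =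
          (\<Sum>ks\<in>F. if ks = cell_counts T m \<nu> then \<psi> m ks else 0)"
        using \<nu> by (intro sum.cong) (auto simp: indicator_def)
      also have "\<dots> = \<psi>k m k \<nu>"
        using F by (simp add: \<psi>k_def F_def)
      finally show "\<psi>k m k \<nu> =
          (\<Sum>ks\<in>F. \<psi> m ks * indicator {\<nu> \<in> point_measures. cell_counts T m \<nu> = ks} \<nu>)" ..
    qed
    also have "\<dots> = (\<Sum>ks\<in>F. \<psi> m ks * measure R {\<nu> \<in> point_measures. cell_counts T m \<nu> = ks})"
    proof (subst Bochner_Integration.integral_sum)
      have "{\<nu> \<in> point_measures. cell_counts T m \<nu> = ks} \<inter> space R =
          {\<nu> \<in> point_measures. cell_counts T m \<nu> = ks}" for ks
        by (auto simp: space_of[OF R(2)])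
      then show "(\<Sum>ks\<in>F. \<integral>\<nu>. \<psi> m ks * indicator {\<nu> \<in> point_measures. cell_counts T m \<nu> = ks} \<nu> \<partial>R) =
          (\<Sum>ks\<in>F. \<psi> m ks * measure R {\<nu> \<in> point_measures. cell_counts T m \<nu> = ks})"
        by simp
    qed (use E in \<open>auto simp: less_top[symmetric] intro!: integrable_mult_right integrable_real_indicator\<close>)
    finally show ?thesis .
  qed
  have "(\<lambda>n. \<integral>\<nu>. \<psi>k m k \<nu> \<partial>P n) \<longlonglongrightarrow> (\<integral>\<nu>. \<psi>k m k \<nu> \<partial>Q)"
    unfolding expand[OF P] expand[OF Q] by (intro tendsto_intros lim)
  then have "\<forall>\<^sub>F n in sequentially. (\<integral>\<nu>. \<psi>k m k \<nu> \<partial>Q) - e / 3 < (\<integral>\<nu>. \<psi>k m k \<nu> \<partial>P n)"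
    using e by (intro order_tendstoD) auto
  then show ?thesis
  proof eventually_elim
    case (elim n)
    interpret P: prob_space "P n" by (rule P(1))
    have "(\<integral>\<nu>. \<psi>k m k \<nu> \<partial>P n) \<le> (\<integral>\<nu>. \<phi> \<nu> \<partial>P n)"
    proof (rule integral_mono_AE)
      show "integrable (P n) (\<psi>k m k)"
        using \<psi>k_bounds by (intro P.integrable_const_bound[where B = B] AE_I2 meas[OF \<psi>_meas(2) P(2)])
          (simp add: space_of[OF P(2)])
      show "integrable (P n) \<phi>"
        using \<phi>_bounds by (intro P.integrable_const_bound[where B = B] AE_I2 meas[OF \<phi>_meas P(2)])
          (simp add: space_of[OF P(2)])
    qed (use \<psi>k_bounds in \<open>auto simp: space_of[OF P(2)]\<close>)
    then show ?case using m k elim by linarith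
  qed
qed

text \<open>The lower bound is applied to \<open>B + \<phi>\<close> and to \<open>B -
  \<phi>\<close>.\<close>

lemma weak_convergence_cell_counts:
  assumes P: "\<And>n. prob_space (P n)" "\<And>n. sets (P n) = sets (borel_of vague_topology)"
    and Q: "prob_space Q" "sets Q = sets (borel_of vague_topology)"
    and lim: "\<And>m ks. (\<lambda>n. measure (P n) {\<nu> \<in> point_measures. cell_counts T m \<nu> = ks})
        \<longlonglongrightarrow> measure Q {\<nu> \<in> point_measures. cell_counts T m \<nu> = ks}"
  shows "weak_convergence vague_topology P Q sequentially"
  unfolding weak_convergence_def
proof (intro allI impI)
  fix \<phi> assume "continuous_map vague_topology euclideanreal \<phi> \<and> bounded (\<phi> ` topspace vague_topology)"
  then have \<phi>: "continuous_map vague_topology euclideanreal \<phi>" and "bounded (\<phi> ` point_measures)"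
    by auto
  then obtain B where B: "\<And>\<nu>. \<nu> \<in> point_measures \<Longrightarrow> \<bar>\<phi> \<nu>\<bar> \<le> B"
    unfolding bounded_iff by auto
  have shift: "integrable R \<phi> \<and> (\<integral>\<nu>. B + \<phi> \<nu> \<partial>R) = B + (\<integral>\<nu>. \<phi> \<nu> \<partial>R) \<and> (\<integral>\<nu>. B - \<phi> \<nu> \<partial>R) = B - (\<integral>\<nu>. \<phi> \<nu> \<partial>R)"
    if R: "prob_space R" "sets R = sets (borel_of vague_topology)" for R
  proof -
    interpret R: prob_space R by (rule R(1))
    have "space R = point_measures"
      using sets_eq_imp_space_eq[OF R(2)] by simp
    moreover have "\<phi> \<in> borel_measurable R"
      using continuous_map_borel_measurable[OF \<phi>] measurable_cong_sets[OF R(2) refl] by blast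
    ultimately have "integrable R \<phi>"
      using B by (intro R.integrable_const_bound[where B = B] AE_I2) auto
    then show ?thesis by (simp add: R.prob_space)
  qed
  show "(\<lambda>n. \<integral>\<nu>. \<phi> \<nu> \<partial>P n) \<longlonglongrightarrow> (\<integral>\<nu>. \<phi> \<nu> \<partial>Q)"
  proof (rule tendstoI)
    fix e :: real assume e: "e > 0"
    have "\<forall>\<^sub>F n in sequentially. (\<integral>\<nu>. B + \<phi> \<nu> \<partial>Q) - e < (\<integral>\<nu>. B + \<phi> \<nu> \<partial>P n)"
    proof (rule weak_convergence_lower_bound[OF P Q lim _ _ _ e])
      show "continuous_map vague_topology euclideanreal (\<lambda>\<nu>. B + \<phi> \<nu>)"
        by (intro continuous_map_add \<phi>) simp
      show "0 \<le> B + \<phi> \<nu>" "B + \<phi> \<nu> \<le> 2 * B" if "\<nu> \<in> point_measures" for \<nu>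
        using B[OF that] by linarith+
    qed
    moreover have "\<forall>\<^sub>F n in sequentially. (\<integral>\<nu>. B - \<phi> \<nu> \<partial>Q) - e < (\<integral>\<nu>. B - \<phi> \<nu> \<partial>P n)"
    proof (rule weak_convergence_lower_bound[OF P Q lim _ _ _ e])
      show "continuous_map vague_topology euclideanreal (\<lambda>\<nu>. B - \<phi> \<nu>)"
        by (intro continuous_map_diff \<phi>) simp
      show "0 \<le> B - \<phi> \<nu>" "B - \<phi> \<nu> \<le> 2 * B" if "\<nu> \<in> point_measures" for \<nu>
        using B[OF that] by linarith+
    qed
    ultimately show "\<forall>\<^sub>F n in sequentially. dist (\<integral>\<nu>. \<phi> \<nu> \<partial>P n) (\<integral>\<nu>. \<phi> \<nu> \<partial>Q) < e"
    proof eventually_elim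
      case (elim n)
      then show ?case
        using shift[OF P, of n] shift[OF Q] by (auto simp: dist_real_def)
    qed
  qed
qed

end

section \<open>Generating functions of sums of Dirac measures\<close>

text \<open>The factor that a point at \<open>y\<close> contributes to the generating function of
  the counts in the sets \<open>A j\<close>.\<close>

definition hit_weight :: "'j set \<Rightarrow> ('j \<Rightarrow> real set) \<Rightarrow> ('j \<Rightarrow> real) \<Rightarrow> real \<Rightarrow> real" where
  "hit_weight J A s y = (\<Prod>j\<in>J. if y \<in> A j then s j else 1)"

lemma hit_weight_bounds:
  assumes "\<And>j. j \<in> J \<Longrightarrow> 0 < s j \<and> s j < 1"
  shows "0 \<le> hit_weight J A s y" "hit_weight J A s y \<le> 1"
proof -
  have "0 \<le> s j \<and> s j \<le> 1" if "j \<in> J" for j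
    using assms[OF that] by simp
  then show "0 \<le> hit_weight J A s y" "hit_weight J A s y \<le> 1"
    unfolding hit_weight_def by (auto intro!: prod_nonneg prod_le_1)
qed

text \<open>A point lies in at most one of the disjoint sets, so at most one factor differs from
  \<open>1\<close>.\<close>

lemma hit_weight_disjoint:
  assumes "finite J" "disjoint_family_on A J"
  shows "1 - hit_weight J A s y = (\<Sum>j\<in>J. (1 - s j) * indicator (A j) y)"
proof (cases "\<exists>i\<in>J. y \<in> A i")
  case True
  then obtain i where i: "i \<in> J" "y \<in> A i" by blast
  then have only: "y \<in> A j \<longleftrightarrow> j = i" if "j \<in> J" for j
    using assms(2) that by (auto simp: disjoint_family_on_def)
  have "hit_weight J A s y = (\<Prod>j\<in>J. if j = i then s i else 1)"
    unfolding hit_weight_def using only by (intro prod.cong) auto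
  also have "\<dots> = s i"
    using i assms(1) by simp
  finally have 1: "hit_weight J A s y = s i" .
  have "(\<Sum>j\<in>J. (1 - s j) * indicator (A j) y) = (\<Sum>j\<in>J. if j = i then 1 - s i else 0)"
    using only by (intro sum.cong) auto
  then show ?thesis using 1 i assms(1) by simp
next
  case False
  then show ?thesis by (auto simp: hit_weight_def intro!: sum.neutral)
qed

lemma hit_weight_measurable [measurable]:
  assumes "finite J" "\<And>j. j \<in> J \<Longrightarrow> A j \<in> sets pos_borel"
  shows "hit_weight J A s \<in> borel_measurable borel"
proof -
  have [measurable]: "A j \<in> sets borel" if "j \<in> J" for j
    using assms(2)[OF that] by (simp add: sets_pos_borel_iff)
  show ?thesis unfolding hit_weight_def by measurable
qed

lemma finite_subset_incseq_UN:
  assumes "incseq G" "finite S" "S \<subseteq> (\<Union>m. G m)"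
  shows "\<exists>m. S \<subseteq> G m"
  using assms(2,3)
proof (induction S rule: finite_induct)
  case (insert x S)
  then obtain m1 m2 where m: "S \<subseteq> G m1" "x \<in> G m2" by auto
  have "G m1 \<subseteq> G (max m1 m2)" "G m2 \<subseteq> G (max m1 m2)"
    using assms(1) by (auto simp: mono_def)
  then show ?case using m by blast
qed simp

lemma power_card_tendsto:
  assumes G: "incseq G" "\<And>m. finite (G m)" "(\<Union>m. G m) = S" "S \<subseteq> I" and s: "0 < s" "s < (1::real)"
  shows "(\<lambda>m. s ^ card (G m)) \<longlonglongrightarrow> count_power s (emeasure (count_space I) S)"
proof (cases "finite S")
  case True
  then obtain m where m: "S \<subseteq> G m"
    using finite_subset_incseq_UN[OF G(1), of S] G(3) by auto
  have "\<forall>\<^sub>F n in sequentially. s ^ card (G n) = s ^ card S"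
    using eventually_ge_at_top[of m]
  proof eventually_elim
    case (elim n)
    then have "G m \<subseteq> G n" using G(1) by (auto simp: mono_def)
    then have "G n = S" using m G(3) by blast
    then show ?case by simp
  qed
  then show ?thesis
    using True G(4) by (simp add: tendsto_eventually)
next
  case False
  have "filterlim (\<lambda>m. card (G m)) at_top sequentially"
    unfolding filterlim_at_top
  proof
    fix k
    obtain F where F: "F \<subseteq> S" "finite F" "card F = k"
      using infinite_arbitrarily_large[OF False] by blast
    then obtain m where m: "F \<subseteq> G m"
      using finite_subset_incseq_UN[OF G(1), of F] G(3) by auto
    show "\<forall>\<^sub>F n in sequentially. k \<le> card (G n)"
      using eventually_ge_at_top[of m]
    proof eventually_elim
      case (elim n)
      then have "G m \<subseteq> G n" using G(1) by (auto simp: mono_def)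
      then have "F \<subseteq> G n" using m by blast
      then show ?case using F card_mono[OF G(2)] by metis
    qed
  qed
  moreover have "(\<lambda>k. s ^ k) \<longlonglongrightarrow> 0"
    using s by (intro LIMSEQ_power_zero) auto
  ultimately have "(\<lambda>m. s ^ card (G m)) \<longlonglongrightarrow> 0"
    by (rule filterlim_compose[rotated])
  then show ?thesis
    using False G(4) by simp
qed

text \<open>The product of the weights over finitely many points is the product of the powers
  \<open>s j ^ k\<close>, where \<open>k\<close> counts the points in \<open>A j\<close>. As the
  points are exhausted, \<open>k\<close> increases to the full count, and the convention \<open>s
  ^ \<infinity> = 0\<close> covers the case that it is infinite.\<close>

lemma hit_weight_prod_tendsto:
  assumes I: "\<And>i. i \<in> I \<Longrightarrow> 0 < y i" and J: "finite J" "\<And>j. j \<in> J \<Longrightarrow> A j \<in> sets pos_borel"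
    and s: "\<And>j. j \<in> J \<Longrightarrow> 0 < s j \<and> s j < 1"
    and F: "incseq F" "\<And>m. finite (F m)" "(\<Union>m. F m) = I"
  shows "(\<lambda>m. \<Prod>i\<in>F m. hit_weight J A s (y i)) \<longlonglongrightarrow> (\<Prod>j\<in>J. count_power (s j) (emeasure (dirac_sum I y) (A j)))"
proof -
  have "(\<Prod>i\<in>F m. hit_weight J A s (y i)) = (\<Prod>j\<in>J. s j ^ card {i \<in> F m. y i \<in> A j})" for m
  proof -
    have "(\<Prod>i\<in>F m. hit_weight J A s (y i)) = (\<Prod>j\<in>J. \<Prod>i\<in>F m. if y i \<in> A j then s j else 1)"
      unfolding hit_weight_def by (rule prod.swap)
    also have "\<dots> = (\<Prod>j\<in>J. s j ^ card {i \<in> F m. y i \<in> A j})"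
      using F(2)[of m] by (intro prod.cong refl) (simp add: prod.If_cases Int_def)
    finally show ?thesis .
  qed
  moreover have "(\<lambda>m. \<Prod>j\<in>J. s j ^ card {i \<in> F m. y i \<in> A j})
      \<longlonglongrightarrow> (\<Prod>j\<in>J. count_power (s j) (emeasure (dirac_sum I y) (A j)))"
  proof (rule tendsto_prod)
    fix j assume j: "j \<in> J"
    have "(\<lambda>m. s j ^ card {i \<in> F m. y i \<in> A j}) \<longlonglongrightarrow> count_power (s j) (emeasure (count_space I) {i \<in> I. y i \<in> A j})"
    proof (rule power_card_tendsto)
      show "incseq (\<lambda>m. {i \<in> F m. y i \<in> A j})"
        using F(1) by (fastforce simp: mono_def)
      show "(\<Union>m. {i \<in> F m. y i \<in> A j}) = {i \<in> I. y i \<in> A j}"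
        using F(3) by blast
    qed (use F(2) s[OF j] in auto)
    then show "(\<lambda>m. s j ^ card {i \<in> F m. y i \<in> A j}) \<longlonglongrightarrow> count_power (s j) (emeasure (dirac_sum I y) (A j))"
      using emeasure_dirac_sum[where I = I and y = y, OF I J(2)[OF j]] by simp
  qed
  ultimately show ?thesis by simp
qed

lemma PiM_integral_prod:
  fixes h :: "'i \<Rightarrow> 'b \<Rightarrow> real"
  assumes R: "\<And>i. prob_space (R i)" and J: "finite J"
    and h: "\<And>j. j \<in> J \<Longrightarrow> h j \<in> borel_measurable (R j)" "\<And>j x. j \<in> J \<Longrightarrow> 0 \<le> h j x" "\<And>j x. j \<in> J \<Longrightarrow> h j x \<le> 1"
  shows "(\<integral>\<omega>. (\<Prod>j\<in>J. h j (\<omega> j)) \<partial>PiM UNIV R) = (\<Prod>j\<in>J. \<integral>x. h j x \<partial>R j)"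
proof -
  interpret product_prob_space R UNIV
    by (simp add: product_prob_space_def product_prob_space_axioms_def product_sigma_finite_def
        R prob_space_imp_sigma_finite)
  have meas: "(\<lambda>\<omega>. \<Prod>j\<in>J. h j (\<omega> j)) \<in> borel_measurable (PiM J R)"
    using h(1) by (intro borel_measurable_prod measurable_compose[OF measurable_component_singleton])
  have "(\<integral>\<omega>. (\<Prod>j\<in>J. h j (\<omega> j)) \<partial>PiM UNIV R) = (\<integral>\<omega>. (\<Prod>j\<in>J. h j (restrict \<omega> J j)) \<partial>PiM UNIV R)"
    by simp
  also have "\<dots> = (\<integral>\<omega>. (\<Prod>j\<in>J. h j (\<omega> j)) \<partial>distr (PiM UNIV R) (PiM J R) (\<lambda>\<omega>. restrict \<omega> J))"
    by (rule integral_distr[symmetric, OF measurable_restrict_subset meas]) simp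
  also have "\<dots> = (\<integral>\<omega>. (\<Prod>j\<in>J. h j (\<omega> j)) \<partial>PiM J R)"
    using distr_PiM_restrict_finite[OF J] by simp
  also have "\<dots> = (\<Prod>j\<in>J. \<integral>x. h j x \<partial>R j)"
  proof (rule product_integral_prod[OF J])
    fix j assume "j \<in> J"
    then show "integrable (R j) (h j)"
      using h R by (intro prob_space.integrable_unit_interval) auto
  qed
  finally show ?thesis .
qed

text \<open>The degenerate distribution at \<open>0\<close> covers the parameter \<open>0\<close>,
  for which \<^const>\<open>poisson_pmf\<close> is unspecified.\<close>

definition poisson_count_pmf :: "real \<Rightarrow> nat pmf" where
  "poisson_count_pmf c = (if 0 < c then poisson_pmf c else return_pmf 0)"

lemma pmf_poisson_count:
  "0 \<le> c \<Longrightarrow> pmf (poisson_count_pmf c) k = poisson_prob (ennreal c) k"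
  by (cases "0 < c"; cases k) (auto simp: poisson_count_pmf_def poisson_prob_def mult.commute)

lemma integral_poisson_count_power:
  assumes "0 \<le> c" "0 \<le> a" "a \<le> 1"
  shows "(\<integral>k. a ^ k \<partial>measure_pmf (poisson_count_pmf c)) = exp (- ((1 - a) * c))"
proof -
  let ?p = "pmf (poisson_count_pmf c)"
  have "(\<integral>k. a ^ k \<partial>measure_pmf (poisson_count_pmf c)) = (\<integral>k. ?p k * a ^ k \<partial>count_space UNIV)"
    unfolding measure_pmf_eq_density by (subst integral_density) auto
  also have "\<dots> = (\<Sum>k. ?p k * a ^ k)"
  proof (rule integral_count_space_nat)
    show "integrable (count_space UNIV) (\<lambda>k. ?p k * a ^ k)"
      using assms by (intro Bochner_Integration.integrable_bound[OF integrable_pmf[of UNIV "poisson_count_pmf c"]])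
        (auto intro!: AE_I2 mult_left_le power_le_one simp: abs_mult)
  qed
  also have "\<dots> = poisson_pgf (ennreal c) a"
    using assms poisson_pgf_sums[of "ennreal c" a] by (simp add: pmf_poisson_count sums_iff)
  finally show ?thesis
    using assms by (simp add: poisson_pgf_def)
qed

text \<open>A random number of independent points: conditionally on the number \<open>k\<close> of
  points the mean of the product is a \<open>k\<close>-th power.\<close>

lemma integral_random_power:
  fixes u :: "'b \<Rightarrow> real"
  assumes \<mu>: "prob_space \<mu>" and u: "u \<in> borel_measurable \<mu>" "\<And>y. 0 \<le> u y" "\<And>y. u y \<le> 1"
  shows "(\<integral>z. (\<Prod>j<fst z. u (snd z j)) \<partial>(measure_pmf p \<Otimes>\<^sub>M PiM (UNIV :: nat set) (\<lambda>_. \<mu>))) =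
      (\<integral>k. (\<integral>y. u y \<partial>\<mu>) ^ k \<partial>measure_pmf p)"
proof -
  note [measurable] = u(1)
  interpret Y: prob_space "PiM (UNIV :: nat set) (\<lambda>_. \<mu>)"
    by (rule prob_space_PiM) (rule \<mu>)
  interpret pair_prob_space "measure_pmf p" "PiM (UNIV :: nat set) (\<lambda>_. \<mu>)" ..
  have meas: "(\<lambda>z. \<Prod>j<fst z. u (snd z j)) \<in> borel_measurable (measure_pmf p \<Otimes>\<^sub>M PiM (UNIV :: nat set) (\<lambda>_. \<mu>))"
  proof (rule measurable_compose_countable'[where I = UNIV and g = fst and f = "\<lambda>k z. \<Prod>j<k. u (snd z j)"])
    show "fst \<in> measurable (measure_pmf p \<Otimes>\<^sub>M PiM (UNIV :: nat set) (\<lambda>_. \<mu>)) (count_space UNIV)"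
      by (rule measurable_compose[OF measurable_fst]) simp
  qed auto
  have "integrable (measure_pmf p \<Otimes>\<^sub>M PiM (UNIV :: nat set) (\<lambda>_. \<mu>)) (\<lambda>z. \<Prod>j<fst z. u (snd z j))"
    using u by (intro P.integrable_unit_interval meas prod_nonneg prod_le_1) auto
  from integral_fst'[OF this]
  have "(\<integral>z. (\<Prod>j<fst z. u (snd z j)) \<partial>(measure_pmf p \<Otimes>\<^sub>M PiM (UNIV :: nat set) (\<lambda>_. \<mu>))) =
      (\<integral>k. (\<integral>Y. (\<Prod>j<k. u (Y j)) \<partial>PiM (UNIV :: nat set) (\<lambda>_. \<mu>)) \<partial>measure_pmf p)"
    by simp
  moreover have "(\<integral>Y. (\<Prod>j<k. u (Y j)) \<partial>PiM (UNIV :: nat set) (\<lambda>_. \<mu>)) = (\<integral>y. u y \<partial>\<mu>) ^ k" for k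
    using PiM_integral_prod[of "\<lambda>_. \<mu>" "{..<k}" "\<lambda>_. u"] \<mu> u by simp
  ultimately show ?thesis by simp
qed

text \<open>This also covers \<open>l = \<infinity>\<close>, where the exponent diverges.\<close>

lemma exp_tendsto_poisson_pgf:
  assumes x: "\<And>m. 0 \<le> x m" "(\<lambda>m. ennreal (x m)) \<longlonglongrightarrow> l" and s: "s < 1"
  shows "(\<lambda>m. exp (- ((1 - s) * x m))) \<longlonglongrightarrow> poisson_pgf l s"
proof (cases "l = \<infinity>")
  case False
  then obtain r where r: "l = ennreal r" "0 \<le> r" by (cases l) auto
  then have "x \<longlonglongrightarrow> r"
    using x by (simp add: tendsto_ennreal_iff)
  then show ?thesis
    using r by (auto simp: poisson_pgf_def intro!: tendsto_intros)
next
  case True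
  have "filterlim x at_top sequentially"
    unfolding filterlim_at_top_dense
  proof
    fix Z :: real
    have "\<forall>\<^sub>F m in sequentially. ennreal Z < ennreal (x m)"
      using x(2) True by (intro order_tendstoD) auto
    then show "\<forall>\<^sub>F m in sequentially. Z < x m"
      by eventually_elim (metis ennreal_leI not_le)
  qed
  then have "filterlim (\<lambda>m. (1 - s) * x m) at_top sequentially"
    using s by (intro filterlim_tendsto_pos_mult_at_top[OF tendsto_const]) auto
  then have "(\<lambda>m. exp (- ((1 - s) * x m))) \<longlonglongrightarrow> 0"
    by (intro filterlim_compose[OF exp_at_bot] filterlim_compose[OF filterlim_uminus_at_bot_at_top])
  then show ?thesis using True by (simp add: poisson_pgf_def)
qed

lemma fine_grid_exists: "\<exists>T. fine_grid T"
  by (intro exI[of _ "\<lambda>m i. (real i + 1 / 2) / real (Suc m)"])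
    (auto simp: fine_grid_def intro!: divide_strict_right_mono)

lemma emeasure_dirac_sum_nat:
  fixes I :: "nat set"
  assumes "\<And>i. i \<in> I \<Longrightarrow> 0 < y i" "A \<in> sets pos_borel"
  shows "emeasure (dirac_sum I y) A = (\<Sum>i. if i \<in> I \<and> y i \<in> A then 1 else 0)"
proof -
  have "emeasure (dirac_sum I y) A = emeasure (count_space I) {i \<in> I. y i \<in> A}"
    by (rule emeasure_dirac_sum[OF assms])
  also have "\<dots> = emeasure (count_space UNIV) {i \<in> I. y i \<in> A}"
    by (cases "finite {i \<in> I. y i \<in> A}") auto
  also have "\<dots> = (\<integral>\<^sup>+i. indicator {i \<in> I. y i \<in> A} i \<partial>count_space UNIV)"
    by simp
  also have "\<dots> = (\<Sum>i. indicator {i \<in> I. y i \<in> A} i)"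
    by (rule nn_integral_count_space_nat)
  also have "\<dots> = (\<Sum>i. if i \<in> I \<and> y i \<in> A then 1 else 0)"
    by (intro suminf_cong) (auto simp: indicator_def)
  finally show ?thesis .
qed

section \<open>Construction of the Poisson process\<close>

text \<open>A partition of the half line into countably many sets on which the mean measure is
  finite.\<close>

definition unit_cell :: "nat \<Rightarrow> real set" where
  "unit_cell n = {real n<..real (Suc n)}"

lemma unit_cell_pos_borel [simp]: "unit_cell n \<in> sets pos_borel"
  by (simp add: unit_cell_def)

lemma disjoint_unit_cells: "disjoint_family unit_cell"
proof -
  have "unit_cell i \<inter> unit_cell j = {}" if "i \<noteq> j" for i j
    using that
  proof (induction i j rule: linorder_wlog)
    case (le i j)
    then have "real (Suc i) \<le> real j" by linarith
    then show ?case by (auto simp: unit_cell_def)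
  qed blast
  then show ?thesis by (auto simp: disjoint_family_on_def)
qed

lemma UN_unit_cell: "(\<Union>n. unit_cell n) = {0<..}"
proof -
  have "\<exists>n. x \<in> unit_cell n" if x: "0 < x" for x
  proof (intro exI)
    have "0 < \<lceil>x\<rceil>" using x by simp
    then have "real (Suc (nat (\<lceil>x\<rceil> - 1))) = real_of_int \<lceil>x\<rceil>" "real (nat (\<lceil>x\<rceil> - 1)) = real_of_int \<lceil>x\<rceil> - 1"
      by simp_all
    then show "x \<in> unit_cell (nat (\<lceil>x\<rceil> - 1))"
      unfolding unit_cell_def by simp linarith
  qed
  then show ?thesis by (auto simp: unit_cell_def)
qed

context
  fixes L :: "real measure"
  assumes radon: "radon_pos L"
    and finite_near_0: "\<And>t. 0 < t \<Longrightarrow> emeasure L {0<..t} < \<infinity>"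
begin

lemma sets_L: "sets L = sets pos_borel"
  using radon by (simp add: radon_pos_def)

lemma space_L: "space L = {0<..}"
  using sets_eq_imp_space_eq[OF sets_L] by simp

lemma L_unit_cell_finite: "emeasure L (unit_cell n) < \<infinity>"
proof -
  have "emeasure L (unit_cell n) \<le> emeasure L {0<..real (Suc n)}"
    by (intro emeasure_mono) (auto simp: unit_cell_def sets_L)
  also have "\<dots> < \<infinity>" by (rule finite_near_0) simp
  finally show ?thesis .
qed

definition cell_mass :: "nat \<Rightarrow> real" where
  "cell_mass n = measure L (unit_cell n)"

text \<open>The normalised restriction of \<open>L\<close> to a cell; a cell without mass carries
  an arbitrary point mass. Restricting the space to the cell makes every sampled point, not just
  almost every one, lie in its cell, so that the sampled measure is locally finite for every
  outcome.\<close>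

definition cell_dist :: "nat \<Rightarrow> real measure" where
  "cell_dist n = restrict_space (if 0 < cell_mass n then uniform_measure L (unit_cell n)
     else return pos_borel (real (Suc n))) (unit_cell n)"

text \<open>An outcome for one cell is a number \<open>k\<close> of points together with an
  infinite sequence of independent locations, whose first \<open>k\<close> terms are the
  points.\<close>

definition cell_sample :: "nat \<Rightarrow> (nat \<times> (nat \<Rightarrow> real)) measure" where
  "cell_sample n = measure_pmf (poisson_count_pmf (cell_mass n)) \<Otimes>\<^sub>M PiM UNIV (\<lambda>_. cell_dist n)"

definition sample_space :: "(nat \<Rightarrow> nat \<times> (nat \<Rightarrow> real)) measure" where
  "sample_space = PiM UNIV cell_sample"

text \<open>The \<open>j\<close>-th point in cell \<open>n\<close> has index \<open>prod_encode
  (n, j)\<close>.\<close>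

definition sample_index :: "(nat \<Rightarrow> nat \<times> (nat \<Rightarrow> real)) \<Rightarrow> nat set" where
  "sample_index \<omega> = {i. snd (prod_decode i) < fst (\<omega> (fst (prod_decode i)))}"

definition sample_point :: "(nat \<Rightarrow> nat \<times> (nat \<Rightarrow> real)) \<Rightarrow> nat \<Rightarrow> real" where
  "sample_point \<omega> i = snd (\<omega> (fst (prod_decode i))) (snd (prod_decode i))"

definition poisson_sample :: "(nat \<Rightarrow> nat \<times> (nat \<Rightarrow> real)) \<Rightarrow> real measure" where
  "poisson_sample \<omega> = dirac_sum (sample_index \<omega>) (sample_point \<omega>)"

lemma cell_mass_pos:
  assumes "0 < cell_mass n"
  shows "emeasure L (unit_cell n) \<noteq> 0" "emeasure L (unit_cell n) \<noteq> \<infinity>"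
  using assms L_unit_cell_finite[of n] by (auto simp: cell_mass_def measure_def)

lemma sets_cell_dist: "sets (cell_dist n) = sets (restrict_space pos_borel (unit_cell n))"
  unfolding cell_dist_def by (intro sets_restrict_space_cong) (simp add: sets_L)

lemma space_cell_dist: "space (cell_dist n) = unit_cell n"
  using unit_cell_pos_borel[of n]
  by (auto simp: cell_dist_def space_restrict_space space_L sets_pos_borel_iff)

lemma measure_cell_dist:
  assumes A: "A \<in> sets pos_borel"
  shows "cell_mass n * measure (cell_dist n) (A \<inter> unit_cell n) = measure L (A \<inter> unit_cell n)"
proof (cases "0 < cell_mass n")
  case True
  have "measure (cell_dist n) (A \<inter> unit_cell n) = measure (uniform_measure L (unit_cell n)) (A \<inter> unit_cell n)"
    unfolding cell_dist_def using True
    by (subst measure_restrict_space) (auto simp: space_L sets_L Int_absorb2 sets_pos_borel_iff unit_cell_def)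
  also have "\<dots> = measure L (unit_cell n \<inter> (A \<inter> unit_cell n)) / measure L (unit_cell n)"
    using cell_mass_pos[OF True] A by (intro measure_uniform_measure) (auto simp: sets_L)
  also have "unit_cell n \<inter> (A \<inter> unit_cell n) = A \<inter> unit_cell n" by blast
  finally show ?thesis using True by (simp add: cell_mass_def)
next
  case False
  then have 0: "cell_mass n = 0" by (simp add: cell_mass_def le_less measure_nonneg not_less)
  have "measure L (A \<inter> unit_cell n) \<le> measure L (unit_cell n)"
    using L_unit_cell_finite[of n] A
    by (intro measure_mono_fmeasurable) (auto simp: fmeasurable_def sets_L)
  then show ?thesis using 0 by (simp add: cell_mass_def measure_le_0_iff)
qed

lemma prob_space_cell_dist: "prob_space (cell_dist n)"
proof (cases "0 < cell_mass n")
  case True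
  show ?thesis
    unfolding cell_dist_def using True
  proof (simp, intro prob_space_restrict_space)
    show "emeasure (uniform_measure L (unit_cell n)) (unit_cell n) = 1"
      using cell_mass_pos[OF True] by (intro emeasure_uniform_measure_1)
  qed (simp add: sets_L)
next
  case False
  show ?thesis
    unfolding cell_dist_def using False
  proof (simp, intro prob_space_restrict_space)
    have "real (Suc n) \<in> unit_cell n" by (simp add: unit_cell_def)
    then show "emeasure (return pos_borel (1 + real n)) (unit_cell n) = 1"
      by (subst emeasure_return) (auto simp: unit_cell_def)
  qed simp
qed

lemma prob_space_cell_sample: "prob_space (cell_sample n)"
proof -
  interpret Y: prob_space "PiM (UNIV :: nat set) (\<lambda>_. cell_dist n)"
    by (rule prob_space_PiM) (rule prob_space_cell_dist)
  interpret pair_prob_space "measure_pmf (poisson_count_pmf (cell_mass n))" "PiM (UNIV :: nat set) (\<lambda>_. cell_dist n)" ..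
  show ?thesis unfolding cell_sample_def by (rule P.prob_space_axioms)
qed

lemma prob_space_sample_space: "prob_space sample_space"
  unfolding sample_space_def by (rule prob_space_PiM) (rule prob_space_cell_sample)

lemma sample_count_measurable:
  "(\<lambda>\<omega>. fst (\<omega> n)) \<in> measurable sample_space (count_space UNIV)"
proof -
  have "(\<lambda>\<omega>. \<omega> n) \<in> measurable sample_space (cell_sample n)"
    unfolding sample_space_def by (rule measurable_component_singleton) simp
  moreover have "fst \<in> measurable (cell_sample n) (count_space UNIV)"
    unfolding cell_sample_def by (rule measurable_compose[OF measurable_fst]) simp
  ultimately show ?thesis by (rule measurable_compose)
qed

lemma sample_value_measurable:
  "(\<lambda>\<omega>. snd (\<omega> n) j) \<in> measurable sample_space (cell_dist n)"
proof -
  have "(\<lambda>\<omega>. \<omega> n) \<in> measurable sample_space (cell_sample n)"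
    unfolding sample_space_def by (rule measurable_component_singleton) simp
  moreover have "(\<lambda>z. snd z j) \<in> measurable (cell_sample n) (cell_dist n)"
    unfolding cell_sample_def
    by (rule measurable_compose[OF measurable_snd]) (simp add: measurable_component_singleton)
  ultimately show ?thesis by (rule measurable_compose)
qed

lemma cell_dist_id_measurable: "(\<lambda>y. y) \<in> measurable (cell_dist n) pos_borel"
  by (subst measurable_cong_sets[OF sets_cell_dist refl]) (simp add: measurable_restrict_space1)

lemma sample_value_cell:
  assumes "\<omega> \<in> space sample_space"
  shows "snd (\<omega> n) j \<in> unit_cell n"
  using measurable_space[OF sample_value_measurable assms, of n j] by (simp add: space_cell_dist)

lemma sample_point_pos:
  assumes "\<omega> \<in> space sample_space"
  shows "0 < sample_point \<omega> i"
  using sample_value_cell[OF assms, of "fst (prod_decode i)" "snd (prod_decode i)"]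
  by (simp add: sample_point_def unit_cell_def le_less_trans[OF of_nat_0_le_iff])

definition sample_prefix :: "(nat \<Rightarrow> nat \<times> (nat \<Rightarrow> real)) \<Rightarrow> nat \<Rightarrow> nat set" where
  "sample_prefix \<omega> m = prod_encode ` (SIGMA n:{..<m}. {..<fst (\<omega> n)})"

lemma sample_prefix_iff:
  "i \<in> sample_prefix \<omega> m \<longleftrightarrow> i \<in> sample_index \<omega> \<and> fst (prod_decode i) < m"
proof -
  obtain n j where i: "i = prod_encode (n, j)"
    by (metis prod_decode_inverse surj_pair)
  show ?thesis
    unfolding i sample_prefix_def sample_index_def
    by (auto simp: inj_image_mem_iff[OF inj_prod_encode])
qed

lemma sample_prefix_exhausts:
  "finite (sample_prefix \<omega> m)" "incseq (sample_prefix \<omega>)" "(\<Union>m. sample_prefix \<omega> m) = sample_index \<omega>"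
proof -
  show "finite (sample_prefix \<omega> m)" by (simp add: sample_prefix_def)
  show "incseq (sample_prefix \<omega>)"
    unfolding mono_def using sample_prefix_iff by fastforce
  show "(\<Union>m. sample_prefix \<omega> m) = sample_index \<omega>"
    using sample_prefix_iff by blast
qed

lemma poisson_sample_point_measures:
  assumes \<omega>: "\<omega> \<in> space sample_space"
  shows "poisson_sample \<omega> \<in> point_measures"
proof -
  have "emeasure (poisson_sample \<omega>) K < \<infinity>" if K: "compact K" "K \<subseteq> {0<..}" for K
  proof -
    obtain a b where ab: "0 < a" "a < b" "K \<subseteq> {a..b}"
      using compact_pos_bounds[OF K] by blast
    have "{i \<in> sample_index \<omega>. sample_point \<omega> i \<in> K} \<subseteq> sample_prefix \<omega> (nat \<lceil>b\<rceil>)"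
    proof
      fix i assume i: "i \<in> {i \<in> sample_index \<omega>. sample_point \<omega> i \<in> K}"
      have "real (fst (prod_decode i)) < sample_point \<omega> i"
        using sample_value_cell[OF \<omega>, of "fst (prod_decode i)" "snd (prod_decode i)"]
        by (simp add: sample_point_def unit_cell_def)
      also have "\<dots> \<le> b" using i ab by auto
      finally have "fst (prod_decode i) < nat \<lceil>b\<rceil>" by linarith
      then show "i \<in> sample_prefix \<omega> (nat \<lceil>b\<rceil>)"
        using i by (simp add: sample_prefix_iff)
    qed
    then have "finite {i \<in> sample_index \<omega>. sample_point \<omega> i \<in> K}"
      by (rule finite_subset) (rule sample_prefix_exhausts)
    moreover have "K \<in> sets pos_borel"
      using K by (simp add: sets_pos_borel_iff borel_compact)
    ultimately show ?thesis
      unfolding poisson_sample_def using sample_point_pos[OF \<omega>]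
      by (subst emeasure_dirac_sum) (auto simp: less_top[symmetric])
  qed
  then have "radon_pos (poisson_sample \<omega>)"
    by (simp add: radon_pos_def poisson_sample_def)
  then show ?thesis
    using sample_point_pos[OF \<omega>] unfolding point_measures_def poisson_sample_def by blast
qed

lemma emeasure_poisson_sample_measurable:
  assumes A: "A \<in> sets pos_borel"
  shows "(\<lambda>\<omega>. emeasure (poisson_sample \<omega>) A) \<in> borel_measurable sample_space"
proof -
  have [measurable]: "Measurable.pred sample_space (\<lambda>\<omega>. i \<in> sample_index \<omega>)" for i
    unfolding sample_index_def
    using sample_count_measurable[of "fst (prod_decode i)"] by measurable
  have [measurable]: "(\<lambda>\<omega>. sample_point \<omega> i) \<in> measurable sample_space pos_borel" for i
    unfolding sample_point_def
    by (rule measurable_compose[OF sample_value_measurable cell_dist_id_measurable])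
  note A[measurable]
  have "(\<lambda>\<omega>. \<Sum>i. if i \<in> sample_index \<omega> \<and> sample_point \<omega> i \<in> A then 1 else 0 :: ennreal) \<in> borel_measurable sample_space"
    (is "?f \<in> _")
    by measurable
  moreover have "?f \<omega> = emeasure (poisson_sample \<omega>) A" if "\<omega> \<in> space sample_space" for \<omega>
    unfolding poisson_sample_def
    by (rule emeasure_dirac_sum_nat[symmetric]) (use sample_point_pos[OF that] A in auto)
  ultimately show ?thesis
    by (rule measurable_cong[THEN iffD1, rotated]) simp
qed

lemma poisson_sample_measurable: "poisson_sample \<in> measurable sample_space (borel_of vague_topology)"
proof -
  obtain T where T: "fine_grid T" using fine_grid_exists by blast
  show ?thesis
    by (rule measurable_point_process[OF T])
      (simp_all add: poisson_sample_point_measures emeasure_poisson_sample_measurable cell_pos_borel[OF T])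
qed

text \<open>The generating function of a Poisson number of points with mean weight
  \<open>a\<close> is \<open>exp (- (1 - a) c)\<close>, where \<open>c\<close> is the mass of the
  cell, and \<open>(1 - a) c\<close> is the integral of one minus the weight with respect to
  \<open>L\<close> over the cell.\<close>

lemma cell_sample_weight:
  assumes J: "finite J" "\<And>j. j \<in> J \<Longrightarrow> A j \<in> sets pos_borel" "disjoint_family_on A J"
    and s: "\<And>j. j \<in> J \<Longrightarrow> 0 < s j \<and> s j < 1"
  shows "(\<integral>z. (\<Prod>j<fst z. hit_weight J A s (snd z j)) \<partial>cell_sample n) =
     (\<Prod>j\<in>J. exp (- ((1 - s j) * measure L (A j \<inter> unit_cell n))))"
proof -
  interpret Y: prob_space "cell_dist n" by (rule prob_space_cell_dist)
  have meas: "hit_weight J A s \<in> borel_measurable (cell_dist n)"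
  proof (rule measurable_compose[OF cell_dist_id_measurable])
    show "hit_weight J A s \<in> borel_measurable pos_borel"
      unfolding pos_borel_def by (intro measurable_restrict_space1 hit_weight_measurable J)
  qed
  note bounds = hit_weight_bounds[of J s A, OF s]
  have int: "integrable (cell_dist n) (hit_weight J A s)"
    using bounds by (intro Y.integrable_unit_interval meas) auto
  define a where "a = (\<integral>y. hit_weight J A s y \<partial>cell_dist n)"
  have a: "0 \<le> a" "a \<le> 1"
    unfolding a_def using bounds by (auto intro!: Y.expectation_unit_interval meas)
  have A_sets: "A j \<inter> unit_cell n \<in> sets (cell_dist n)" if "j \<in> J" for j
    using J(2)[OF that] unfolding sets_cell_dist by (auto simp: sets_restrict_space)
  have "1 - a = (\<integral>y. 1 - hit_weight J A s y \<partial>cell_dist n)"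
    unfolding a_def using int by (simp add: Y.prob_space)
  also have "\<dots> = (\<integral>y. (\<Sum>j\<in>J. (1 - s j) * indicator (A j \<inter> unit_cell n) y) \<partial>cell_dist n)"
    unfolding hit_weight_disjoint[OF J(1,3)]
    by (intro Bochner_Integration.integral_cong refl sum.cong) (auto simp: indicator_def space_cell_dist)
  also have "\<dots> = (\<Sum>j\<in>J. (1 - s j) * measure (cell_dist n) (A j \<inter> unit_cell n))"
  proof (subst Bochner_Integration.integral_sum)
    fix j assume "j \<in> J"
    then show "integrable (cell_dist n) (\<lambda>y. (1 - s j) * indicator (A j \<inter> unit_cell n) y)"
      using A_sets by (intro integrable_mult_right integrable_real_indicator) (auto simp: less_top[symmetric])
  next
    have "A j \<inter> unit_cell n \<inter> space (cell_dist n) = A j \<inter> unit_cell n" for j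
      by (auto simp: space_cell_dist)
    then show "(\<Sum>j\<in>J. \<integral>y. (1 - s j) * indicator (A j \<inter> unit_cell n) y \<partial>cell_dist n) =
        (\<Sum>j\<in>J. (1 - s j) * measure (cell_dist n) (A j \<inter> unit_cell n))"
      by simp
  qed
  finally have "(1 - a) * cell_mass n = (\<Sum>j\<in>J. (1 - s j) * (cell_mass n * measure (cell_dist n) (A j \<inter> unit_cell n)))"
    by (simp add: sum_distrib_left mult_ac)
  also have "\<dots> = (\<Sum>j\<in>J. (1 - s j) * measure L (A j \<inter> unit_cell n))"
    using measure_cell_dist[OF J(2)] by (intro sum.cong) auto
  finally have mass: "(1 - a) * cell_mass n = (\<Sum>j\<in>J. (1 - s j) * measure L (A j \<inter> unit_cell n))" .
  have "(\<integral>z. (\<Prod>j<fst z. hit_weight J A s (snd z j)) \<partial>cell_sample n) =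
      (\<integral>k. a ^ k \<partial>measure_pmf (poisson_count_pmf (cell_mass n)))"
    unfolding cell_sample_def a_def by (rule integral_random_power[OF Y.prob_space_axioms meas bounds])
  also have "\<dots> = exp (- ((1 - a) * cell_mass n))"
    using a by (intro integral_poisson_count_power) (simp_all add: cell_mass_def)
  finally show ?thesis
    unfolding mass using J(1) by (simp add: exp_sum flip: sum_negf)
qed

text \<open>The product over the first \<open>m\<close> cells factorises by independence. As
  \<open>m \<rightarrow> \<infinity>\<close> the exponents add up to \<open>(1 - s j) * L (A
  j)\<close>, which may be infinite.\<close>

lemma poisson_sample_pgf:
  assumes J: "finite J" "\<And>j. j \<in> J \<Longrightarrow> A j \<in> sets pos_borel" "disjoint_family_on A J"
    and s: "\<And>j. j \<in> J \<Longrightarrow> 0 < s j \<and> s j < 1"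
  shows "(\<integral>\<omega>. (\<Prod>j\<in>J. count_power (s j) (emeasure (poisson_sample \<omega>) (A j))) \<partial>sample_space) =
    (\<Prod>j\<in>J. poisson_pgf (emeasure L (A j)) (s j))"
proof -
  interpret prob_space sample_space by (rule prob_space_sample_space)
  define h where "h z = (\<Prod>j<fst z. hit_weight J A s (snd z j))" for z :: "nat \<times> (nat \<Rightarrow> real)"
  note bounds = hit_weight_bounds[of J s A, OF s]
  have h_bounds: "0 \<le> h z" "h z \<le> 1" for z
    unfolding h_def using bounds by (auto intro!: prod_nonneg prod_le_1)
  have h_meas: "h \<in> borel_measurable (cell_sample n)" for n
  proof -
    have 1: "fst \<in> measurable (cell_sample n) (count_space UNIV)"
      unfolding cell_sample_def by (rule measurable_compose[OF measurable_fst]) simp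
    have 2: "(\<lambda>z. hit_weight J A s (snd z j)) \<in> borel_measurable (cell_sample n)" for j
    proof (rule measurable_compose[where N = "cell_dist n" and f = "\<lambda>z. snd z j" and g = "hit_weight J A s"])
      show "(\<lambda>z. snd z j) \<in> measurable (cell_sample n) (cell_dist n)"
        unfolding cell_sample_def
        by (rule measurable_compose[OF measurable_snd]) (simp add: measurable_component_singleton)
      show "hit_weight J A s \<in> borel_measurable (cell_dist n)"
      proof (rule measurable_compose[OF cell_dist_id_measurable])
        show "hit_weight J A s \<in> borel_measurable pos_borel"
          unfolding pos_borel_def by (intro measurable_restrict_space1 hit_weight_measurable J)
      qed
    qed
    show ?thesis
      unfolding h_def
      by (rule measurable_compose_countable'[where I = UNIV and g = fst and
            f = "\<lambda>k z. \<Prod>j<k. hit_weight J A s (snd z j)"])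
        (use 1 2 in auto)
  qed
  have prefix: "(\<Prod>i\<in>sample_prefix \<omega> m. hit_weight J A s (sample_point \<omega> i)) = (\<Prod>n<m. h (\<omega> n))" for \<omega> m
  proof -
    have "(\<Prod>i\<in>sample_prefix \<omega> m. hit_weight J A s (sample_point \<omega> i)) =
        (\<Prod>(n, j)\<in>(SIGMA n:{..<m}. {..<fst (\<omega> n)}). hit_weight J A s (snd (\<omega> n) j))"
      unfolding sample_prefix_def
      by (subst prod.reindex) (auto simp: sample_point_def inj_prod_encode split_beta' intro!: prod.cong)
    also have "\<dots> = (\<Prod>n<m. \<Prod>j<fst (\<omega> n). hit_weight J A s (snd (\<omega> n) j))"
      by (rule prod.Sigma[symmetric]) auto
    finally show ?thesis by (simp add: h_def)
  qed
  have 1: "(\<lambda>m. \<integral>\<omega>. (\<Prod>n<m. h (\<omega> n)) \<partial>sample_space) \<longlonglongrightarrow>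
      (\<integral>\<omega>. (\<Prod>j\<in>J. count_power (s j) (emeasure (poisson_sample \<omega>) (A j))) \<partial>sample_space)"
  proof (rule integral_dominated_convergence[where w = "\<lambda>_. 1"])
    show "AE \<omega> in sample_space. (\<lambda>m. \<Prod>n<m. h (\<omega> n)) \<longlonglongrightarrow>
        (\<Prod>j\<in>J. count_power (s j) (emeasure (poisson_sample \<omega>) (A j)))"
    proof (rule AE_I2)
      fix \<omega> assume \<omega>: "\<omega> \<in> space sample_space"
      show "(\<lambda>m. \<Prod>n<m. h (\<omega> n)) \<longlonglongrightarrow> (\<Prod>j\<in>J. count_power (s j) (emeasure (poisson_sample \<omega>) (A j)))"
        unfolding prefix[symmetric] poisson_sample_def
        by (rule hit_weight_prod_tendsto[OF sample_point_pos[OF \<omega>] J(1,2) s])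
          (use sample_prefix_exhausts in auto)
    qed
    show "AE \<omega> in sample_space. norm (\<Prod>n<m. h (\<omega> n)) \<le> 1" for m
      by (intro AE_I2) (simp add: abs_prod abs_of_nonneg[OF h_bounds(1)] prod_le_1 h_bounds)
    show "(\<lambda>\<omega>. \<Prod>n<m. h (\<omega> n)) \<in> borel_measurable sample_space" for m
      unfolding sample_space_def
    proof (rule borel_measurable_prod)
      fix n
      show "(\<lambda>\<omega>. h (\<omega> n)) \<in> borel_measurable (PiM UNIV cell_sample)"
        by (rule measurable_compose[where f = "\<lambda>\<omega>. \<omega> n" and g = h, OF measurable_component_singleton h_meas]) simp
    qed
    show "(\<lambda>\<omega>. \<Prod>j\<in>J. count_power (s j) (emeasure (poisson_sample \<omega>) (A j))) \<in> borel_measurable sample_space"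
      by (intro borel_measurable_prod measurable_compose[OF emeasure_poisson_sample_measurable count_power_measurable] J(2))
  qed simp
  have 2: "(\<integral>\<omega>. (\<Prod>n<m. h (\<omega> n)) \<partial>sample_space) =
      (\<Prod>j\<in>J. exp (- ((1 - s j) * (\<Sum>n<m. measure L (A j \<inter> unit_cell n)))))" for m
  proof -
    have "(\<integral>\<omega>. (\<Prod>n<m. h (\<omega> n)) \<partial>sample_space) = (\<Prod>n<m. \<integral>z. h z \<partial>cell_sample n)"
      unfolding sample_space_def
      by (rule PiM_integral_prod[where h = "\<lambda>_. h"]) (use prob_space_cell_sample h_meas h_bounds in auto)
    also have "\<dots> = (\<Prod>n<m. \<Prod>j\<in>J. exp (- ((1 - s j) * measure L (A j \<inter> unit_cell n))))"
      unfolding h_def using cell_sample_weight[OF J s] by simp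
    also have "\<dots> = (\<Prod>j\<in>J. \<Prod>n<m. exp (- ((1 - s j) * measure L (A j \<inter> unit_cell n))))"
      by (rule prod.swap)
    also have "\<dots> = (\<Prod>j\<in>J. exp (- ((1 - s j) * (\<Sum>n<m. measure L (A j \<inter> unit_cell n)))))"
      by (simp add: exp_sum[symmetric] sum_distrib_left sum_negf)
    finally show ?thesis .
  qed
  have 3: "(\<lambda>m. \<Prod>j\<in>J. exp (- ((1 - s j) * (\<Sum>n<m. measure L (A j \<inter> unit_cell n)))))
      \<longlonglongrightarrow> (\<Prod>j\<in>J. poisson_pgf (emeasure L (A j)) (s j))"
  proof (intro tendsto_prod exp_tendsto_poisson_pgf)
    fix j assume j: "j \<in> J"
    have "emeasure L (A j \<inter> unit_cell n) < \<infinity>" for n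
    proof -
      have "emeasure L (A j \<inter> unit_cell n) \<le> emeasure L (unit_cell n)"
        by (intro emeasure_mono) (auto simp: sets_L)
      then show ?thesis using L_unit_cell_finite[of n] by (rule le_less_trans)
    qed
    then have "ennreal (measure L (A j \<inter> unit_cell n)) = emeasure L (A j \<inter> unit_cell n)" for n
      by (intro emeasure_eq_ennreal_measure[symmetric]) (simp add: less_top)
    then have "ennreal (\<Sum>n<m. measure L (A j \<inter> unit_cell n)) = (\<Sum>n<m. emeasure L (A j \<inter> unit_cell n))" for m
      by (simp add: sum_ennreal[symmetric])
    moreover have "(\<lambda>n. emeasure L (A j \<inter> unit_cell n)) sums emeasure L (A j)"
    proof -
      have "(\<Sum>n. emeasure L (A j \<inter> unit_cell n)) = emeasure L (\<Union>n. A j \<inter> unit_cell n)"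
      proof (rule suminf_emeasure)
        show "range (\<lambda>n. A j \<inter> unit_cell n) \<subseteq> sets L"
          using J(2)[OF j] by (auto simp: sets_L)
        show "disjoint_family (\<lambda>n. A j \<inter> unit_cell n)"
          using disjoint_unit_cells by (auto simp: disjoint_family_on_def)
      qed
      also have "(\<Union>n. A j \<inter> unit_cell n) = A j"
        using J(2)[OF j] UN_unit_cell by (auto simp: sets_pos_borel_iff)
      finally show ?thesis by (simp add: sums_iff)
    qed
    ultimately show "(\<lambda>m. ennreal (\<Sum>n<m. measure L (A j \<inter> unit_cell n))) \<longlonglongrightarrow> emeasure L (A j)"
      by (simp add: sums_def)
  qed (use s in \<open>auto intro!: sum_nonneg\<close>)
  show ?thesis
    using LIMSEQ_unique[OF 1[unfolded 2] 3] .
qed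

definition poisson_law :: "real measure measure" where
  "poisson_law = distr sample_space (borel_of vague_topology) poisson_sample"

text \<open>The generating function of the counts is that of independent Poisson variables, and it
  determines their joint law.\<close>

lemma poisson_law_counts:
  assumes J: "finite J" "\<And>j. j \<in> J \<Longrightarrow> A j \<in> sets pos_borel" "disjoint_family_on A J"
  shows "measure poisson_law {\<nu> \<in> point_measures. \<forall>j\<in>J. emeasure \<nu> (A j) = of_nat (k j)} =
    (\<Prod>j\<in>J. poisson_prob (emeasure L (A j)) (k j))"
proof -
  interpret Q: prob_space poisson_law
    unfolding poisson_law_def
    by (rule prob_space.prob_space_distr[OF prob_space_sample_space poisson_sample_measurable])
  have space: "space poisson_law = point_measures"
    by (simp add: poisson_law_def)
  have meas: "(\<lambda>\<nu>. emeasure \<nu> (A j)) \<in> borel_measurable poisson_law" if "j \<in> J" for j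
    unfolding poisson_law_def using evaluation_measurable[OF J(2)[OF that]] by simp
  have "(\<lambda>n::nat. Q.prob {\<nu> \<in> space poisson_law. \<forall>j\<in>J. emeasure \<nu> (A j) = of_nat (k j)})
      \<longlonglongrightarrow> (\<Prod>j\<in>J. poisson_prob (emeasure L (A j)) (k j))"
  proof (rule Q.pgf_convergence[OF J(1)])
    show "AE \<nu> in poisson_law. emeasure \<nu> (A j) \<in> count_values" if "j \<in> J" for j
      using point_measures_counts[OF _ J(2)[OF that]] by (intro AE_I2) (simp add: space)
  next
    fix s :: "'a \<Rightarrow> real" assume s: "\<And>j. 0 < s j \<and> s j < 1"
    have "(\<integral>\<nu>. (\<Prod>j\<in>J. count_power (s j) (emeasure \<nu> (A j))) \<partial>poisson_law) =
        (\<integral>\<omega>. (\<Prod>j\<in>J. count_power (s j) (emeasure (poisson_sample \<omega>) (A j))) \<partial>sample_space)"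
      unfolding poisson_law_def
      by (intro integral_distr poisson_sample_measurable borel_measurable_prod
          measurable_compose[OF evaluation_measurable count_power_measurable] J(2))
    also have "\<dots> = (\<Prod>j\<in>J. poisson_pgf (emeasure L (A j)) (s j))"
      using s by (intro poisson_sample_pgf J)
    finally show "(\<lambda>n::nat. \<integral>\<nu>. (\<Prod>j\<in>J. count_power (s j) (emeasure \<nu> (A j))) \<partial>poisson_law)
        \<longlonglongrightarrow> (\<Prod>j\<in>J. poisson_pgf (emeasure L (A j)) (s j))"
      by simp
  qed (rule meas)
  then show ?thesis
    unfolding space using LIMSEQ_unique tendsto_const by blast
qed

text \<open>Independence of the counts is checked on the events that prescribe finite values. They
  form an intersection stable system, and they generate all events about a count because the value
  \<open>\<infinity>\<close> is the complement of the finite ones.\<close>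

lemma poisson_process_law_poisson_law: "poisson_process_law L poisson_law"
proof -
  interpret Q: prob_space poisson_law
    unfolding poisson_law_def
    by (rule prob_space.prob_space_distr[OF prob_space_sample_space poisson_sample_measurable])
  have space: "space poisson_law = point_measures"
    by (simp add: poisson_law_def)
  have meas: "(\<lambda>\<nu>. emeasure \<nu> A) \<in> borel_measurable poisson_law" if "A \<in> sets pos_borel" for A
    unfolding poisson_law_def using evaluation_measurable[OF that] by simp
  have single: "measure poisson_law {\<nu> \<in> point_measures. emeasure \<nu> A = of_nat k} = poisson_prob (emeasure L A) k"
    if "A \<in> sets pos_borel" for A k
    using poisson_law_counts[of "{()}" "\<lambda>_. A" "\<lambda>_. k"] that by (simp add: disjoint_family_on_def)
  have indep: "Q.indep_vars (\<lambda>_. borel) (\<lambda>i \<nu>. emeasure \<nu> (A i)) {..<n}"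
    if A: "\<forall>i<n. A i \<in> sets pos_borel" "disjoint_family_on A {..<n}" for n and A :: "nat \<Rightarrow> real set"
  proof -
    define E where "E i = insert {} (range (\<lambda>k::nat. {\<nu> \<in> point_measures. emeasure \<nu> (A i) = of_nat k}))" for i
    have E_event: "X \<in> Q.events" if "i < n" "X \<in> E i" for i X
    proof -
      have [measurable]: "(\<lambda>\<nu>. emeasure \<nu> (A i)) \<in> borel_measurable poisson_law"
        using A(1) that(1) by (intro meas) auto
      have "{\<nu> \<in> space poisson_law. emeasure \<nu> (A i) = of_nat k} \<in> Q.events" for k :: nat
        by measurable
      then show ?thesis using that(2) by (auto simp: E_def space)
    qed
    have "Q.indep_sets E {..<n}"
    proof (rule Q.indep_setsI)
      show "E i \<subseteq> Q.events" if "i \<in> {..<n}" for i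
        using E_event that by auto
    next
      fix X J assume J: "J \<noteq> {}" "J \<subseteq> {..<n}" "finite J" and X: "\<forall>j\<in>J. X j \<in> E j"
      show "Q.prob (\<Inter>j\<in>J. X j) = (\<Prod>j\<in>J. Q.prob (X j))"
      proof (cases "\<exists>j\<in>J. X j = {}")
        case True
        then obtain j where j: "j \<in> J" "X j = {}" by blast
        then have "(\<Inter>j\<in>J. X j) = {}" by blast
        moreover have "(\<Prod>j\<in>J. Q.prob (X j)) = 0"
          using j by (intro prod_zero[OF J(3)] bexI[of _ j]) simp_all
        ultimately show ?thesis by simp
      next
        case False
        then have "\<forall>j\<in>J. \<exists>k::nat. X j = {\<nu> \<in> point_measures. emeasure \<nu> (A j) = of_nat k}"
          using X unfolding E_def by blast
        then obtain k :: "nat \<Rightarrow> nat" where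
          k: "\<And>j. j \<in> J \<Longrightarrow> X j = {\<nu> \<in> point_measures. emeasure \<nu> (A j) = of_nat (k j)}"
          by metis
        have AJ: "A j \<in> sets pos_borel" if "j \<in> J" for j
          using that J(2) A(1) by auto
        have "(\<Inter>j\<in>J. X j) = {\<nu> \<in> point_measures. \<forall>j\<in>J. emeasure \<nu> (A j) = of_nat (k j)}"
          using k J(1) by auto
        also have "Q.prob \<dots> = (\<Prod>j\<in>J. poisson_prob (emeasure L (A j)) (k j))"
          using J(3) AJ disjoint_family_on_mono[OF J(2) A(2)] by (rule poisson_law_counts)
        also have "\<dots> = (\<Prod>j\<in>J. Q.prob (X j))"
          using k single[OF AJ] by (intro prod.cong) auto
        finally show ?thesis .
      qed
    qed
    then have "Q.indep_sets (\<lambda>i. sigma_sets (space poisson_law) (E i)) {..<n}"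
    proof (rule Q.indep_sets_sigma)
      show "Int_stable (E i)" for i
        by (auto simp: E_def Int_stable_def)
    qed
    then have "Q.indep_sets (\<lambda>i. {(\<lambda>\<nu>. emeasure \<nu> (A i)) -` B \<inter> space poisson_law | B. B \<in> sets borel}) {..<n}"
    proof (rule Q.indep_sets_mono_sets)
      fix i assume i: "i \<in> {..<n}"
      interpret S: sigma_algebra "space poisson_law" "sigma_sets (space poisson_law) (E i)"
        using E_event i sets.sets_into_space by (intro sigma_algebra_sigma_sets) blast
      have fin: "{\<nu> \<in> point_measures. emeasure \<nu> (A i) = of_nat k} \<in> sigma_sets (space poisson_law) (E i)" for k :: nat
        by (rule sigma_sets.Basic) (auto simp: E_def)
      have fins: "(\<Union>k\<in>K. {\<nu> \<in> point_measures. emeasure \<nu> (A i) = of_nat k}) \<in> sigma_sets (space poisson_law) (E i)"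
        for K :: "nat set"
        using fin by (intro S.countable_UN') auto
      show "{(\<lambda>\<nu>. emeasure \<nu> (A i)) -` B \<inter> space poisson_law | B. B \<in> sets borel} \<subseteq> sigma_sets (space poisson_law) (E i)"
      proof safe
        fix B :: "ennreal set"
        let ?F = "\<Union>k\<in>{k. of_nat k \<in> B}. {\<nu> \<in> point_measures. emeasure \<nu> (A i) = of_nat k}"
        let ?I = "space poisson_law - (\<Union>k\<in>UNIV. {\<nu> \<in> point_measures. emeasure \<nu> (A i) = of_nat k})"
        have cv: "emeasure \<nu> (A i) \<in> count_values" if "\<nu> \<in> point_measures" for \<nu>
          using point_measures_counts[OF that] A(1) i by auto
        have "(\<lambda>\<nu>. emeasure \<nu> (A i)) -` B \<inter> space poisson_law = (if \<infinity> \<in> B then ?F \<union> ?I else ?F)"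
        proof (rule set_eqI)
          fix \<nu>
          show "\<nu> \<in> (\<lambda>\<nu>. emeasure \<nu> (A i)) -` B \<inter> space poisson_law \<longleftrightarrow> \<nu> \<in> (if \<infinity> \<in> B then ?F \<union> ?I else ?F)"
          proof (cases "\<nu> \<in> point_measures \<and> emeasure \<nu> (A i) \<noteq> \<infinity>")
            case True
            then obtain k :: nat where "emeasure \<nu> (A i) = of_nat k"
              using cv[of \<nu>] by (auto simp: count_values_def)
            then show ?thesis using True by (auto simp: space)
          qed (auto simp: space)
        qed
        also have "\<dots> \<in> sigma_sets (space poisson_law) (E i)"
          using fins[of UNIV] fins[of "{k. of_nat k \<in> B}"] by (auto intro!: S.Un S.compl_sets)
        finally show "(\<lambda>\<nu>. emeasure \<nu> (A i)) -` B \<inter> space poisson_law \<in> sigma_sets (space poisson_law) (E i)" .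
      qed
    qed
    then show ?thesis
      using A(1) meas unfolding Q.indep_vars_def2 by simp
  qed
  show ?thesis
    unfolding poisson_process_law_def
  proof (intro conjI ballI allI impI)
    show "sets poisson_law = sets (borel_of vague_topology)"
      by (simp add: poisson_law_def)
    show "measure poisson_law {\<nu> \<in> space poisson_law. emeasure \<nu> A = of_nat k} =
        (if emeasure L A < \<infinity> then exp (- measure L A) * measure L A ^ k / fact k else 0)"
      if "A \<in> sets pos_borel" for A k
      using single[OF that] by (simp add: space poisson_prob_def measure_def[of L])
  qed (use Q.prob_space_axioms space indep in auto)
qed

end

section \<open>Mean numbers of points\<close>

text \<open>The Galois connection between \<open>h\<close> and its inverse. Left continuity is
  what excludes \<open>y < h r\<close> with \<open>h \<le> y\<close> on \<open>[0, r)\<close>, in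
  which case the inverse at \<open>y\<close> would still be at least \<open>r\<close>.\<close>

lemma le_gen_inverse_iff:
  assumes h: "mono_on {0..} h" "\<And>r. 0 < r \<Longrightarrow> continuous (at_left r) h" and r: "0 < r"
  shows "ennreal r \<le> gen_inverse h y \<longleftrightarrow> h r \<le> y"
proof
  assume hr: "h r \<le> y"
  have "ennreal r \<le> ennreal x" if "0 \<le> x" "y < h x" for x
  proof (rule ennreal_leI, rule ccontr)
    assume "\<not> r \<le> x"
    then have "h x \<le> h r" using h(1) that r by (auto simp: mono_on_def)
    then show False using hr that by simp
  qed
  then show "ennreal r \<le> gen_inverse h y"
    unfolding gen_inverse_def by (intro Inf_greatest) auto
next
  assume le: "ennreal r \<le> gen_inverse h y"
  show "h r \<le> y"
  proof (rule ccontr)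
    assume "\<not> h r \<le> y"
    then have "y < h r" by simp
    moreover have "(h \<longlongrightarrow> h r) (at_left r)"
      using h(2)[OF r] by (simp add: continuous_within)
    ultimately have "\<forall>\<^sub>F x in at_left r. y < h x"
      by (intro order_tendstoD)
    moreover have "\<forall>\<^sub>F x in at_left r. 0 < x \<and> x < r"
      using eventually_at_left_real[OF r] by simp
    ultimately have "\<forall>\<^sub>F x in at_left r. y < h x \<and> 0 < x \<and> x < r"
      by eventually_elim simp
    then obtain x where x: "y < h x" "0 < x" "x < r"
      using eventually_happens'[OF trivial_limit_at_left_real] by blast
    have "gen_inverse h y \<le> ennreal x"
      unfolding gen_inverse_def using x by (intro Inf_lower) auto
    also have "\<dots> < ennreal r"
      using x by (simp add: ennreal_less_iff)
    finally show False using le by simp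
  qed
qed

lemma mono_gen_inverse: "mono (gen_inverse h)"
  unfolding gen_inverse_def by (intro monoI Inf_superset_mono) auto

lemma extend_infty_finite: "0 \<le> r \<Longrightarrow> extend_infty D (ennreal r) = ennreal (D r)"
  by (simp add: extend_infty_def)

text \<open>By monotonicity the limit defining \<open>D(\<infinity>)\<close> exists and is a
  supremum.\<close>

lemma extend_infty_infinity:
  assumes D: "mono_on {0..} D"
  shows "extend_infty D \<infinity> = (SUP x\<in>{0..}. ennreal (D x))"
proof -
  have "((\<lambda>x. ennreal (D x)) \<longlongrightarrow> (SUP x\<in>{0..}. ennreal (D x))) at_top"
  proof (rule order_tendstoI)
    fix a assume "a < (SUP x\<in>{0..}. ennreal (D x))"
    then obtain x where x: "0 \<le> x" "a < ennreal (D x)"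
      by (auto simp: less_SUP_iff)
    show "\<forall>\<^sub>F x in at_top. a < ennreal (D x)"
      using eventually_ge_at_top[of x]
    proof eventually_elim
      case (elim x')
      then have "D x \<le> D x'" using D x by (auto simp: mono_on_def)
      then show ?case using x by (meson ennreal_leI less_le_trans)
    qed
  next
    fix a assume a: "(SUP x\<in>{0..}. ennreal (D x)) < a"
    show "\<forall>\<^sub>F x in at_top. ennreal (D x) < a"
      using eventually_ge_at_top[of 0]
    proof eventually_elim
      case (elim x)
      then have "ennreal (D x) \<le> (SUP x\<in>{0..}. ennreal (D x))" by (intro SUP_upper) auto
      then show ?case using a by (rule le_less_trans)
    qed
  qed
  then have "Lim at_top (\<lambda>x. ennreal (D x)) = (SUP x\<in>{0..}. ennreal (D x))"
    by (intro tendsto_Lim) auto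
  then show ?thesis by (simp add: extend_infty_def)
qed

lemma mono_extend_infty:
  assumes D: "mono_on {0..} D"
  shows "mono (extend_infty D)"
proof (rule monoI)
  fix r r' :: ennreal assume le: "r \<le> r'"
  show "extend_infty D r \<le> extend_infty D r'"
  proof (cases r)
    case top
    then show ?thesis using le by (simp add: top_unique)
  next
    case (real x)
    show ?thesis
    proof (cases r')
      case top
      have "ennreal (D x) \<le> (SUP x\<in>{0..}. ennreal (D x))"
        using real by (intro SUP_upper) auto
      then show ?thesis
        using real top extend_infty_infinity[OF D] by (simp add: extend_infty_finite)
    next
      case (real x')
      then have "x \<le> x'" using le \<open>r = ennreal x\<close> \<open>0 \<le> x\<close> by simp
      then have "D x \<le> D x'" using D \<open>0 \<le> x\<close> by (auto simp: mono_on_def)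
      then show ?thesis
        using real \<open>r = ennreal x\<close> \<open>0 \<le> x\<close> by (simp add: extend_infty_finite ennreal_leI)
    qed
  qed
qed

text \<open>The sets \<open>{x. y < f x}\<close> are closed upwards, so their indicators are
  monotone real functions, which are Borel.\<close>

lemma mono_borel_measurable_ennreal:
  fixes f :: "real \<Rightarrow> ennreal"
  assumes "mono f"
  shows "f \<in> borel_measurable borel"
proof (rule borel_measurableI_greater)
  fix y
  let ?U = "{x. y < f x}"
  have "mono (indicator ?U :: real \<Rightarrow> real)"
    using assms by (intro monoI) (auto simp: indicator_def mono_def intro: less_le_trans)
  then have [measurable]: "(indicator ?U :: real \<Rightarrow> real) \<in> borel_measurable borel"
    by (rule borel_measurable_mono)
  have "{x \<in> space borel. indicator ?U x = (1::real)} \<in> sets borel"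
    by measurable
  moreover have "{x \<in> space borel. indicator ?U x = (1::real)} = {x \<in> space borel. y < f x}"
    by (auto simp: indicator_def)
  ultimately show "{x \<in> space borel. y < f x} \<in> sets borel" by (simp only:)
qed

text \<open>The counting function of the configuration, extended to infinite radius and to
  infinite counts so that it can be composed with the generalised inverse.\<close>

definition ball_count :: "'a::real_normed_vector set \<Rightarrow> ennreal \<Rightarrow> ennreal" where
  "ball_count \<xi> r = emeasure (count_space \<xi>) {x \<in> \<xi>. ennreal (norm x) \<le> r}"

lemma mono_ball_count: "mono (ball_count \<xi>)"
  unfolding ball_count_def by (intro monoI emeasure_mono) auto

lemma ball_count_num_points:
  assumes "locally_finite_config \<xi>" "0 \<le> r"
  shows "ball_count \<xi> (ennreal r) = ennreal (real (num_points \<xi> r))"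
proof -
  have "finite {x \<in> \<xi>. norm x \<le> r}"
    using assms(1) by (simp add: locally_finite_config_def)
  moreover have "{x \<in> \<xi>. ennreal (norm x) \<le> ennreal r} = {x \<in> \<xi>. norm x \<le> r}"
    using assms(2) by auto
  ultimately show ?thesis
    by (simp add: ball_count_def num_points_def ennreal_of_nat_eq_real_of_nat)
qed

lemma ball_count_infinity:
  assumes "locally_finite_config \<xi>"
  shows "ball_count \<xi> \<infinity> = (SUP n. ball_count \<xi> (ennreal (real n)))"
proof -
  have "(SUP n. emeasure (count_space \<xi>) {x \<in> \<xi>. ennreal (norm x) \<le> ennreal (real n)}) =
      emeasure (count_space \<xi>) (\<Union>n. {x \<in> \<xi>. ennreal (norm x) \<le> ennreal (real n)})"
    by (intro SUP_emeasure_incseq) (auto simp: mono_def)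
  also have "(\<Union>n. {x \<in> \<xi>. ennreal (norm x) \<le> ennreal (real n)}) = {x \<in> \<xi>. ennreal (norm x) \<le> \<infinity>}"
    using real_arch_simple by auto
  finally show ?thesis by (simp add: ball_count_def)
qed

lemma locally_finite_config_countable:
  assumes "locally_finite_config \<xi>"
  shows "countable \<xi>"
proof -
  have "\<xi> = (\<Union>n. {x \<in> \<xi>. norm x \<le> real n})"
    using real_arch_simple by auto
  moreover have "countable (\<Union>n. {x \<in> \<xi>. norm x \<le> real n})"
    using assms by (intro countable_UN) (auto simp: locally_finite_config_def intro: countable_finite)
  ultimately show ?thesis by simp
qed

text \<open>The origin is neither a point nor a limit of points of the configuration.\<close>

lemma locally_finite_config_gap:
  assumes "locally_finite_config \<xi>"
  obtains r0 where "0 < r0" "\<And>x. x \<in> \<xi> \<Longrightarrow> r0 \<le> norm x"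
proof -
  let ?F = "insert 1 (norm ` {x \<in> \<xi>. norm x \<le> 1})"
  have fin: "finite ?F"
    using assms by (simp add: locally_finite_config_def)
  have "x \<noteq> 0" if "x \<in> \<xi>" for x
    using assms that by (auto simp: locally_finite_config_def)
  then have "0 < Min ?F"
    using fin by (subst Min_gr_iff) auto
  moreover have "Min ?F \<le> norm x" if "x \<in> \<xi>" for x
  proof (cases "norm x \<le> 1")
    case True
    then show ?thesis using that fin by (intro Min_le) auto
  next
    case False
    have "Min ?F \<le> 1" using fin by (intro Min_le) auto
    then show ?thesis using False by simp
  qed
  ultimately show ?thesis by (rule that)
qed

text \<open>For finite radii this is the convergence of the ratio, where \<open>D r \<noteq>
  0\<close> because the ratio is close to \<open>1\<close>. Both functions at infinite radius are
  suprema of their values at finite radii, so the bounds persist there.\<close>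

lemma ball_count_compare:
  assumes \<xi>: "locally_finite_config \<xi>" and D: "mono_on {0..} D" "\<And>r. 0 \<le> r \<Longrightarrow> 0 \<le> D r"
    and ratio: "((\<lambda>r. real (num_points \<xi> r) / D r) \<longlongrightarrow> 1) at_top"
    and \<epsilon>: "0 < \<epsilon>" "\<epsilon> < 1"
  obtains R where "0 < R"
    "\<And>r. ennreal R \<le> r \<Longrightarrow> ennreal (1 - \<epsilon>) * extend_infty D r \<le> ball_count \<xi> r"
    "\<And>r. ennreal R \<le> r \<Longrightarrow> ball_count \<xi> r \<le> ennreal (1 + \<epsilon>) * extend_infty D r"
proof -
  have "\<forall>\<^sub>F r in at_top. dist (real (num_points \<xi> r) / D r) 1 < \<epsilon>"
    using ratio \<epsilon>(1) by (rule tendstoD)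
  then obtain R0 where R0: "\<And>r. R0 \<le> r \<Longrightarrow> dist (real (num_points \<xi> r) / D r) 1 < \<epsilon>"
    by (auto simp: eventually_at_top_linorder)
  define R where "R = max 1 R0"
  have R: "0 < R" by (simp add: R_def)
  have num: "(1 - \<epsilon>) * D r \<le> real (num_points \<xi> r)" "real (num_points \<xi> r) \<le> (1 + \<epsilon>) * D r"
    if "R \<le> r" for r
  proof -
    have r: "0 \<le> r" "dist (real (num_points \<xi> r) / D r) 1 < \<epsilon>"
      using that R0[of r] by (auto simp: R_def)
    then have "D r \<noteq> 0" using \<epsilon> by (auto simp: dist_real_def)
    then have "0 < D r" using D(2)[OF r(1)] by simp
    moreover have "1 - \<epsilon> \<le> real (num_points \<xi> r) / D r" "real (num_points \<xi> r) / D r \<le> 1 + \<epsilon>"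
      using r(2) by (auto simp: dist_real_def)
    ultimately show "(1 - \<epsilon>) * D r \<le> real (num_points \<xi> r)" "real (num_points \<xi> r) \<le> (1 + \<epsilon>) * D r"
      by (simp_all add: field_simps)
  qed
  have fin: "ennreal (1 - \<epsilon>) * ennreal (D x) \<le> ball_count \<xi> (ennreal x)"
    "ball_count \<xi> (ennreal x) \<le> ennreal (1 + \<epsilon>) * ennreal (D x)" if "R \<le> x" for x
  proof -
    have x: "0 \<le> x" using R that by simp
    show "ennreal (1 - \<epsilon>) * ennreal (D x) \<le> ball_count \<xi> (ennreal x)"
      unfolding ball_count_num_points[OF \<xi> x]
      using ennreal_leI[OF num(1)[OF that]] ennreal_mult[of "1 - \<epsilon>" "D x"] \<epsilon> D(2)[OF x] by simp
    show "ball_count \<xi> (ennreal x) \<le> ennreal (1 + \<epsilon>) * ennreal (D x)"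
      unfolding ball_count_num_points[OF \<xi> x]
      using ennreal_leI[OF num(2)[OF that]] ennreal_mult[of "1 + \<epsilon>" "D x"] \<epsilon> D(2)[OF x]
      by (simp del: ennreal_plus)
  qed
  have D_le: "ennreal (D x) \<le> extend_infty D \<infinity>" if "0 \<le> x" for x
    unfolding extend_infty_infinity[OF D(1)] using that by (intro SUP_upper) auto
  show ?thesis
  proof (rule that[OF R])
    fix r :: ennreal assume r: "ennreal R \<le> r"
    show "ennreal (1 - \<epsilon>) * extend_infty D r \<le> ball_count \<xi> r"
    proof (cases r)
      case (real x)
      then show ?thesis using r R fin(1)[of x] by (simp add: extend_infty_finite)
    next
      case top
      have "ennreal (1 - \<epsilon>) * ennreal (D x) \<le> ball_count \<xi> \<infinity>" if x: "x \<in> {0..}" for x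
      proof -
        have "ennreal (D x) \<le> ennreal (D (max x R))"
          using D(1) x by (intro ennreal_leI) (auto simp: mono_on_def)
        then have "ennreal (1 - \<epsilon>) * ennreal (D x) \<le> ennreal (1 - \<epsilon>) * ennreal (D (max x R))"
          by (rule mult_left_mono) simp
        also have "\<dots> \<le> ball_count \<xi> (ennreal (max x R))"
          by (rule fin(1)) simp
        also have "\<dots> \<le> ball_count \<xi> \<infinity>"
          by (rule monoD[OF mono_ball_count]) simp
        finally show ?thesis .
      qed
      then show ?thesis
        using top extend_infty_infinity[OF D(1)] by (simp add: SUP_mult_left_ennreal SUP_le_iff)
    qed
    show "ball_count \<xi> r \<le> ennreal (1 + \<epsilon>) * extend_infty D r"
    proof (cases r)
      case (real x)
      then show ?thesis using r R fin(2)[of x] by (simp add: extend_infty_finite)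
    next
      case top
      have "ball_count \<xi> (ennreal (real n)) \<le> ennreal (1 + \<epsilon>) * extend_infty D \<infinity>" for n
      proof -
        have "ball_count \<xi> (ennreal (real n)) \<le> ball_count \<xi> (ennreal (max (real n) R))"
          by (intro monoD[OF mono_ball_count] ennreal_leI) simp
        also have "\<dots> \<le> ennreal (1 + \<epsilon>) * ennreal (D (max (real n) R))"
          by (rule fin(2)) simp
        also have "\<dots> \<le> ennreal (1 + \<epsilon>) * extend_infty D \<infinity>"
          using R by (intro mult_left_mono D_le) auto
        finally show ?thesis .
      qed
      then show ?thesis
        using top ball_count_infinity[OF \<xi>] by (simp add: SUP_le_iff)
    qed
  qed
qed

lemma tendsto_ennreal_margins:
  fixes f :: "'i \<Rightarrow> ennreal"
  assumes l: "0 \<le> l"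
    and upper: "\<And>\<eta>. 0 < \<eta> \<Longrightarrow> \<forall>\<^sub>F n in F. f n \<le> ennreal (l + \<eta>)"
    and lower: "\<And>\<eta>. 0 < \<eta> \<Longrightarrow> \<forall>\<^sub>F n in F. ennreal (l - \<eta>) \<le> f n"
  shows "(f \<longlongrightarrow> ennreal l) F"
proof (rule order_tendstoI)
  fix a assume a: "a < ennreal l"
  then obtain x where x: "a = ennreal x" "0 \<le> x" "x < l"
    by (cases a) (auto simp: ennreal_less_iff)
  have "\<forall>\<^sub>F n in F. ennreal (l - (l - x) / 2) \<le> f n"
    using x by (intro lower) simp
  then show "\<forall>\<^sub>F n in F. a < f n"
  proof eventually_elim
    case (elim n)
    have "a < ennreal (l - (l - x) / 2)"
      unfolding x(1) using x by (subst ennreal_less_iff) (auto simp: field_simps)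
    then show ?case using elim by (rule less_le_trans)
  qed
next
  fix a assume a: "ennreal l < a"
  then obtain x where x: "l < x" "ennreal x \<le> a"
  proof (cases a)
    case (real x)
    then show ?thesis using a l that[of x] by (simp add: ennreal_less_iff)
  next
    case top
    then show ?thesis using that[of "l + 1"] by simp
  qed
  have "\<forall>\<^sub>F n in F. f n \<le> ennreal (l + (x - l) / 2)"
    using x by (intro upper) simp
  then show "\<forall>\<^sub>F n in F. f n < a"
  proof eventually_elim
    case (elim n)
    have "ennreal (l + (x - l) / 2) < ennreal x"
      using x l by (subst ennreal_less_iff) (auto simp: field_simps)
    then show ?case using elim x(2) by simp
  qed
qed

text \<open>With \<open>\<rho> = h\<^sup>-\<^sup>1(S t)\<close> and \<open>R\<close> so large that
  the counting function and \<open>D\<close> agree up to the factor \<open>1 \<plusminus>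
  \<epsilon>\<close> beyond \<open>R\<close>, the two means can differ further only through the
  event \<open>\<rho> < R\<close>. There the count vanishes unless \<open>\<rho> \<ge> r0\<close>,
  where \<open>r0\<close> is the distance of the configuration from the origin, and
  \<open>D(\<rho>) \<le> \<epsilon>\<close> unless \<open>\<rho> \<ge> \<delta>\<close>. As
  \<open>\<rho> \<ge> r\<close> means \<open>h r \<le> S t\<close>, both exceptional events have
  vanishing probability.\<close>

lemma (in prob_space) ball_count_intensity_tendsto:
  fixes S :: "nat \<Rightarrow> 'a \<Rightarrow> real"
  assumes \<xi>: "locally_finite_config \<xi>" and D: "mono_on {0..} D" "\<And>r. 0 \<le> r \<Longrightarrow> 0 \<le> D r"
    and ratio: "((\<lambda>r. real (num_points \<xi> r) / D r) \<longlongrightarrow> 1) at_top"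
    and D0: "(D \<longlongrightarrow> 0) (at_right 0)"
    and h: "mono_on {0..} h" "\<And>r. 0 < r \<Longrightarrow> continuous (at_left r) h" "\<And>r. 0 < r \<Longrightarrow> 0 < h r"
    and S [measurable]: "\<And>n. S n \<in> borel_measurable M"
    and small: "\<And>c. 0 < c \<Longrightarrow> (\<lambda>n. prob {\<omega> \<in> space M. c \<le> S n \<omega> * t}) \<longlonglongrightarrow> 0"
    and l: "0 \<le> l"
    and lim: "(\<lambda>n. \<integral>\<^sup>+\<omega>. extend_infty D (gen_inverse h (S n \<omega> * t)) \<partial>M) \<longlonglongrightarrow> ennreal l"
  shows "(\<lambda>n. \<integral>\<^sup>+\<omega>. ball_count \<xi> (gen_inverse h (S n \<omega> * t)) \<partial>M) \<longlonglongrightarrow> ennreal l"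
proof -
  define \<rho> where "\<rho> y = gen_inverse h y" for y
  define p where "p c n = prob {\<omega> \<in> space M. c \<le> S n \<omega> * t}" for c n
  define E where "E n = (\<integral>\<^sup>+\<omega>. extend_infty D (\<rho> (S n \<omega> * t)) \<partial>M)" for n
  define B where "B n = (\<integral>\<^sup>+\<omega>. ball_count \<xi> (\<rho> (S n \<omega> * t)) \<partial>M)" for n
  have [measurable]: "(\<lambda>y. extend_infty D (\<rho> y)) \<in> borel_measurable borel"
    unfolding \<rho>_def
    by (intro mono_borel_measurable_ennreal monoI monoD[OF mono_extend_infty[OF D(1)]] monoD[OF mono_gen_inverse])
  have [measurable]: "(\<lambda>y. ball_count \<xi> (\<rho> y)) \<in> borel_measurable borel"
    unfolding \<rho>_def
    by (intro mono_borel_measurable_ennreal monoI monoD[OF mono_ball_count] monoD[OF mono_gen_inverse])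
  have \<rho>_iff: "ennreal r \<le> \<rho> y \<longleftrightarrow> h r \<le> y" if "0 < r" for r y
    unfolding \<rho>_def by (rule le_gen_inverse_iff[OF h(1,2) that])
  \<comment> \<open>Both estimates below have an error term that is a constant times the indicator
    of \<open>S t \<ge> c'\<close>.\<close>
  have split_integral: "(\<integral>\<^sup>+\<omega>. f (S n \<omega> * t) + ennreal c * indicator {c'..} (S n \<omega> * t) \<partial>M) =
      (\<integral>\<^sup>+\<omega>. f (S n \<omega> * t) \<partial>M) + ennreal (c * p c' n)"
    if "f \<in> borel_measurable borel" "0 \<le> c" for f c c' n
  proof -
    note [measurable] = that(1)
    have "(\<integral>\<^sup>+\<omega>. f (S n \<omega> * t) + ennreal c * indicator {c'..} (S n \<omega> * t) \<partial>M) =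
        (\<integral>\<^sup>+\<omega>. f (S n \<omega> * t) \<partial>M) + ennreal c * (\<integral>\<^sup>+\<omega>. indicator {c'..} (S n \<omega> * t) \<partial>M)"
      by (subst nn_integral_add) (auto simp: nn_integral_cmult)
    also have "(\<integral>\<^sup>+\<omega>. indicator {c'..} (S n \<omega> * t) \<partial>M) =
        (\<integral>\<^sup>+\<omega>. indicator {\<omega> \<in> space M. c' \<le> S n \<omega> * t} \<omega> \<partial>M)"
      by (intro nn_integral_cong) (auto simp: indicator_def)
    also have "\<dots> = ennreal (p c' n)"
      by (simp add: p_def emeasure_eq_measure)
    finally show ?thesis
      using that(2) by (simp add: ennreal_mult p_def)
  qed
  have p_lim: "(\<lambda>n. c * p c' n) \<longlonglongrightarrow> 0" if "0 < c'" for c c'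
    using tendsto_mult_left[OF small[OF that], of c] by (simp add: p_def)
  obtain r0 where r0: "0 < r0" "\<And>x. x \<in> \<xi> \<Longrightarrow> r0 \<le> norm x"
    using locally_finite_config_gap[OF \<xi>] by blast
  have below_r0: "ball_count \<xi> r = 0" if "r < ennreal r0" for r
  proof -
    have "\<not> ennreal (norm x) \<le> r" if "x \<in> \<xi>" for x
      using less_le_trans[OF \<open>r < ennreal r0\<close> ennreal_leI[OF r0(2)[OF that]]] by (simp only: not_le)
    then have "{x \<in> \<xi>. ennreal (norm x) \<le> r} = {}" by blast
    then show ?thesis unfolding ball_count_def by (simp only: emeasure_empty)
  qed
  have "B \<longlonglongrightarrow> ennreal l"
  proof (rule tendsto_ennreal_margins[OF l])
    fix \<eta> :: real assume \<eta>: "0 < \<eta>"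
    \<comment> \<open>The final errors are \<open>(1 + \<epsilon>) (l + \<epsilon>) + \<epsilon> -
      l\<close> and \<open>l - (1 - \<epsilon>) (l - \<epsilon>) + 2 \<epsilon>\<close>, both at
      most \<open>\<epsilon> (l + 3)\<close>.\<close>
    define \<epsilon> where "\<epsilon> = min (1 / 2) (\<eta> / (l + 3))"
    have "\<epsilon> \<le> 1 / 2" "\<epsilon> \<le> \<eta> / (l + 3)"
      unfolding \<epsilon>_def by (rule min.cobounded1, rule min.cobounded2)
    moreover have "0 < \<epsilon>"
      using \<eta> l by (simp add: \<epsilon>_def)
    ultimately have \<epsilon>: "0 < \<epsilon>" "\<epsilon> < 1" "\<epsilon> * (l + 3) \<le> \<eta>"
      using l by (simp_all add: pos_le_divide_eq)
    obtain R where R: "0 < R"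
      "\<And>r. ennreal R \<le> r \<Longrightarrow> ennreal (1 - \<epsilon>) * extend_infty D r \<le> ball_count \<xi> r"
      "\<And>r. ennreal R \<le> r \<Longrightarrow> ball_count \<xi> r \<le> ennreal (1 + \<epsilon>) * extend_infty D r"
      using ball_count_compare[OF \<xi> D ratio \<epsilon>(1,2)] by blast
    define b where "b = real (num_points \<xi> R)"
    have upper: "B n \<le> ennreal (1 + \<epsilon>) * E n + ennreal (b * p (h r0) n)" for n
    proof -
      have "ball_count \<xi> (\<rho> y) \<le> ennreal (1 + \<epsilon>) * extend_infty D (\<rho> y) + ennreal b * indicator {h r0..} y" for y
      proof (cases "ennreal R \<le> \<rho> y")
        case True
        then show ?thesis using R(3) by (intro add_increasing2) auto
      next
        case False
        show ?thesis
        proof (cases "ennreal r0 \<le> \<rho> y")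
          case True
          have "ball_count \<xi> (\<rho> y) \<le> ball_count \<xi> (ennreal R)"
            using False by (intro monoD[OF mono_ball_count]) simp
          also have "\<dots> = ennreal b"
            unfolding b_def using R(1) by (intro ball_count_num_points[OF \<xi>]) simp
          finally show ?thesis
            using True \<rho>_iff[OF r0(1)] by (intro add_increasing) auto
        next
          case False
          then show ?thesis using below_r0 by simp
        qed
      qed
      then have "B n \<le> (\<integral>\<^sup>+\<omega>. ennreal (1 + \<epsilon>) * extend_infty D (\<rho> (S n \<omega> * t)) +
          ennreal b * indicator {h r0..} (S n \<omega> * t) \<partial>M)"
        unfolding B_def by (intro nn_integral_mono)
      also have "\<dots> = (\<integral>\<^sup>+\<omega>. ennreal (1 + \<epsilon>) * extend_infty D (\<rho> (S n \<omega> * t)) \<partial>M) + ennreal (b * p (h r0) n)"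
        by (rule split_integral[of "\<lambda>y. ennreal (1 + \<epsilon>) * extend_infty D (\<rho> y)"]) (auto simp: b_def)
      also have "\<dots> = ennreal (1 + \<epsilon>) * E n + ennreal (b * p (h r0) n)"
        unfolding E_def by (subst nn_integral_cmult) auto
      finally show ?thesis .
    qed
    have E_upper: "\<forall>\<^sub>F n in sequentially. E n < ennreal (l + \<epsilon>)"
      using lim \<epsilon> l unfolding E_def \<rho>_def by (intro order_tendstoD) (auto simp: ennreal_less_iff)
    \<comment> \<open>The exceptional event \<open>\<rho> \<ge> r0\<close> is \<open>h r0 \<le> S
      t\<close>, and \<open>h r0 > 0\<close>.\<close>
    have "\<forall>\<^sub>F n in sequentially. b * p (h r0) n < \<epsilon>"
      using p_lim[OF h(3)[OF r0(1)]] \<epsilon> by (intro order_tendstoD) auto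
    with E_upper show "\<forall>\<^sub>F n in sequentially. B n \<le> ennreal (l + \<eta>)"
    proof eventually_elim
      case (elim n)
      have "B n \<le> ennreal (1 + \<epsilon>) * ennreal (l + \<epsilon>) + ennreal \<epsilon>"
        using upper[of n] elim by (meson add_mono ennreal_leI less_imp_le mult_left_mono order_trans zero_le)
      also have "\<dots> = ennreal ((1 + \<epsilon>) * (l + \<epsilon>) + \<epsilon>)"
        using \<epsilon> l by (simp add: ennreal_mult ennreal_plus)
      also have "\<dots> \<le> ennreal (l + \<eta>)"
      proof (rule ennreal_leI)
        have "\<epsilon> * \<epsilon> \<le> \<epsilon> * 1" using \<epsilon> by (intro mult_left_mono) auto
        then show "(1 + \<epsilon>) * (l + \<epsilon>) + \<epsilon> \<le> l + \<eta>"
          using \<epsilon>(3) by (simp add: algebra_simps)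
      qed
      finally show ?case .
    qed
    have "\<forall>\<^sub>F r in at_right 0. D r < \<epsilon>"
      using D0 \<epsilon> by (intro order_tendstoD) auto
    then obtain \<delta> where \<delta>: "0 < \<delta>" "\<And>r. 0 < r \<Longrightarrow> r < \<delta> \<Longrightarrow> D r < \<epsilon>"
      by (auto simp: eventually_at_right_field)
    have D_small: "D r \<le> \<epsilon>" if "0 \<le> r" "r < \<delta>" for r
    proof -
      have "D r \<le> D ((r + \<delta>) / 2)"
        using D(1) that by (auto simp: mono_on_def)
      also have "\<dots> < \<epsilon>" using that by (intro \<delta>) auto
      finally show ?thesis by simp
    qed
    have lower: "ennreal (1 - \<epsilon>) * E n \<le> B n + ennreal \<epsilon> + ennreal (D R * p (h \<delta>) n)" for n
    proof -
      have "ennreal (1 - \<epsilon>) * extend_infty D (\<rho> y) \<le>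
          (ball_count \<xi> (\<rho> y) + ennreal \<epsilon>) + ennreal (D R) * indicator {h \<delta>..} y" for y
      proof (cases "ennreal R \<le> \<rho> y")
        case True
        then have "ennreal (1 - \<epsilon>) * extend_infty D (\<rho> y) \<le> ball_count \<xi> (\<rho> y)" by (rule R(2))
        then show ?thesis by (simp add: add_increasing2 add.assoc)
      next
        case False
        have le: "ennreal (1 - \<epsilon>) * extend_infty D (\<rho> y) \<le> extend_infty D (\<rho> y)"
          using \<epsilon> mult_right_mono[of "ennreal (1 - \<epsilon>)" 1] by simp
        show ?thesis
        proof (cases "ennreal \<delta> \<le> \<rho> y")
          case True
          have "extend_infty D (\<rho> y) \<le> extend_infty D (ennreal R)"
            using False by (intro monoD[OF mono_extend_infty[OF D(1)]]) simp
          also have "\<dots> = ennreal (D R)" using R(1) by (simp add: extend_infty_finite)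
          finally have "extend_infty D (\<rho> y) \<le> ennreal (D R) * indicator {h \<delta>..} y"
            using True \<rho>_iff[OF \<delta>(1)] by simp
          then show ?thesis using le by (meson add_increasing order_trans zero_le)
        next
          case False
          then have "\<rho> y < ennreal \<delta>" by simp
          then obtain x where x: "\<rho> y = ennreal x" "0 \<le> x" "x < \<delta>"
            by (cases "\<rho> y") (auto simp: ennreal_less_iff)
          then have "extend_infty D (\<rho> y) \<le> ennreal \<epsilon>"
            using D_small[OF x(2,3)] by (simp add: extend_infty_finite ennreal_leI)
          then show ?thesis
            using le by (meson add_increasing add_increasing2 order_trans zero_le)
        qed
      qed
      then have "(\<integral>\<^sup>+\<omega>. ennreal (1 - \<epsilon>) * extend_infty D (\<rho> (S n \<omega> * t)) \<partial>M) \<le>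
          (\<integral>\<^sup>+\<omega>. (ball_count \<xi> (\<rho> (S n \<omega> * t)) + ennreal \<epsilon>) + ennreal (D R) * indicator {h \<delta>..} (S n \<omega> * t) \<partial>M)"
        by (intro nn_integral_mono)
      also have "\<dots> = (\<integral>\<^sup>+\<omega>. ball_count \<xi> (\<rho> (S n \<omega> * t)) + ennreal \<epsilon> \<partial>M) + ennreal (D R * p (h \<delta>) n)"
        using R(1) by (intro split_integral[of "\<lambda>y. ball_count \<xi> (\<rho> y) + ennreal \<epsilon>"]) (auto intro!: D(2))
      also have "\<dots> = B n + ennreal \<epsilon> + ennreal (D R * p (h \<delta>) n)"
        unfolding B_def by (subst nn_integral_add) (auto simp: emeasure_space_1)
      finally show ?thesis
        unfolding E_def by (subst (asm) nn_integral_cmult) auto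
    qed
    have E_lower: "\<forall>\<^sub>F n in sequentially. ennreal (l - \<epsilon>) \<le> E n"
    proof (cases "l - \<epsilon> \<le> 0")
      case False
      then have "\<forall>\<^sub>F n in sequentially. ennreal (l - \<epsilon>) < E n"
        using lim \<epsilon> l unfolding E_def \<rho>_def by (intro order_tendstoD) (auto simp: ennreal_less_iff)
      then show ?thesis by eventually_elim simp
    qed (simp add: ennreal_neg)
    have "\<forall>\<^sub>F n in sequentially. D R * p (h \<delta>) n < \<epsilon>"
      using p_lim[OF h(3)[OF \<delta>(1)]] \<epsilon> by (intro order_tendstoD) auto
    with E_lower show "\<forall>\<^sub>F n in sequentially. ennreal (l - \<eta>) \<le> B n"
    proof eventually_elim
      case (elim n)
      show ?case
      proof (cases "0 \<le> l - \<eta>")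
        case True
        have "ennreal (l - \<eta>) + ennreal (2 * \<epsilon>) = ennreal (l - \<eta> + 2 * \<epsilon>)"
          using True \<epsilon> by (simp add: ennreal_plus)
        also have "\<dots> \<le> ennreal ((1 - \<epsilon>) * (l - \<epsilon>))"
        proof (rule ennreal_leI)
          have "(1 - \<epsilon>) * (l - \<epsilon>) = l - \<epsilon> * (l + 3) + 2 * \<epsilon> + \<epsilon> * \<epsilon>"
            by (simp add: algebra_simps)
          then show "l - \<eta> + 2 * \<epsilon> \<le> (1 - \<epsilon>) * (l - \<epsilon>)"
            using \<epsilon>(3) zero_le_square[of \<epsilon>] by linarith
        qed
        also have "\<dots> = ennreal (1 - \<epsilon>) * ennreal (l - \<epsilon>)"
          using \<epsilon> by (intro ennreal_mult') simp
        also have "\<dots> \<le> ennreal (1 - \<epsilon>) * E n"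
          by (intro mult_left_mono elim) simp
        also have "\<dots> \<le> B n + ennreal \<epsilon> + ennreal (D R * p (h \<delta>) n)"
          by (rule lower)
        also have "\<dots> \<le> B n + ennreal \<epsilon> + ennreal \<epsilon>"
          using elim by (intro add_left_mono ennreal_leI) simp
        also have "\<dots> = B n + ennreal (2 * \<epsilon>)"
          using \<epsilon> by (simp add: add.assoc ennreal_plus[symmetric] del: ennreal_plus)
        finally have "ennreal (2 * \<epsilon>) + ennreal (l - \<eta>) \<le> ennreal (2 * \<epsilon>) + B n"
          by (simp only: add.commute)
        then show ?thesis
          by (simp only: ennreal_add_left_cancel_le) simp
      qed (simp add: ennreal_neg)
    qed
  qed
  then show ?thesis by (simp add: B_def[abs_def] \<rho>_def)
qed

section \<open>Independent fading variables and thinned products\<close>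

text \<open>This is the law of rare events. The upper bound is \<open>1 - q \<le> exp (-
  q)\<close>; the lower one is \<open>1 - q \<ge> exp (- q / (1 - q))\<close>, which follows from
  \<open>exp x \<ge> 1 + x\<close> at \<open>x = q / (1 - q)\<close>.\<close>

lemma thinning_product_bounds:
  fixes q :: "nat \<Rightarrow> real"
  assumes q: "\<And>i. i \<in> I \<Longrightarrow> 0 \<le> q i" "\<And>i. i \<in> I \<Longrightarrow> q i \<le> \<delta>" and \<delta>: "\<delta> < 1" "0 \<le> \<delta>"
    and \<tau>: "(\<integral>\<^sup>+i. ennreal (q i) \<partial>count_space I) = ennreal \<tau>" "0 \<le> \<tau>"
    and lim: "(\<lambda>m. \<Prod>i\<in>{i \<in> {..<m}. i \<in> I}. 1 - q i) \<longlonglongrightarrow> \<Psi>"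
  shows "exp (- (\<tau> / (1 - \<delta>))) \<le> \<Psi>" "\<Psi> \<le> exp (- \<tau>)"
proof -
  define s where "s m = (\<Sum>i\<in>{i \<in> {..<m}. i \<in> I}. q i)" for m
  have "(\<Sum>i. ennreal (if i \<in> I then q i else 0)) = (\<integral>\<^sup>+i. ennreal (if i \<in> I then q i else 0) \<partial>count_space UNIV)"
    by (rule nn_integral_count_space_nat[symmetric])
  also have "\<dots> = (\<integral>\<^sup>+i. ennreal (q i) * indicator I i \<partial>count_space UNIV)"
    by (intro nn_integral_cong) (auto simp: indicator_def)
  also have "\<dots> = ennreal \<tau>"
    using \<tau>(1) by (simp add: nn_integral_count_space_indicator)
  finally have "(\<lambda>i. ennreal (if i \<in> I then q i else 0)) sums ennreal \<tau>"
    by (simp add: sums_iff)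
  moreover have "(\<Sum>i<m. ennreal (if i \<in> I then q i else 0)) = ennreal (s m)" for m
  proof -
    have "(\<Sum>i<m. ennreal (if i \<in> I then q i else 0)) = ennreal (\<Sum>i<m. if i \<in> I then q i else 0)"
      using q(1) by (intro sum_ennreal) auto
    also have "(\<Sum>i<m. if i \<in> I then q i else 0) = s m"
      unfolding s_def by (rule sum.inter_filter[symmetric]) simp
    finally show ?thesis .
  qed
  ultimately have "(\<lambda>m. ennreal (s m)) \<longlonglongrightarrow> ennreal \<tau>"
    by (simp add: sums_def)
  moreover have s_nonneg: "0 \<le> s m" for m
    unfolding s_def using q(1) by (intro sum_nonneg) auto
  ultimately have s_lim: "s \<longlonglongrightarrow> \<tau>"
    using \<tau>(2) by (simp add: tendsto_ennreal_iff)
  have upper: "(\<Prod>i\<in>{i \<in> {..<m}. i \<in> I}. 1 - q i) \<le> exp (- s m)" for m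
  proof -
    have "(\<Prod>i\<in>{i \<in> {..<m}. i \<in> I}. 1 - q i) \<le> (\<Prod>i\<in>{i \<in> {..<m}. i \<in> I}. exp (- q i))"
    proof (rule prod_mono)
      fix i assume "i \<in> {i \<in> {..<m}. i \<in> I}"
      then show "0 \<le> 1 - q i \<and> 1 - q i \<le> exp (- q i)"
        using q(2)[of i] \<delta> exp_ge_add_one_self[of "- q i"] by auto
    qed
    then show ?thesis by (simp add: s_def exp_sum sum_negf[symmetric])
  qed
  have lower: "exp (- (s m / (1 - \<delta>))) \<le> (\<Prod>i\<in>{i \<in> {..<m}. i \<in> I}. 1 - q i)" for m
  proof -
    have "(\<Prod>i\<in>{i \<in> {..<m}. i \<in> I}. exp (- (q i / (1 - \<delta>)))) \<le> (\<Prod>i\<in>{i \<in> {..<m}. i \<in> I}. 1 - q i)"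
    proof (rule prod_mono)
      fix i assume "i \<in> {i \<in> {..<m}. i \<in> I}"
      then have i: "0 \<le> q i" "q i \<le> \<delta>" using q by auto
      have "1 / (1 - q i) = 1 + q i / (1 - q i)"
        using i \<delta> by (simp add: field_simps)
      also have "\<dots> \<le> exp (q i / (1 - q i))"
        by (rule exp_ge_add_one_self)
      also have "\<dots> \<le> exp (q i / (1 - \<delta>))"
        using i \<delta> by (simp add: frac_le)
      finally have "1 \<le> exp (q i / (1 - \<delta>)) * (1 - q i)"
        using i \<delta> by (simp add: pos_divide_le_eq)
      then have "exp (- (q i / (1 - \<delta>))) \<le> 1 - q i"
        by (simp add: exp_minus field_simps)
      then show "0 \<le> exp (- (q i / (1 - \<delta>))) \<and> exp (- (q i / (1 - \<delta>))) \<le> 1 - q i"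
        by simp
    qed
    moreover have "(\<Prod>i\<in>{i \<in> {..<m}. i \<in> I}. exp (- (q i / (1 - \<delta>)))) = exp (- (s m / (1 - \<delta>)))"
      by (simp add: s_def exp_sum[symmetric] sum_negf sum_divide_distrib)
    ultimately show ?thesis by simp
  qed
  have "(\<lambda>m. exp (- (s m / (1 - \<delta>)))) \<longlonglongrightarrow> exp (- (\<tau> / (1 - \<delta>)))"
    using \<delta> by (intro tendsto_intros s_lim) simp
  then show "exp (- (\<tau> / (1 - \<delta>))) \<le> \<Psi>"
    by (rule LIMSEQ_le[OF _ lim]) (use lower in blast)
  have "(\<lambda>m. exp (- s m)) \<longlonglongrightarrow> exp (- \<tau>)"
    by (intro tendsto_intros s_lim)
  then show "\<Psi> \<le> exp (- \<tau>)"
    by (rule LIMSEQ_le[OF lim]) (use upper in blast)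
qed

context prob_space
begin

text \<open>The joint law is the product of the marginals, so one may integrate over an
  independent copy of \<open>Y\<close> first.\<close>

lemma indep_pair_expectation:
  fixes f :: "'b \<times> 'c \<Rightarrow> real"
  assumes indep: "indep_pair M A Z B Y"
    and f: "f \<in> borel_measurable (A \<Otimes>\<^sub>M B)" "\<And>z. 0 \<le> f z" "\<And>z. f z \<le> 1"
  shows "expectation (\<lambda>\<omega>. f (Z \<omega>, Y \<omega>)) = expectation (\<lambda>\<omega>. expectation (\<lambda>\<omega>'. f (Z \<omega>, Y \<omega>')))"
proof -
  have Z[measurable]: "Z \<in> measurable M A" and Y[measurable]: "Y \<in> measurable M B"
    using indep by (auto simp: indep_pair_def)
  interpret DZ: prob_space "distr M A Z" by (rule prob_space_distr[OF Z])
  interpret DY: prob_space "distr M B Y" by (rule prob_space_distr[OF Y])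
  interpret PP: pair_prob_space "distr M A Z" "distr M B Y" ..
  have joint: "distr M A Z \<Otimes>\<^sub>M distr M B Y = distr M (A \<Otimes>\<^sub>M B) (\<lambda>\<omega>. (Z \<omega>, Y \<omega>))"
  proof (rule pair_measure_eqI)
    show "sigma_finite_measure (distr M A Z)" "sigma_finite_measure (distr M B Y)"
      by unfold_locales
    show "sets (distr M A Z \<Otimes>\<^sub>M distr M B Y) = sets (distr M (A \<Otimes>\<^sub>M B) (\<lambda>\<omega>. (Z \<omega>, Y \<omega>)))"
      by simp
    fix U V assume "U \<in> sets (distr M A Z)" "V \<in> sets (distr M B Y)"
    then have U: "U \<in> sets A" and V: "V \<in> sets B" by auto
    have "prob ((Z -` U \<inter> space M) \<inter> (Y -` V \<inter> space M)) = prob (Z -` U \<inter> space M) * prob (Y -` V \<inter> space M)"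
      using indep U V unfolding indep_pair_def by (intro indep_setD) auto
    moreover have "(\<lambda>\<omega>. (Z \<omega>, Y \<omega>)) -` (U \<times> V) \<inter> space M = (Z -` U \<inter> space M) \<inter> (Y -` V \<inter> space M)"
      by auto
    ultimately show "emeasure (distr M A Z) U * emeasure (distr M B Y) V =
        emeasure (distr M (A \<Otimes>\<^sub>M B) (\<lambda>\<omega>. (Z \<omega>, Y \<omega>))) (U \<times> V)"
      using U V by (simp add: emeasure_distr emeasure_eq_measure ennreal_mult)
  qed
  have f': "f \<in> borel_measurable (distr M A Z \<Otimes>\<^sub>M distr M B Y)"
    using f(1) measurable_cong_sets[OF sets_pair_measure_cong[OF sets_distr sets_distr] refl] by blast
  have sect: "(\<lambda>y. f (z, y)) \<in> borel_measurable B" if "z \<in> space A" for z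
    using f(1) that by (rule measurable_Pair2)
  have "expectation (\<lambda>\<omega>. f (Z \<omega>, Y \<omega>)) = (\<integral>z. f z \<partial>distr M (A \<Otimes>\<^sub>M B) (\<lambda>\<omega>. (Z \<omega>, Y \<omega>)))"
    using f(1) by (intro integral_distr[symmetric]) auto
  also have "\<dots> = (\<integral>z. (\<integral>y. f (z, y) \<partial>distr M B Y) \<partial>distr M A Z)"
    unfolding joint[symmetric] using f(2,3) f'
    by (intro PP.integral_fst'[symmetric] PP.P.integrable_unit_interval) auto
  also have "\<dots> = expectation (\<lambda>\<omega>. \<integral>y. f (Z \<omega>, y) \<partial>distr M B Y)"
  proof (rule integral_distr[OF Z])
    have "(\<lambda>z. \<integral>y. f (z, y) \<partial>distr M B Y) \<in> borel_measurable (distr M A Z)"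
      using f' by (intro DY.borel_measurable_lebesgue_integral) simp
    then show "(\<lambda>z. \<integral>y. f (z, y) \<partial>distr M B Y) \<in> borel_measurable A" by simp
  qed
  also have "\<dots> = expectation (\<lambda>\<omega>. expectation (\<lambda>\<omega>'. f (Z \<omega>, Y \<omega>')))"
  proof (rule Bochner_Integration.integral_cong[OF refl])
    fix \<omega> assume "\<omega> \<in> space M"
    then have "Z \<omega> \<in> space A" using Z by (rule measurable_space[rotated])
    then show "(\<integral>y. f (Z \<omega>, y) \<partial>distr M B Y) = expectation (\<lambda>\<omega>'. f (Z \<omega>, Y \<omega>'))"
      by (intro integral_distr Y sect)
  qed
  finally show ?thesis .
qed

text \<open>Conditionally on the enumerated configuration the marks are independent, so the mean
  of the product is the product of the means. The product is truncated at \<open>m\<close> so that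
  only finitely many marks occur.\<close>

lemma independent_marks_product:
  fixes X :: "nat \<Rightarrow> 'a \<Rightarrow> 'v :: second_countable_topology" and v :: "'v \<Rightarrow> real \<Rightarrow> real"
  assumes indep: "indep_pair M (count_space UNIV \<Otimes>\<^sub>M PiM UNIV (\<lambda>_. borel)) (\<lambda>\<omega>. (\<kappa> \<omega>, \<lambda>i. X i \<omega>))
      (PiM UNIV (\<lambda>_. borel)) (\<lambda>\<omega> i. S' i \<omega>)"
    and S': "indep_vars (\<lambda>_. borel) S' (UNIV :: nat set)" "\<And>i. distr M borel (S' i) = distr M borel S"
    and S: "S \<in> borel_measurable M"
    and v: "(\<lambda>z. v (fst z) (snd z)) \<in> borel_measurable (borel \<Otimes>\<^sub>M borel)"
      "\<And>x s. 0 \<le> v x s" "\<And>x s. v x s \<le> 1"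
  shows "expectation (\<lambda>\<omega>. \<Prod>i\<in>{i \<in> {..<m}. enat i < \<kappa> \<omega>}. v (X i \<omega>) (S' i \<omega>)) =
    expectation (\<lambda>\<omega>. \<Prod>i\<in>{i \<in> {..<m}. enat i < \<kappa> \<omega>}. expectation (\<lambda>\<omega>'. v (X i \<omega>) (S \<omega>')))"
proof -
  let ?A = "count_space UNIV \<Otimes>\<^sub>M PiM UNIV (\<lambda>_::nat. borel :: 'v measure)"
  let ?B = "PiM UNIV (\<lambda>_::nat. borel :: real measure)"
  define f where "f z = (\<Prod>i<m. if enat i < fst (fst z) then v (snd (fst z) i) (snd z i) else 1)"
    for z :: "(enat \<times> (nat \<Rightarrow> 'v)) \<times> (nat \<Rightarrow> real)"
  have f_filter: "f ((k, x), s) = (\<Prod>i\<in>{i \<in> {..<m}. enat i < k}. v (x i) (s i))" for k x s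
    unfolding f_def fst_conv snd_conv by (rule prod.inter_filter[symmetric]) simp
  have f_meas: "f \<in> borel_measurable (?A \<Otimes>\<^sub>M ?B)"
    unfolding f_def
  proof (intro borel_measurable_prod measurable_If)
    fix i
    have 1: "(\<lambda>z. snd (fst z) i) \<in> measurable (?A \<Otimes>\<^sub>M ?B) borel"
      by measurable
    have 2: "(\<lambda>z. snd z i) \<in> measurable (?A \<Otimes>\<^sub>M ?B) borel"
      by measurable
    show "(\<lambda>z. v (snd (fst z) i) (snd z i)) \<in> borel_measurable (?A \<Otimes>\<^sub>M ?B)"
      using measurable_compose[OF measurable_Pair[OF 1 2] v(1)] by simp
    have "(\<lambda>z. fst (fst z)) \<in> measurable (?A \<Otimes>\<^sub>M ?B) (count_space UNIV)"
      by measurable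
    then show "{z \<in> space (?A \<Otimes>\<^sub>M ?B). enat i < fst (fst z)} \<in> sets (?A \<Otimes>\<^sub>M ?B)"
      by measurable
  qed simp
  have f_bounds: "0 \<le> f z" "f z \<le> 1" for z
    unfolding f_def using v(2,3) by (auto intro!: prod_nonneg prod_le_1)
  have S'_meas: "S' i \<in> borel_measurable M" for i
    using S'(1) by (auto simp: indep_vars_def)
  have v_sect: "v x \<in> borel_measurable borel" for x
    using measurable_Pair2[OF v(1), of x] by simp
  have marginal: "expectation (\<lambda>\<omega>'. v x (S' i \<omega>')) = expectation (\<lambda>\<omega>'. v x (S \<omega>'))" for x i
    using integral_distr[OF S'_meas v_sect[of x], of i] integral_distr[OF S v_sect[of x]] S'(2)[of i] by simp
  have inner: "expectation (\<lambda>\<omega>'. f ((k, x), \<lambda>i. S' i \<omega>')) =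
      (\<Prod>i\<in>{i \<in> {..<m}. enat i < k}. expectation (\<lambda>\<omega>'. v (x i) (S \<omega>')))" for k x
  proof -
    let ?I = "{i \<in> {..<m}. enat i < k}"
    have "indep_vars (\<lambda>_. borel) (\<lambda>i \<omega>. v (x i) (S' i \<omega>)) ?I"
      by (rule indep_vars_compose2[where M' = "\<lambda>_. borel" and X = S' and Y = "\<lambda>i. v (x i)",
            OF indep_vars_subset[OF S'(1) subset_UNIV] v_sect])
    then have "expectation (\<lambda>\<omega>'. \<Prod>i\<in>?I. v (x i) (S' i \<omega>')) = (\<Prod>i\<in>?I. expectation (\<lambda>\<omega>'. v (x i) (S' i \<omega>')))"
    proof (rule indep_vars_lebesgue_integral[rotated])
      show "integrable M (\<lambda>\<omega>. v (x i) (S' i \<omega>))" for i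
        by (rule integrable_unit_interval[OF measurable_compose[OF S'_meas v_sect] v(2,3)])
    qed simp
    then show ?thesis
      unfolding f_filter marginal .
  qed
  have "expectation (\<lambda>\<omega>. f ((\<kappa> \<omega>, \<lambda>i. X i \<omega>), \<lambda>i. S' i \<omega>)) =
      expectation (\<lambda>\<omega>. expectation (\<lambda>\<omega>'. f ((\<kappa> \<omega>, \<lambda>i. X i \<omega>), \<lambda>i. S' i \<omega>')))"
    using indep_pair_expectation[OF indep f_meas f_bounds] .
  then show ?thesis
    unfolding inner unfolding f_filter .
qed

text \<open>Fubini's theorem: the mean number of points within the random radius is the sum over
  all points of the probability of being within it.\<close>

lemma ball_count_intensity:
  assumes \<xi>: "locally_finite_config \<xi>"
    and h: "mono_on {0..} h" "\<And>r. 0 < r \<Longrightarrow> continuous (at_left r) h"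
    and y [measurable]: "y \<in> borel_measurable M"
  shows "(\<integral>\<^sup>+\<omega>. ball_count \<xi> (gen_inverse h (y \<omega>)) \<partial>M) =
    (\<integral>\<^sup>+x. emeasure M {\<omega> \<in> space M. h (norm x) \<le> y \<omega>} \<partial>count_space \<xi>)"
proof -
  have "ball_count \<xi> (gen_inverse h z) = (\<integral>\<^sup>+x. indicator {x. h (norm x) \<le> z} x \<partial>count_space \<xi>)" for z
  proof -
    have "x \<in> \<xi> \<Longrightarrow> 0 < norm x" for x
      using \<xi> by (auto simp: locally_finite_config_def)
    then have "{x \<in> \<xi>. ennreal (norm x) \<le> gen_inverse h z} = {x \<in> \<xi>. h (norm x) \<le> z}"
      using le_gen_inverse_iff[OF h] by blast
    then have "ball_count \<xi> (gen_inverse h z) = (\<integral>\<^sup>+x. indicator {x \<in> \<xi>. h (norm x) \<le> z} x \<partial>count_space \<xi>)"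
      by (simp add: ball_count_def)
    also have "\<dots> = (\<integral>\<^sup>+x. indicator {x. h (norm x) \<le> z} x \<partial>count_space \<xi>)"
      by (intro nn_integral_cong) (auto simp: indicator_def)
    finally show ?thesis .
  qed
  then have "(\<integral>\<^sup>+\<omega>. ball_count \<xi> (gen_inverse h (y \<omega>)) \<partial>M) =
      (\<integral>\<^sup>+\<omega>. (\<integral>\<^sup>+x. indicator {\<omega> \<in> space M. h (norm x) \<le> y \<omega>} \<omega> \<partial>count_space \<xi>) \<partial>M)"
    by (intro nn_integral_cong) (auto simp: indicator_def intro!: nn_integral_cong)
  also have "\<dots> = (\<integral>\<^sup>+x. (\<integral>\<^sup>+\<omega>. indicator {\<omega> \<in> space M. h (norm x) \<le> y \<omega>} \<omega> \<partial>M) \<partial>count_space \<xi>)"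
    by (rule nn_integral_count_space_nn_integral[OF locally_finite_config_countable[OF \<xi>]]) measurable
  also have "\<dots> = (\<integral>\<^sup>+x. emeasure M {\<omega> \<in> space M. h (norm x) \<le> y \<omega>} \<partial>count_space \<xi>)"
    by simp
  finally show ?thesis .
qed

text \<open>For \<open>S > 0\<close>, the events \<open>h |x| / S \<in> (a, b]\<close> and
  \<open>h |x| \<le> S a\<close> partition \<open>h |x| \<le> S b\<close>.\<close>

lemma interval_intensity_tendsto:
  fixes S :: "nat \<Rightarrow> 'a \<Rightarrow> real" and \<xi> :: "(real ^ 'n) set"
  assumes \<xi>: "locally_finite_config \<xi>" and D: "mono_on {0..} D" "\<And>r. 0 \<le> r \<Longrightarrow> 0 \<le> D r"
    and ratio: "((\<lambda>r. real (num_points \<xi> r) / D r) \<longlongrightarrow> 1) at_top"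
    and D0: "(D \<longlongrightarrow> 0) (at_right 0)"
    and h: "mono_on {0..} h" "\<And>r. 0 < r \<Longrightarrow> continuous (at_left r) h" "\<And>r. 0 < r \<Longrightarrow> 0 < h r"
    and S [measurable]: "\<And>n. S n \<in> borel_measurable M" and S_pos: "\<And>n. AE \<omega> in M. 0 < S n \<omega>"
    and small: "\<And>c. 0 < c \<Longrightarrow> (\<lambda>n. prob {\<omega> \<in> space M. c \<le> S n \<omega>}) \<longlonglongrightarrow> 0"
    and ab: "0 < a" "a < b" and l: "0 \<le> la" "0 \<le> lb"
    and lim_a: "(\<lambda>n. \<integral>\<^sup>+\<omega>. extend_infty D (gen_inverse h (S n \<omega> * a)) \<partial>M) \<longlonglongrightarrow> ennreal la"
    and lim_b: "(\<lambda>n. \<integral>\<^sup>+\<omega>. extend_infty D (gen_inverse h (S n \<omega> * b)) \<partial>M) \<longlonglongrightarrow> ennreal lb"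
  shows "(\<lambda>n. \<integral>\<^sup>+x. emeasure M {\<omega> \<in> space M. h (norm x) / S n \<omega> \<in> {a<..b}} \<partial>count_space \<xi>)
    \<longlonglongrightarrow> ennreal (lb - la)"
proof -
  define \<Lambda> where "\<Lambda> t n = (\<integral>\<^sup>+x. emeasure M {\<omega> \<in> space M. h (norm x) \<le> S n \<omega> * t} \<partial>count_space \<xi>)" for t n
  define \<Delta> where "\<Delta> n = (\<integral>\<^sup>+x. emeasure M {\<omega> \<in> space M. h (norm x) / S n \<omega> \<in> {a<..b}} \<partial>count_space \<xi>)" for n
  have \<Lambda>_lim: "\<Lambda> t \<longlonglongrightarrow> ennreal l"
    if t: "0 < t" and l: "0 \<le> l"
      and lim: "(\<lambda>n. \<integral>\<^sup>+\<omega>. extend_infty D (gen_inverse h (S n \<omega> * t)) \<partial>M) \<longlonglongrightarrow> ennreal l" for t l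
  proof -
    have "(\<lambda>n. prob {\<omega> \<in> space M. c \<le> S n \<omega> * t}) \<longlonglongrightarrow> 0" if "0 < c" for c
      using small[of "c / t"] that t by (simp add: pos_divide_le_eq)
    then have "(\<lambda>n. \<integral>\<^sup>+\<omega>. ball_count \<xi> (gen_inverse h (S n \<omega> * t)) \<partial>M) \<longlonglongrightarrow> ennreal l"
      by (intro ball_count_intensity_tendsto[OF \<xi> D ratio D0 h S _ l lim])
    moreover have "(\<integral>\<^sup>+\<omega>. ball_count \<xi> (gen_inverse h (S n \<omega> * t)) \<partial>M) = \<Lambda> t n" for n
      unfolding \<Lambda>_def by (intro ball_count_intensity \<xi> h) measurable
    ultimately show ?thesis by simp
  qed
  have sum: "\<Delta> n + \<Lambda> a n = \<Lambda> b n" for n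
  proof -
    have "emeasure M {\<omega> \<in> space M. y / S n \<omega> \<in> {a<..b}} + emeasure M {\<omega> \<in> space M. y \<le> S n \<omega> * a} =
        emeasure M {\<omega> \<in> space M. y \<le> S n \<omega> * b}" for y
    proof -
      have "(\<integral>\<^sup>+\<omega>. indicator {\<omega> \<in> space M. y / S n \<omega> \<in> {a<..b}} \<omega> +
          indicator {\<omega> \<in> space M. y \<le> S n \<omega> * a} \<omega> \<partial>M) =
          (\<integral>\<^sup>+\<omega>. indicator {\<omega> \<in> space M. y \<le> S n \<omega> * b} \<omega> \<partial>M)"
      proof (rule nn_integral_cong_AE)
        show "AE \<omega> in M. indicator {\<omega> \<in> space M. y / S n \<omega> \<in> {a<..b}} \<omega> +
            indicator {\<omega> \<in> space M. y \<le> S n \<omega> * a} \<omega> =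
            (indicator {\<omega> \<in> space M. y \<le> S n \<omega> * b} \<omega> :: ennreal)"
          using S_pos[of n]
        proof eventually_elim
          case (elim \<omega>)
          have "a < y / S n \<omega> \<longleftrightarrow> \<not> y \<le> S n \<omega> * a" "y / S n \<omega> \<le> b \<longleftrightarrow> y \<le> S n \<omega> * b"
            using elim by (auto simp: pos_less_divide_eq pos_divide_le_eq mult.commute)
          moreover have "S n \<omega> * a \<le> S n \<omega> * b" using elim ab by simp
          ultimately show ?case by (auto simp: indicator_def)
        qed
      qed
      then show ?thesis by (subst (asm) nn_integral_add) auto
    qed
    then show ?thesis
      unfolding \<Delta>_def \<Lambda>_def by (subst nn_integral_add[symmetric]) auto
  qed
  have La: "\<Lambda> a \<longlonglongrightarrow> ennreal la" and Lb: "\<Lambda> b \<longlonglongrightarrow> ennreal lb"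
    using ab l lim_a lim_b by (auto intro!: \<Lambda>_lim)
  have "\<forall>\<^sub>F n in sequentially. \<Lambda> a n < \<infinity>"
    using La by (intro order_tendstoD) auto
  then have "\<forall>\<^sub>F n in sequentially. \<Lambda> b n - \<Lambda> a n = \<Delta> n"
  proof eventually_elim
    case (elim n)
    then show ?case unfolding sum[symmetric] by (intro ennreal_add_diff_cancel_right) auto
  qed
  moreover have "(\<lambda>n. \<Lambda> b n - \<Lambda> a n) \<longlonglongrightarrow> ennreal lb - ennreal la"
    by (intro tendsto_diff_ennreal La Lb) auto
  ultimately have "\<Delta> \<longlonglongrightarrow> ennreal lb - ennreal la"
    by (rule Lim_transform_eventually[rotated])
  then show ?thesis
    unfolding \<Delta>_def using l by (simp add: ennreal_minus)
qed

end

section \<open>Convergence of propagation processes\<close>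

text \<open>The data whose existence the definition of a propagation process asserts, named so
  that they can be chosen for all members of a sequence at once. They may be different
  enumerations of the configuration for different members.\<close>

definition marked_enumeration ::
  "'w measure \<Rightarrow> ('w \<Rightarrow> real) \<Rightarrow> (real ^ 'n \<Rightarrow> real) \<Rightarrow> ('w \<Rightarrow> (real ^ 'n) set) \<Rightarrow> ('w \<Rightarrow> real measure)
    \<Rightarrow> ('w \<Rightarrow> enat) \<Rightarrow> (nat \<Rightarrow> 'w \<Rightarrow> real ^ 'n) \<Rightarrow> (nat \<Rightarrow> 'w \<Rightarrow> real) \<Rightarrow> bool" where
  "marked_enumeration M S g \<xi> N \<kappa> X S' \<longleftrightarrow> random_enumeration M \<xi> \<kappa> X \<and>
        prob_space.indep_vars M (\<lambda>_. borel) S' (UNIV :: nat set) \<and>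
        (\<forall>i. distr M borel (S' i) = distr M borel S) \<and>
        indep_pair M
          (count_space UNIV \<Otimes>\<^sub>M PiM UNIV (\<lambda>_. borel)) (\<lambda>\<omega>. (\<kappa> \<omega>, \<lambda>i. X i \<omega>))
          (PiM UNIV (\<lambda>_. borel)) (\<lambda>\<omega> i. S' i \<omega>) \<and>
        (AE \<omega> in M. N \<omega> = dirac_sum {i. enat i < \<kappa> \<omega>} (\<lambda>i. g (X i \<omega>) / S' i \<omega>))"

lemma propagation_process_iff:
  "propagation_process M S g \<xi> N \<longleftrightarrow> point_process M N \<and> (\<exists>\<kappa> X S'. marked_enumeration M S g \<xi> N \<kappa> X S')"
  by (simp add: propagation_process_def marked_enumeration_def)

lemma unit_product_convergent:
  fixes c :: "nat \<Rightarrow> real"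
  assumes "\<And>i. 0 \<le> c i" "\<And>i. c i \<le> 1"
  shows "convergent (\<lambda>m. \<Prod>i<m. c i)"
proof -
  have nonneg: "0 \<le> (\<Prod>i<m. c i)" for m
    using assms(1) by (intro prod_nonneg) auto
  have "decseq (\<lambda>m. \<Prod>i<m. c i)"
    using nonneg assms(2) by (intro decseq_SucI) (simp add: mult_left_le)
  then obtain l where "(\<lambda>m. \<Prod>i<m. c i) \<longlonglongrightarrow> l"
    using decseq_convergent[of "\<lambda>m. \<Prod>i<m. c i" 0] nonneg by blast
  then show ?thesis by (rule convergentI)
qed

context prob_space
begin

text \<open>Let \<open>w n x\<close> be the mean weight of the point produced by \<open>x\<close>.
  The generating function is the mean of \<open>\<Psi> n\<close>, the product of \<open>w n
  x\<close> over the configuration, which does not depend on the enumeration. For a fixed good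
  configuration the deficits \<open>q n x = 1 - w n x\<close> have a convergent sum and are
  bounded by the probability that \<open>S\<close> exceeds a fixed positive level, so
  \<open>\<Psi> n\<close> converges almost surely by the law of rare events. The limit is not
  random, and dominated convergence finishes the proof.\<close>

lemma propagation_pgf_tendsto:
  fixes S :: "nat \<Rightarrow> 'a \<Rightarrow> real" and \<xi> :: "'a \<Rightarrow> (real ^ 'n) set" and N :: "nat \<Rightarrow> 'a \<Rightarrow> real measure"
    and a b la lb s :: "'j \<Rightarrow> real"
  assumes \<xi>: "AE \<omega> in M. locally_finite_config (\<xi> \<omega>)"
    and D: "mono_on {0..} D" "\<And>r. 0 \<le> r \<Longrightarrow> 0 \<le> D r"
    and ratio: "AE \<omega> in M. ((\<lambda>r. real (num_points (\<xi> \<omega>) r) / D r) \<longlongrightarrow> 1) at_top"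
    and D0: "(D \<longlongrightarrow> 0) (at_right 0)"
    and g: "\<And>x. g x = h (norm x)"
    and h: "mono_on {0..} h" "\<And>r. 0 < r \<Longrightarrow> continuous (at_left r) h" "\<And>r. 0 < r \<Longrightarrow> 0 < h r"
    and S [measurable]: "\<And>n. S n \<in> borel_measurable M" and S_pos: "\<And>n. AE \<omega> in M. 0 < S n \<omega>"
    and small: "\<And>c. 0 < c \<Longrightarrow> (\<lambda>n. prob {\<omega> \<in> space M. c \<le> S n \<omega>}) \<longlonglongrightarrow> 0"
    and N: "\<And>n. propagation_process M (S n) g \<xi> (N n)"
    and J: "finite J" "disjoint_family_on (\<lambda>j. {a j<..b j}) J"
    and ab: "\<And>j. j \<in> J \<Longrightarrow> 0 < a j" "\<And>j. j \<in> J \<Longrightarrow> a j < b j"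
    and s: "\<And>j. j \<in> J \<Longrightarrow> 0 < s j \<and> s j < 1"
    and l: "\<And>j. j \<in> J \<Longrightarrow> 0 \<le> la j" "\<And>j. j \<in> J \<Longrightarrow> la j \<le> lb j"
    and lim_a: "\<And>j. j \<in> J \<Longrightarrow>
      (\<lambda>n. \<integral>\<^sup>+\<omega>. extend_infty D (gen_inverse h (S n \<omega> * a j)) \<partial>M) \<longlonglongrightarrow> ennreal (la j)"
    and lim_b: "\<And>j. j \<in> J \<Longrightarrow>
      (\<lambda>n. \<integral>\<^sup>+\<omega>. extend_infty D (gen_inverse h (S n \<omega> * b j)) \<partial>M) \<longlonglongrightarrow> ennreal (lb j)"
  shows "(\<lambda>n. expectation (\<lambda>\<omega>. \<Prod>j\<in>J. count_power (s j) (emeasure (N n \<omega>) {a j<..b j})))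
    \<longlonglongrightarrow> exp (- (\<Sum>j\<in>J. (1 - s j) * (lb j - la j)))"
proof -
  define I where "I j = {a j<..b j}" for j
  have I_sets: "I j \<in> sets pos_borel" if "j \<in> J" for j
    using ab(1)[OF that] by (simp add: I_def)
  have I_disj: "disjoint_family_on I J"
    using J(2) by (simp add: I_def[abs_def])
  define u where "u = hit_weight J I s"
  have u_bounds: "0 \<le> u y" "u y \<le> 1" for y
    unfolding u_def using hit_weight_bounds[of J s I] s by auto
  have u_meas [measurable]: "u \<in> borel_measurable borel"
    unfolding u_def by (rule hit_weight_measurable[OF J(1) I_sets])
  have g_meas [measurable]: "g \<in> borel_measurable borel"
  proof -
    have "mono (\<lambda>r. h (max 0 r))"
      using h(1) by (intro monoI) (auto simp: mono_on_def)
    then have "(\<lambda>r. h (max 0 r)) \<in> borel_measurable borel"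
      by (rule borel_measurable_mono)
    then have "(\<lambda>x. h (max 0 (norm x))) \<in> borel_measurable (borel :: (real ^ 'n) measure)"
      by measurable
    moreover have "(\<lambda>x. h (max 0 (norm x))) = g" by (auto simp: g fun_eq_iff)
    ultimately show ?thesis by simp
  qed
  define w where "w n x = expectation (\<lambda>\<omega>. u (g x / S n \<omega>))" for n x
  define q where "q n x = 1 - w n x" for n x
  have w_bounds: "0 \<le> w n x" "w n x \<le> 1" for n x
    unfolding w_def using u_bounds by (auto intro!: expectation_unit_interval)
  have w_meas [measurable]: "w n \<in> borel_measurable borel" for n
    unfolding w_def[abs_def] by (rule borel_measurable_lebesgue_integral) measurable
  have q_eq: "q n x = expectation (\<lambda>\<omega>. 1 - u (g x / S n \<omega>))" for n x
    unfolding q_def w_def using u_bounds by (subst Bochner_Integration.integral_diff)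
      (auto simp: prob_space intro!: integrable_unit_interval)
  have q_sum: "q n x = (\<Sum>j\<in>J. (1 - s j) * prob {\<omega> \<in> space M. h (norm x) / S n \<omega> \<in> I j})" for n x
  proof -
    have [measurable]: "I j \<in> sets borel" for j by (simp add: I_def)
    have "q n x = expectation (\<lambda>\<omega>. \<Sum>j\<in>J. (1 - s j) * indicator {\<omega> \<in> space M. h (norm x) / S n \<omega> \<in> I j} \<omega>)"
      unfolding q_eq u_def hit_weight_disjoint[OF J(1) I_disj]
      by (intro Bochner_Integration.integral_cong refl sum.cong) (auto simp: indicator_def g)
    also have "\<dots> = (\<Sum>j\<in>J. (1 - s j) * prob {\<omega> \<in> space M. h (norm x) / S n \<omega> \<in> I j})"
      by (subst Bochner_Integration.integral_sum) (auto simp: Int_absorb2 less_top[symmetric])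
    finally show ?thesis .
  qed
  define \<Theta> where "\<Theta> = (\<Sum>j\<in>J. (1 - s j) * (lb j - la j))"
  have \<Theta>_nonneg: "0 \<le> \<Theta>"
    unfolding \<Theta>_def using s l by (intro sum_nonneg mult_nonneg_nonneg) (auto intro: less_imp_le)
  have intensity: "(\<lambda>n. \<integral>\<^sup>+x. ennreal (q n x) \<partial>count_space \<xi>0) \<longlonglongrightarrow> ennreal \<Theta>"
    if \<xi>0: "locally_finite_config \<xi>0" "((\<lambda>r. real (num_points \<xi>0 r) / D r) \<longlongrightarrow> 1) at_top" for \<xi>0 :: "(real ^ 'n) set"
  proof -
    have "(\<lambda>n. \<Sum>j\<in>J. ennreal (1 - s j) *
        (\<integral>\<^sup>+x. emeasure M {\<omega> \<in> space M. h (norm x) / S n \<omega> \<in> I j} \<partial>count_space \<xi>0))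
      \<longlonglongrightarrow> (\<Sum>j\<in>J. ennreal (1 - s j) * ennreal (lb j - la j))"
    proof (rule tendsto_sum)
      fix j assume j: "j \<in> J"
      have "(\<lambda>n. \<integral>\<^sup>+x. emeasure M {\<omega> \<in> space M. h (norm x) / S n \<omega> \<in> I j} \<partial>count_space \<xi>0)
          \<longlonglongrightarrow> ennreal (lb j - la j)"
        unfolding I_def
        using order_trans[OF l(1)[OF j] l(2)[OF j]]
        by (intro interval_intensity_tendsto[OF \<xi>0(1) D \<xi>0(2) D0 h S S_pos small ab(1)[OF j] ab(2)[OF j] l(1)[OF j] _
            lim_a[OF j] lim_b[OF j]])
      then show "(\<lambda>n. ennreal (1 - s j) * (\<integral>\<^sup>+x. emeasure M {\<omega> \<in> space M. h (norm x) / S n \<omega> \<in> I j} \<partial>count_space \<xi>0))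
          \<longlonglongrightarrow> ennreal (1 - s j) * ennreal (lb j - la j)"
        by (intro tendsto_mult_ennreal tendsto_const) auto
    qed
    moreover have "(\<Sum>j\<in>J. ennreal (1 - s j) * ennreal (lb j - la j)) = ennreal \<Theta>"
    proof -
      have "(\<Sum>j\<in>J. ennreal (1 - s j) * ennreal (lb j - la j)) = (\<Sum>j\<in>J. ennreal ((1 - s j) * (lb j - la j)))"
        using s l by (intro sum.cong refl ennreal_mult[symmetric]) (auto intro: less_imp_le)
      also have "\<dots> = ennreal \<Theta>"
        unfolding \<Theta>_def using s l by (intro sum_ennreal mult_nonneg_nonneg) (auto intro: less_imp_le)
      finally show ?thesis .
    qed
    moreover have "(\<integral>\<^sup>+x. ennreal (q n x) \<partial>count_space \<xi>0) = (\<Sum>j\<in>J. ennreal (1 - s j) *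
        (\<integral>\<^sup>+x. emeasure M {\<omega> \<in> space M. h (norm x) / S n \<omega> \<in> I j} \<partial>count_space \<xi>0))" for n
    proof -
      have "ennreal (q n x) = (\<Sum>j\<in>J. ennreal (1 - s j) * emeasure M {\<omega> \<in> space M. h (norm x) / S n \<omega> \<in> I j})" for x
      proof -
        have "ennreal (q n x) = (\<Sum>j\<in>J. ennreal ((1 - s j) * prob {\<omega> \<in> space M. h (norm x) / S n \<omega> \<in> I j}))"
          unfolding q_sum using s by (intro sum_ennreal[symmetric] mult_nonneg_nonneg) (auto intro: less_imp_le)
        also have "\<dots> = (\<Sum>j\<in>J. ennreal (1 - s j) * emeasure M {\<omega> \<in> space M. h (norm x) / S n \<omega> \<in> I j})"
          unfolding emeasure_eq_measure using s by (intro sum.cong refl ennreal_mult) (auto intro: less_imp_le)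
        finally show ?thesis .
      qed
      then show ?thesis by (simp add: nn_integral_sum nn_integral_cmult)
    qed
    ultimately show ?thesis by simp
  qed
  \<comment> \<open>All intervals lie in \<open>(0, \<beta>]\<close>; the element \<open>1\<close>
    makes the maximum meaningful and positive for empty \<open>J\<close>.\<close>
  define \<beta> where "\<beta> = Max (insert 1 (b ` J))"
  have \<beta>: "0 < \<beta>" "\<And>j. j \<in> J \<Longrightarrow> b j \<le> \<beta>"
    using J(1) by (auto simp: \<beta>_def Max_gr_iff)
  have q_le: "q n x \<le> prob {\<omega> \<in> space M. c / \<beta> \<le> S n \<omega>}" if "c \<le> g x" for n x c
  proof -
    have "q n x \<le> expectation (indicator {\<omega> \<in> space M. c / \<beta> \<le> S n \<omega>})"
      unfolding q_eq
    proof (rule integral_mono_AE)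
      show "integrable M (\<lambda>\<omega>. 1 - u (g x / S n \<omega>))"
        using u_bounds by (intro integrable_unit_interval) auto
      show "integrable M (indicator {\<omega> \<in> space M. c / \<beta> \<le> S n \<omega>} :: 'a \<Rightarrow> real)"
        by (intro integrable_real_indicator) (auto simp: less_top[symmetric])
      show "AE \<omega> in M. 1 - u (g x / S n \<omega>) \<le> indicator {\<omega> \<in> space M. c / \<beta> \<le> S n \<omega>} \<omega>"
        using S_pos[of n] AE_space
      proof eventually_elim
        case (elim \<omega>)
        show ?case
        proof (cases "c / \<beta> \<le> S n \<omega>")
          case True
          then show ?thesis using elim u_bounds(1) by simp
        next
          case False
          then have "S n \<omega> * \<beta> < c" using \<beta>(1) by (simp add: not_le pos_less_divide_eq)
          then have "\<beta> < g x / S n \<omega>" using that elim(1) by (simp add: pos_less_divide_eq mult.commute)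
          then have "g x / S n \<omega> \<notin> I j" if "j \<in> J" for j
            using \<beta>(2)[OF that] by (auto simp: I_def)
          then have "u (g x / S n \<omega>) = 1" by (simp add: u_def hit_weight_def)
          then show ?thesis by simp
        qed
      qed
    qed
    then show ?thesis by (simp add: Int_absorb2)
  qed
  have "\<forall>n. \<exists>\<kappa> X S'. marked_enumeration M (S n) g \<xi> (N n) \<kappa> X S'"
    using N by (simp add: propagation_process_iff)
  then obtain \<kappa> X S' where enum: "\<And>n. marked_enumeration M (S n) g \<xi> (N n) (\<kappa> n) (X n) (S' n)"
    by metis
  define P where "P n m \<omega> = (\<Prod>i\<in>{i \<in> {..<m}. enat i < \<kappa> n \<omega>}. w n (X n i \<omega>))" for n m \<omega>
  define \<Psi> where "\<Psi> n \<omega> = lim (\<lambda>m. P n m \<omega>)" for n \<omega>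
  have P_alt: "P n m \<omega> = (\<Prod>i<m. if enat i < \<kappa> n \<omega> then w n (X n i \<omega>) else 1)" for n m \<omega>
    unfolding P_def by (rule prod.inter_filter) simp
  have P_bounds: "0 \<le> P n m \<omega>" "P n m \<omega> \<le> 1" for n m \<omega>
    unfolding P_def using w_bounds by (auto intro!: prod_nonneg prod_le_1)
  have P_lim: "(\<lambda>m. P n m \<omega>) \<longlonglongrightarrow> \<Psi> n \<omega>" for n \<omega>
    unfolding \<Psi>_def convergent_LIMSEQ_iff[symmetric] P_alt
    using w_bounds by (intro unit_product_convergent) auto
  have \<Psi>_bounds: "0 \<le> \<Psi> n \<omega>" "\<Psi> n \<omega> \<le> 1" for n \<omega>
    using LIMSEQ_le_const[OF P_lim] LIMSEQ_le_const2[OF P_lim] P_bounds by blast+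
  have \<kappa>_meas [measurable]: "\<kappa> n \<in> measurable M (count_space UNIV)"
    and X_meas [measurable]: "X n i \<in> borel_measurable M"
    and bij: "AE \<omega> in M. bij_betw (\<lambda>i. X n i \<omega>) {i. enat i < \<kappa> n \<omega>} (\<xi> \<omega>)" for n i
    using enum[of n] by (auto simp: marked_enumeration_def random_enumeration_def)
  have P_meas [measurable]: "P n m \<in> borel_measurable M" for n m
    unfolding P_alt[abs_def] by measurable
  have \<Psi>_meas [measurable]: "\<Psi> n \<in> borel_measurable M" for n
    unfolding \<Psi>_def[abs_def] by measurable
  have N_meas: "N n \<in> measurable M (borel_of vague_topology)" for n
    using N[of n] by (simp add: propagation_process_def point_process_def)
  have pgf_eq: "expectation (\<lambda>\<omega>. \<Prod>j\<in>J. count_power (s j) (emeasure (N n \<omega>) (I j))) = expectation (\<Psi> n)" for n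
  proof -
    have indep: "indep_vars (\<lambda>_. borel) (S' n) (UNIV :: nat set)"
      and S'_distr: "distr M borel (S' n i) = distr M borel (S n)"
      and pair: "indep_pair M (count_space UNIV \<Otimes>\<^sub>M PiM UNIV (\<lambda>_. borel)) (\<lambda>\<omega>. (\<kappa> n \<omega>, \<lambda>i. X n i \<omega>))
          (PiM UNIV (\<lambda>_. borel)) (\<lambda>\<omega> i. S' n i \<omega>)"
      and N_eq: "AE \<omega> in M. N n \<omega> = dirac_sum {i. enat i < \<kappa> n \<omega>} (\<lambda>i. g (X n i \<omega>) / S' n i \<omega>)" for i
      using enum[of n] by (auto simp: marked_enumeration_def)
    have S'_meas [measurable]: "S' n i \<in> borel_measurable M" for i
      using indep by (auto simp: indep_vars_def)
    have "AE \<omega> in M. 0 < S' n i \<omega>" for i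
    proof -
      have "AE y in distr M borel (S n). 0 < y"
        using S_pos[of n] by (subst AE_distr_iff) auto
      then have "AE y in distr M borel (S' n i). 0 < y"
        unfolding S'_distr .
      then show ?thesis by (subst (asm) AE_distr_iff) auto
    qed
    then have S'_pos: "AE \<omega> in M. \<forall>i. 0 < S' n i \<omega>"
      by (simp add: AE_all_countable)
    define V where "V m \<omega> = (\<Prod>i\<in>{i \<in> {..<m}. enat i < \<kappa> n \<omega>}. u (g (X n i \<omega>) / S' n i \<omega>))" for m \<omega>
    have V_alt: "V m \<omega> = (\<Prod>i<m. if enat i < \<kappa> n \<omega> then u (g (X n i \<omega>) / S' n i \<omega>) else 1)" for m \<omega>
      unfolding V_def by (rule prod.inter_filter) simp
    have V_meas: "V m \<in> borel_measurable M" for m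
      unfolding V_alt[abs_def] by measurable
    have V_bounds: "0 \<le> V m \<omega>" "V m \<omega> \<le> 1" for m \<omega>
      unfolding V_def using u_bounds by (auto intro!: prod_nonneg prod_le_1)
    have "(\<lambda>m. expectation (V m)) \<longlonglongrightarrow> expectation (\<lambda>\<omega>. \<Prod>j\<in>J. count_power (s j) (emeasure (N n \<omega>) (I j)))"
    proof (rule integral_dominated_convergence[where w = "\<lambda>_. 1"])
      show "AE \<omega> in M. (\<lambda>m. V m \<omega>) \<longlonglongrightarrow> (\<Prod>j\<in>J. count_power (s j) (emeasure (N n \<omega>) (I j)))"
        using \<xi> bij[of n] S'_pos N_eq
      proof eventually_elim
        case (elim \<omega>)
        have pos: "0 < g (X n i \<omega>) / S' n i \<omega>" if "i \<in> {i. enat i < \<kappa> n \<omega>}" for i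
        proof -
          have "X n i \<omega> \<in> \<xi> \<omega>"
            using bij_betwE[OF elim(2)] that by blast
          then have "X n i \<omega> \<noteq> 0"
            using elim(1) by (auto simp: locally_finite_config_def)
          then show ?thesis using elim(3) h(3) by (simp add: g)
        qed
        show ?case
          unfolding elim(4) V_def u_def
          by (rule hit_weight_prod_tendsto[OF pos J(1) I_sets s]) (auto simp: mono_def)
      qed
      show "(\<lambda>\<omega>. \<Prod>j\<in>J. count_power (s j) (emeasure (N n \<omega>) (I j))) \<in> borel_measurable M"
      proof (rule borel_measurable_prod)
        fix j assume j: "j \<in> J"
        have "(\<lambda>\<nu>. count_power (s j) (emeasure \<nu> (I j))) \<in> borel_measurable (borel_of vague_topology)"
          by (rule measurable_compose[OF evaluation_measurable[OF I_sets[OF j]] count_power_measurable])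
        then show "(\<lambda>\<omega>. count_power (s j) (emeasure (N n \<omega>) (I j))) \<in> borel_measurable M"
          by (rule measurable_compose[OF N_meas])
      qed
      show "AE \<omega> in M. norm (V m \<omega>) \<le> 1" for m
        by (intro AE_I2) (simp add: V_bounds)
    qed (simp_all add: V_meas)
    moreover have "(\<lambda>m. expectation (P n m)) \<longlonglongrightarrow> expectation (\<Psi> n)"
    proof (rule integral_dominated_convergence[where w = "\<lambda>_. 1"])
      show "AE \<omega> in M. norm (P n m \<omega>) \<le> 1" for m
        by (intro AE_I2) (simp add: P_bounds)
    qed (simp_all add: P_lim)
    moreover have "expectation (V m) = expectation (P n m)" for m
      unfolding V_def P_def w_def
      by (rule independent_marks_product[where v = "\<lambda>x \<sigma>. u (g x / \<sigma>)", OF pair indep S'_distr S])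
        (use u_bounds in \<open>simp_all, measurable\<close>)
    ultimately show ?thesis
      using LIMSEQ_unique by simp
  qed
  have "(\<lambda>n. expectation (\<Psi> n)) \<longlonglongrightarrow> expectation (\<lambda>_. exp (- \<Theta>))"
  proof (rule integral_dominated_convergence[where w = "\<lambda>_. 1"])
    have "AE \<omega> in M. \<forall>n. bij_betw (\<lambda>i. X n i \<omega>) {i. enat i < \<kappa> n \<omega>} (\<xi> \<omega>)"
      using bij by (simp add: AE_all_countable)
    then show "AE \<omega> in M. (\<lambda>n. \<Psi> n \<omega>) \<longlonglongrightarrow> exp (- \<Theta>)"
      using \<xi> ratio
    proof eventually_elim
      case (elim \<omega>)
      define \<tau> where "\<tau> n = (\<integral>\<^sup>+x. ennreal (q n x) \<partial>count_space (\<xi> \<omega>))" for n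
      have \<tau>_lim: "\<tau> \<longlonglongrightarrow> ennreal \<Theta>"
        unfolding \<tau>_def using intensity[OF elim(2,3)] .
      obtain r0 where r0: "0 < r0" "\<And>x. x \<in> \<xi> \<omega> \<Longrightarrow> r0 \<le> norm x"
        using locally_finite_config_gap[OF elim(2)] by blast
      define \<delta> where "\<delta> n = prob {\<omega> \<in> space M. h r0 / \<beta> \<le> S n \<omega>}" for n
      have \<delta>_lim: "\<delta> \<longlonglongrightarrow> 0"
        unfolding \<delta>_def using h(3)[OF r0(1)] \<beta>(1) by (intro small) simp
      have \<tau>'_lim: "(\<lambda>n. enn2real (\<tau> n)) \<longlonglongrightarrow> \<Theta>"
        by (rule tendsto_enn2real[OF \<tau>_lim \<Theta>_nonneg])
      have "\<forall>\<^sub>F n in sequentially. \<tau> n < \<infinity>"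
        using \<tau>_lim by (intro order_tendstoD) auto
      moreover have "\<forall>\<^sub>F n in sequentially. \<delta> n < 1"
        using \<delta>_lim by (intro order_tendstoD) auto
      ultimately have bounds: "\<forall>\<^sub>F n in sequentially.
          exp (- (enn2real (\<tau> n) / (1 - \<delta> n))) \<le> \<Psi> n \<omega> \<and> \<Psi> n \<omega> \<le> exp (- enn2real (\<tau> n))"
      proof eventually_elim
        case (elim n)
        have bij_n: "bij_betw (\<lambda>i. X n i \<omega>) {i. enat i < \<kappa> n \<omega>} (\<xi> \<omega>)"
          using \<open>\<forall>n. bij_betw (\<lambda>i. X n i \<omega>) {i. enat i < \<kappa> n \<omega>} (\<xi> \<omega>)\<close> by blast
        have "(\<integral>\<^sup>+i. ennreal (q n (X n i \<omega>)) \<partial>count_space {i. enat i < \<kappa> n \<omega>}) = \<tau> n"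
          unfolding \<tau>_def by (rule nn_integral_bij_count_space[OF bij_n])
        also have "\<dots> = ennreal (enn2real (\<tau> n))"
          using elim(1) by simp
        finally have total: "(\<integral>\<^sup>+i. ennreal (q n (X n i \<omega>)) \<partial>count_space {i. enat i < \<kappa> n \<omega>}) = ennreal (enn2real (\<tau> n))" .
        have q_X: "0 \<le> q n (X n i \<omega>)" "q n (X n i \<omega>) \<le> \<delta> n" if "i \<in> {i. enat i < \<kappa> n \<omega>}" for i
        proof -
          show "0 \<le> q n (X n i \<omega>)" using w_bounds(2) by (simp add: q_def)
          have "X n i \<omega> \<in> \<xi> \<omega>" using bij_betwE[OF bij_n] that by blast
          then have "h r0 \<le> g (X n i \<omega>)"
            using r0 h(1) by (auto simp: g mono_on_def)
          then show "q n (X n i \<omega>) \<le> \<delta> n" unfolding \<delta>_def by (rule q_le)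
        qed
        have "(\<lambda>m. \<Prod>i\<in>{i \<in> {..<m}. i \<in> {i. enat i < \<kappa> n \<omega>}}. 1 - q n (X n i \<omega>)) \<longlonglongrightarrow> \<Psi> n \<omega>"
          using P_lim[of n \<omega>] by (simp add: P_def q_def)
        from thinning_product_bounds[OF q_X elim(2) _ total _ this]
        show ?case by (simp add: \<delta>_def)
      qed
      show ?case
      proof (rule tendsto_sandwich)
        show "\<forall>\<^sub>F n in sequentially. exp (- (enn2real (\<tau> n) / (1 - \<delta> n))) \<le> \<Psi> n \<omega>"
          using bounds by eventually_elim simp
        show "\<forall>\<^sub>F n in sequentially. \<Psi> n \<omega> \<le> exp (- enn2real (\<tau> n))"
          using bounds by eventually_elim simp
        have "(\<lambda>n. exp (- (enn2real (\<tau> n) / (1 - \<delta> n)))) \<longlonglongrightarrow> exp (- (\<Theta> / (1 - 0)))"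
          by (intro tendsto_intros \<tau>'_lim \<delta>_lim) simp
        then show "(\<lambda>n. exp (- (enn2real (\<tau> n) / (1 - \<delta> n)))) \<longlonglongrightarrow> exp (- \<Theta>)" by simp
        show "(\<lambda>n. exp (- enn2real (\<tau> n))) \<longlonglongrightarrow> exp (- \<Theta>)"
          by (intro tendsto_intros \<tau>'_lim)
      qed
    qed
    show "AE \<omega> in M. norm (\<Psi> n \<omega>) \<le> 1" for n
      by (intro AE_I2) (simp add: \<Psi>_bounds)
  qed simp_all
  then show ?thesis
    unfolding pgf_eq[symmetric] by (simp add: \<Theta>_def I_def prob_space)
qed

end

text \<open>The function \<open>t \<mapsto> L (0, t]\<close> is monotone and finite.\<close>

lemma countable_discontinuity_points:
  assumes L: "\<And>t. 0 < t \<Longrightarrow> emeasure L {0<..t} < \<infinity>" and sets: "sets L = sets pos_borel"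
  shows "countable ({0<..} - continuity_points L)"
proof -
  define F where "F t = measure L {0<..t}" for t
  have F: "emeasure L {0<..t} = ennreal (F t)" if "0 < t" for t
    unfolding F_def using L[OF that] by (intro emeasure_eq_ennreal_measure) auto
  have "mono_on {0<..} F"
  proof (rule mono_onI)
    fix r t :: real assume "r \<in> {0<..}" "t \<in> {0<..}" "r \<le> t"
    then show "F r \<le> F t"
      unfolding F_def using L[of t]
      by (intro measure_mono_fmeasurable) (auto simp: fmeasurable_def sets)
  qed
  then have "countable {t \<in> {0<..}. \<not> continuous (at t within {0<..}) F}"
    by (rule mono_on_ctble_discont)
  moreover have "{0<..} - continuity_points L \<subseteq> {t \<in> {0<..}. \<not> continuous (at t within {0<..}) F}"
  proof
    fix t assume t: "t \<in> {0<..} - continuity_points L"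
    have "t \<in> continuity_points L" if "continuous (at t within {0<..}) F"
    proof -
      have t0: "0 < t" using t by simp
      have "at t within {0<..} = at t"
        using t0 by (intro at_within_open) auto
      then have "(F \<longlongrightarrow> F t) (at t)"
        using that by (simp add: continuous_within)
      then have "((\<lambda>s. ennreal (F s)) \<longlongrightarrow> ennreal (F t)) (at t)"
        by (rule tendsto_ennrealI)
      moreover have "\<forall>\<^sub>F s in at t. ennreal (F s) = emeasure L {0<..s}"
      proof -
        have "\<forall>\<^sub>F s in at t. 0 < s"
          using t0 order_tendstoD(1)[OF tendsto_ident_at, of 0 t UNIV] by simp
        then show ?thesis by eventually_elim (simp add: F)
      qed
      ultimately have "((\<lambda>s. emeasure L {0<..s}) \<longlongrightarrow> ennreal (F t)) (at t)"
        by (rule Lim_transform_eventually)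
      then show ?thesis using t0 by (simp add: continuity_points_def F)
    qed
    then show "t \<in> {t \<in> {0<..}. \<not> continuous (at t within {0<..}) F}" using t by auto
  qed
  ultimately show ?thesis by (rule countable_subset[rotated])
qed

text \<open>The open interval prescribed for a node is uncountable.\<close>

lemma fine_grid_avoiding_countable:
  assumes "countable ({0<..} - C)"
  obtains T where "fine_grid T" "\<And>m i. T m i \<in> C"
proof -
  have "\<exists>t. real i / real (Suc m) < t \<and> t < real (Suc i) / real (Suc m) \<and> t \<in> C" for m i
  proof (rule ccontr)
    assume none: "\<not> ?thesis"
    have "{real i / real (Suc m)<..<real (Suc i) / real (Suc m)} \<subseteq> {0<..} - C"
    proof
      fix t assume t: "t \<in> {real i / real (Suc m)<..<real (Suc i) / real (Suc m)}"
      have "0 \<le> real i / real (Suc m)" by simp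
      moreover have "real i / real (Suc m) < t" using t by simp
      ultimately have "0 < t" by (rule le_less_trans)
      then show "t \<in> {0<..} - C" using t none by auto
    qed
    then have "countable {real i / real (Suc m)<..<real (Suc i) / real (Suc m)}"
      using assms by (rule countable_subset)
    moreover have "real i / real (Suc m) < real (Suc i) / real (Suc m)"
      by (intro divide_strict_right_mono) auto
    ultimately show False using uncountable_open_interval by blast
  qed
  then have "\<forall>m i. \<exists>t. real i / real (Suc m) < t \<and> t < real (Suc i) / real (Suc m) \<and> t \<in> C"
    by blast
  then obtain T where T: "\<And>m i. real i / real (Suc m) < T m i \<and> T m i < real (Suc i) / real (Suc m) \<and> T m i \<in> C"
    unfolding choice_iff by blast
  show ?thesis
    using T by (intro that[of T]) (simp_all add: fine_grid_def)
qed

theorem theorem1p1: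
  fixes M :: "'w measure"
    and \<xi> :: "'w \<Rightarrow> (real ^ 'n) set"
    and D h :: "real \<Rightarrow> real"
    and g :: "real ^ 'n \<Rightarrow> real"
    and S :: "real \<Rightarrow> 'w \<Rightarrow> real"
    and N :: "real \<Rightarrow> 'w \<Rightarrow> real measure"
    and L :: "real measure"
  assumes "prob_space M"
    and "AE \<omega> in M. locally_finite_config (\<xi> \<omega>)"
    and "mono_on {0..} D" and "\<And>r. 0 \<le> r \<Longrightarrow> 0 \<le> D r"
    and "AE \<omega> in M. ((\<lambda>r. real (num_points (\<xi> \<omega>) r) / D r) \<longlongrightarrow> 1) at_top"
    and "(D \<longlongrightarrow> 0) (at_right 0)"
    and "\<And>x. 0 \<le> g x" and "\<And>x. x \<noteq> 0 \<Longrightarrow> 0 < g x"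
    and "\<And>x. g x = h (norm x)"
    and "mono_on {0..} h" and "\<And>r. 0 < r \<Longrightarrow> continuous (at_left r) h"
    and "\<And>\<sigma>. 0 \<le> \<sigma> \<Longrightarrow> S \<sigma> \<in> borel_measurable M"
    and "\<And>\<sigma>. 0 \<le> \<sigma> \<Longrightarrow> AE \<omega> in M. 0 < S \<sigma> \<omega>"
    and "\<And>\<sigma>. 0 \<le> \<sigma> \<Longrightarrow> propagation_process M (S \<sigma>) g \<xi> (N \<sigma>)"
    and "radon_pos L" and "\<And>t. 0 < t \<Longrightarrow> emeasure L {0<..t} < \<infinity>"
    and "tends_to_0_in_probability M S"
    and "\<And>t. t \<in> continuity_points L \<Longrightarrow>
      ((\<lambda>\<sigma>. \<integral>\<^sup>+ \<omega>. extend_infty D (gen_inverse h (S \<sigma> \<omega> * t)) \<partial>M)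
         \<longlongrightarrow> emeasure L {0<..t}) at_top"
  shows "\<exists>Q. poisson_process_law L Q \<and>
    weak_convergence vague_topology (\<lambda>\<sigma>. distr M (borel_of vague_topology) (N \<sigma>)) Q at_top"
proof (intro exI conjI)
  interpret prob_space M by (rule assms(1))
  note L = assms(15,16)
  show law: "poisson_process_law L (poisson_law L)"
    by (rule poisson_process_law_poisson_law[OF L])
  have sets_L: "sets L = sets pos_borel"
    using L(1) by (simp add: radon_pos_def)
  obtain T where T: "fine_grid T" "\<And>m i. T m i \<in> continuity_points L"
    using fine_grid_avoiding_countable[OF countable_discontinuity_points[OF L(2) sets_L]] by blast
  have h_pos: "0 < h r" if "0 < r" for r
  proof -
    define x :: "real ^ 'n" where "x = r *\<^sub>R axis undefined 1"
    have x: "norm x = r" using that by (simp add: x_def norm_axis_1)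
    then have "x \<noteq> 0" using that by auto
    then show ?thesis using assms(8)[of x] assms(9)[of x] x by simp
  qed
  have L_finite: "emeasure L {0<..t} = ennreal (measure L {0<..t})" if "0 < t" for t
    using L(2)[OF that] by (intro emeasure_eq_ennreal_measure) auto
  \<comment> \<open>Each parameter has its own enumeration, with its own exceptional null set; for
    a sequence of parameters the union of these sets is null.\<close>
  have along: "weak_convergence vague_topology (\<lambda>n. distr M (borel_of vague_topology) (N (\<sigma> n))) (poisson_law L) sequentially"
    if \<sigma>: "filterlim \<sigma> at_top sequentially" "\<And>n. 0 \<le> \<sigma> n" for \<sigma> :: "nat \<Rightarrow> real"
  proof (rule weak_convergence_cell_counts[OF T(1)])
    have N_meas: "N (\<sigma> n) \<in> measurable M (borel_of vague_topology)" for n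
      using assms(14)[OF \<sigma>(2)] by (simp add: propagation_process_def point_process_def)
    show "prob_space (distr M (borel_of vague_topology) (N (\<sigma> n)))" for n
      by (rule prob_space_distr[OF N_meas])
    show "prob_space (poisson_law L)" "sets (poisson_law L) = sets (borel_of vague_topology)"
      using law by (simp_all add: poisson_process_law_def)
    have N_point: "N (\<sigma> n) \<omega> \<in> point_measures" if "\<omega> \<in> space M" for n \<omega>
      using measurable_space[OF N_meas that] by simp
    have small: "(\<lambda>n. prob {\<omega> \<in> space M. c \<le> S (\<sigma> n) \<omega>}) \<longlonglongrightarrow> 0" if c: "0 < c" for c
    proof (rule tendsto_sandwich[OF _ _ tendsto_const])
      have "0 < c / 2" using c by simp
      then have "((\<lambda>\<sigma>. prob {\<omega> \<in> space M. \<bar>S \<sigma> \<omega>\<bar> > c / 2}) \<longlongrightarrow> 0) at_top"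
        by (rule assms(17)[unfolded tends_to_0_in_probability_def, rule_format])
      then show "(\<lambda>n. prob {\<omega> \<in> space M. \<bar>S (\<sigma> n) \<omega>\<bar> > c / 2}) \<longlonglongrightarrow> 0"
        by (rule filterlim_compose[OF _ \<sigma>(1)])
      show "\<forall>\<^sub>F n in sequentially. prob {\<omega> \<in> space M. c \<le> S (\<sigma> n) \<omega>} \<le> prob {\<omega> \<in> space M. \<bar>S (\<sigma> n) \<omega>\<bar> > c / 2}"
      proof (rule always_eventually, rule allI, rule finite_measure_mono)
        fix n
        have [measurable]: "S (\<sigma> n) \<in> borel_measurable M" by (rule assms(12)[OF \<sigma>(2)])
        show "{\<omega> \<in> space M. \<bar>S (\<sigma> n) \<omega>\<bar> > c / 2} \<in> events" by measurable
      qed (use c in auto)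
    qed simp
    have lim: "(\<lambda>n. \<integral>\<^sup>+\<omega>. extend_infty D (gen_inverse h (S (\<sigma> n) \<omega> * T m i)) \<partial>M)
        \<longlonglongrightarrow> ennreal (measure L {0<..T m i})" for m i
      using filterlim_compose[OF assms(18)[OF T(2)] \<sigma>(1)] L_finite[OF grid_bounds(3)[OF T(1)]] by simp
    have cell_L: "emeasure L (cell T m i) = ennreal (measure L {0<..T m (Suc i)} - measure L {0<..T m i})"
      "measure L {0<..T m i} \<le> measure L {0<..T m (Suc i)}" for m i
    proof -
      have le: "0 < T m i" "T m i < T m (Suc i)"
        using grid_bounds(3)[OF T(1)] grid_strict_mono[OF T(1), of i "Suc i" m] by auto
      have split: "{0<..T m (Suc i)} = {0<..T m i} \<union> cell T m i"
        using le by (auto simp: cell_def)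
      have sum: "emeasure L {0<..T m (Suc i)} = emeasure L {0<..T m i} + emeasure L (cell T m i)"
        unfolding split using cell_pos_borel[OF T(1), of m i] le
        by (intro plus_emeasure[symmetric]) (auto simp: sets_L cell_def)
      have fin: "emeasure L (cell T m i) = ennreal (measure L (cell T m i))"
        using cell_finite[OF T(1) L(1), of m i] by (intro emeasure_eq_ennreal_measure) auto
      have "ennreal (measure L {0<..T m (Suc i)}) = ennreal (measure L {0<..T m i} + measure L (cell T m i))"
        using sum L_finite[of "T m i"] L_finite[of "T m (Suc i)"] le fin by simp
      then have "measure L {0<..T m (Suc i)} = measure L {0<..T m i} + measure L (cell T m i)"
        by (subst (asm) ennreal_inj) auto
      then show "emeasure L (cell T m i) = ennreal (measure L {0<..T m (Suc i)} - measure L {0<..T m i})"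
        "measure L {0<..T m i} \<le> measure L {0<..T m (Suc i)}"
        using fin by simp_all
    qed
    fix m ks
    define J where "J = {..<grid_size m}"
    have counts_eq: "{\<nu> \<in> point_measures. cell_counts T m \<nu> = ks} =
        {\<nu> \<in> point_measures. \<forall>j\<in>J. emeasure \<nu> (cell T m j) = of_nat (ks ! j)}"
      if "length ks = grid_size m"
      using cell_counts_eq_iff[OF T(1)] that by (auto simp: J_def)
    have cell_disj: "disjoint_family_on (cell T m) J"
      using cell_disjoint[OF T(1)] by (auto simp: disjoint_family_on_def)
    have "(\<lambda>n. prob {\<omega> \<in> space M. \<forall>j\<in>J. emeasure (N (\<sigma> n) \<omega>) (cell T m j) = of_nat (ks ! j)})
        \<longlonglongrightarrow> (\<Prod>j\<in>J. poisson_prob (emeasure L (cell T m j)) (ks ! j))"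
    proof (rule pgf_convergence)
      show "finite J" by (simp add: J_def)
      show "(\<lambda>\<omega>. emeasure (N (\<sigma> n) \<omega>) (cell T m j)) \<in> borel_measurable M" for n j
        by (rule measurable_compose[OF N_meas evaluation_measurable[OF cell_pos_borel[OF T(1)]]])
      show "AE \<omega> in M. emeasure (N (\<sigma> n) \<omega>) (cell T m j) \<in> count_values" for n j
        by (intro AE_I2 point_measures_counts N_point cell_pos_borel[OF T(1)])
    next
      fix s :: "nat \<Rightarrow> real" assume s: "\<And>j. 0 < s j \<and> s j < 1"
      have "(\<lambda>n. expectation (\<lambda>\<omega>. \<Prod>j\<in>J. count_power (s j) (emeasure (N (\<sigma> n) \<omega>) {T m j<..T m (Suc j)})))
          \<longlonglongrightarrow> exp (- (\<Sum>j\<in>J. (1 - s j) * (measure L {0<..T m (Suc j)} - measure L {0<..T m j})))"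
      proof (rule propagation_pgf_tendsto[where S = "\<lambda>n. S (\<sigma> n)" and D = D and h = h and g = g and \<xi> = \<xi>
            and la = "\<lambda>j. measure L {0<..T m j}" and lb = "\<lambda>j. measure L {0<..T m (Suc j)}"])
        show "disjoint_family_on (\<lambda>j. {T m j<..T m (Suc j)}) J"
          using cell_disj by (simp add: cell_def[abs_def])
        show "T m j < T m (Suc j)" for j
          by (rule grid_strict_mono[OF T(1)]) simp
        show "propagation_process M (S (\<sigma> n)) g \<xi> (N (\<sigma> n))" for n
          by (rule assms(14)[OF \<sigma>(2)])
        show "S (\<sigma> n) \<in> borel_measurable M" for n
          by (rule assms(12)[OF \<sigma>(2)])
        show "AE \<omega> in M. 0 < S (\<sigma> n) \<omega>" for n
          by (rule assms(13)[OF \<sigma>(2)])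
        show "finite J" by (simp add: J_def)
        show "0 \<le> measure L {0<..T m j}" "measure L {0<..T m j} \<le> measure L {0<..T m (Suc j)}" for j
          by (simp, rule cell_L(2))
        show "0 < T m j" for j by (rule grid_bounds(3)[OF T(1)])
        show "0 < s j \<and> s j < 1" for j by (rule s)
        show "(\<lambda>n. \<integral>\<^sup>+\<omega>. extend_infty D (gen_inverse h (S (\<sigma> n) \<omega> * T m j)) \<partial>M)
            \<longlonglongrightarrow> ennreal (measure L {0<..T m j})"
          "(\<lambda>n. \<integral>\<^sup>+\<omega>. extend_infty D (gen_inverse h (S (\<sigma> n) \<omega> * T m (Suc j))) \<partial>M)
            \<longlonglongrightarrow> ennreal (measure L {0<..T m (Suc j)})" for j
          by (rule lim)+
      qed (fact assms(2-6,9-11) h_pos small)+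
      moreover have "exp (- (\<Sum>j\<in>J. (1 - s j) * (measure L {0<..T m (Suc j)} - measure L {0<..T m j}))) =
          (\<Prod>j\<in>J. poisson_pgf (emeasure L (cell T m j)) (s j))"
        unfolding cell_L(1) using cell_L(2) by (simp add: poisson_pgf_def J_def exp_sum sum_negf[symmetric])
      ultimately show "(\<lambda>n. expectation (\<lambda>\<omega>. \<Prod>j\<in>J. count_power (s j) (emeasure (N (\<sigma> n) \<omega>) (cell T m j))))
          \<longlonglongrightarrow> (\<Prod>j\<in>J. poisson_pgf (emeasure L (cell T m j)) (s j))"
        by (simp add: cell_def)
    qed
    moreover have "(\<Prod>j\<in>J. poisson_prob (emeasure L (cell T m j)) (ks ! j)) =
        measure (poisson_law L) {\<nu> \<in> point_measures. \<forall>j\<in>J. emeasure \<nu> (cell T m j) = of_nat (ks ! j)}"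
      by (rule poisson_law_counts[OF L, symmetric]) (simp_all add: J_def cell_pos_borel[OF T(1)] cell_disj[unfolded J_def])
    moreover have "measure (distr M (borel_of vague_topology) (N (\<sigma> n)))
        {\<nu> \<in> point_measures. \<forall>j\<in>J. emeasure \<nu> (cell T m j) = of_nat (ks ! j)} =
        prob {\<omega> \<in> space M. \<forall>j\<in>J. emeasure (N (\<sigma> n) \<omega>) (cell T m j) = of_nat (ks ! j)}" for n
    proof -
      have [measurable]: "(\<lambda>\<nu>. emeasure \<nu> (cell T m j)) \<in> borel_measurable (borel_of vague_topology)" for j
        by (rule evaluation_measurable[OF cell_pos_borel[OF T(1)]])
      have "{\<nu> \<in> space (borel_of vague_topology). \<forall>j\<in>J. emeasure \<nu> (cell T m j) = of_nat (ks ! j)}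
          \<in> sets (borel_of vague_topology)"
        by (simp only: J_def) measurable
      then have "measure (distr M (borel_of vague_topology) (N (\<sigma> n)))
          {\<nu> \<in> point_measures. \<forall>j\<in>J. emeasure \<nu> (cell T m j) = of_nat (ks ! j)} =
          prob (N (\<sigma> n) -` {\<nu> \<in> point_measures. \<forall>j\<in>J. emeasure \<nu> (cell T m j) = of_nat (ks ! j)} \<inter> space M)"
        by (intro measure_distr[OF N_meas]) simp
      also have "N (\<sigma> n) -` {\<nu> \<in> point_measures. \<forall>j\<in>J. emeasure \<nu> (cell T m j) = of_nat (ks ! j)} \<inter> space M =
          {\<omega> \<in> space M. \<forall>j\<in>J. emeasure (N (\<sigma> n) \<omega>) (cell T m j) = of_nat (ks ! j)}"
        using N_point by auto
      finally show ?thesis .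
    qed
    ultimately have lim_counts: "(\<lambda>n. measure (distr M (borel_of vague_topology) (N (\<sigma> n)))
        {\<nu> \<in> point_measures. \<forall>j\<in>J. emeasure \<nu> (cell T m j) = of_nat (ks ! j)}) \<longlonglongrightarrow>
        measure (poisson_law L) {\<nu> \<in> point_measures. \<forall>j\<in>J. emeasure \<nu> (cell T m j) = of_nat (ks ! j)}"
      by simp
    show "(\<lambda>n. measure (distr M (borel_of vague_topology) (N (\<sigma> n))) {\<nu> \<in> point_measures. cell_counts T m \<nu> = ks})
        \<longlonglongrightarrow> measure (poisson_law L) {\<nu> \<in> point_measures. cell_counts T m \<nu> = ks}"
    proof (cases "length ks = grid_size m")
      case True
      show ?thesis unfolding counts_eq[OF True] by (rule lim_counts)
    next
      case False
      then have "{\<nu> \<in> point_measures. cell_counts T m \<nu> = ks} = {}"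
        by (auto simp: cell_counts_def)
      then show ?thesis by (simp only: measure_empty tendsto_const)
    qed
  qed simp
  show "weak_convergence vague_topology (\<lambda>\<sigma>. distr M (borel_of vague_topology) (N \<sigma>)) (poisson_law L) at_top"
    unfolding weak_convergence_def
  proof (intro allI impI tendsto_at_topI_sequentially)
    fix \<phi> and X :: "nat \<Rightarrow> real"
    assume \<phi>: "continuous_map vague_topology euclideanreal \<phi> \<and> bounded (\<phi> ` topspace vague_topology)"
      and X: "filterlim X at_top sequentially"
    have eq: "\<forall>\<^sub>F n in sequentially. max 0 (X n) = X n"
      using filterlim_at_top[THEN iffD1, OF X, rule_format, of 0] by eventually_elim simp
    \<comment> \<open>The hypotheses speak of nonnegative parameters only, so a sequence tending
      to infinity is truncated at \<open>0\<close>, which eventually changes nothing.\<close>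
    have "filterlim (\<lambda>n. max 0 (X n)) at_top sequentially"
      by (rule filterlim_at_top_mono[OF X]) simp
    from along[OF this] have "(\<lambda>n. \<integral>\<nu>. \<phi> \<nu> \<partial>distr M (borel_of vague_topology) (N (max 0 (X n))))
        \<longlonglongrightarrow> (\<integral>\<nu>. \<phi> \<nu> \<partial>poisson_law L)"
      using \<phi> by (simp add: weak_convergence_def)
    then show "(\<lambda>n. \<integral>\<nu>. \<phi> \<nu> \<partial>distr M (borel_of vague_topology) (N (X n))) \<longlonglongrightarrow> (\<integral>\<nu>. \<phi> \<nu> \<partial>poisson_law L)"
    proof (rule Lim_transform_eventually)
      show "\<forall>\<^sub>F n in sequentially. (\<integral>\<nu>. \<phi> \<nu> \<partial>distr M (borel_of vague_topology) (N (max 0 (X n)))) =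
          (\<integral>\<nu>. \<phi> \<nu> \<partial>distr M (borel_of vague_topology) (N (X n)))"
        using eq by eventually_elim simp
    qed
  qed
qed

end
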